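(* Let $X$ and $Y$ be essentially finite groupoids. A functor $f:Y\to X$ gives two 2-linear maps between Kapranov–Voevodsky 2-vector spaces: the pullback along $f$, $$f^*:[X,\mathrm{Vect}]\to[Y,\mathrm{Vect}],\qquad f^*(F)=F\circ f,$$ and the pushforward along $f$, $$f_*:[Y,\mathrm{Vect}]\to[X,\mathrm{Vect}],$$ which is a two-sided adjoint to $f^*$ (that is, both a left adjoint and a right adjoint of $f^*$).
   Context: Vect is the category of finite-dimensional complex vector spaces. A groupoid is essentially finite if it is equivalent to a finite groupoid (finitely many objects and morphisms). $[X,\mathrm{Vect}]$ is the category of functors $X\to\mathrm{Vect}$ and natural transformations. A $\mathbb{C}$-linear additive category is a category enriched in Vect (bilinear composition), with a zero object and finite biproducts; an object $x$ is simple if $\hom(x,x)\cong\mathbb{C}$. A Kapranov–Voevodsky 2-vector space is a $\mathbb{C}$-linear additive category which is semisimple (every object is a finite biproduct of simple objects), with finitely many simple objects up to isomorphism. A 2-linear map between 2-vector spaces is a $\mathbb{C}$-linear functor. *)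

theory Defs
  imports "Jordan_Normal_Form.VS_Connect"
begin

subsection \<open>Categories, groupoids, functors\<close>

text \<open>Hom-sets are indexed by source and target and need not be disjoint; therefore composition
  takes the three objects involved: \<open>Comp C x y z g f\<close> is \<open>g \<circ> f : x \<rightarrow> y \<rightarrow> z\<close>.\<close>

record ('o, 'a) cat =
  Obj :: "'o set"
  Hom :: "'o \<Rightarrow> 'o \<Rightarrow> 'a set"
  Ident :: "'o \<Rightarrow> 'a"
  Comp :: "'o \<Rightarrow> 'o \<Rightarrow> 'o \<Rightarrow> 'a \<Rightarrow> 'a \<Rightarrow> 'a"

locale category =
  fixes C :: "('o, 'a, 'm) cat_scheme"
  assumes Ident_closed: "x \<in> Obj C \<Longrightarrow> Ident C x \<in> Hom C x x"
    and Comp_closed: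
      "\<lbrakk>x \<in> Obj C; y \<in> Obj C; z \<in> Obj C; f \<in> Hom C x y; g \<in> Hom C y z\<rbrakk>
        \<Longrightarrow> Comp C x y z g f \<in> Hom C x z"
    and Comp_Ident_left:
      "\<lbrakk>x \<in> Obj C; y \<in> Obj C; f \<in> Hom C x y\<rbrakk> \<Longrightarrow> Comp C x y y (Ident C y) f = f"
    and Comp_Ident_right:
      "\<lbrakk>x \<in> Obj C; y \<in> Obj C; f \<in> Hom C x y\<rbrakk> \<Longrightarrow> Comp C x x y f (Ident C x) = f"
    and Comp_assoc:
      "\<lbrakk>w \<in> Obj C; x \<in> Obj C; y \<in> Obj C; z \<in> Obj C;
        f \<in> Hom C w x; g \<in> Hom C x y; h \<in> Hom C y z\<rbrakk>
        \<Longrightarrow> Comp C w x z (Comp C x y z h g) f = Comp C w y z h (Comp C w x y g f)"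

definition iso_arrow :: "('o, 'a, 'm) cat_scheme \<Rightarrow> 'o \<Rightarrow> 'o \<Rightarrow> 'a \<Rightarrow> bool" where
  "iso_arrow C x y f \<longleftrightarrow> f \<in> Hom C x y \<and>
     (\<exists>g \<in> Hom C y x. Comp C x y x g f = Ident C x \<and> Comp C y x y f g = Ident C y)"

definition isomorphic :: "('o, 'a, 'm) cat_scheme \<Rightarrow> 'o \<Rightarrow> 'o \<Rightarrow> bool" where
  "isomorphic C x y \<longleftrightarrow> (\<exists>f. iso_arrow C x y f)"

locale groupoid = category +
  assumes all_iso: "\<lbrakk>x \<in> Obj C; y \<in> Obj C; f \<in> Hom C x y\<rbrakk> \<Longrightarrow> iso_arrow C x y f"

definition finite_category :: "('o, 'a, 'm) cat_scheme \<Rightarrow> bool" where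
  "finite_category C \<longleftrightarrow> finite (Obj C) \<and> (\<forall>x \<in> Obj C. \<forall>y \<in> Obj C. finite (Hom C x y))"

record ('o, 'a, 'p, 'b) func =
  on_obj :: "'o \<Rightarrow> 'p"
  on_arr :: "'o \<Rightarrow> 'o \<Rightarrow> 'a \<Rightarrow> 'b"

text \<open>Functors and natural transformations are extensional functions, so that equality of the
  representations is equality of functors and of natural transformations.\<close>

locale cat_functor = dom: category C + cod: category D
  for C :: "('o, 'a, 'm) cat_scheme" and D :: "('p, 'b, 'n) cat_scheme" +
  fixes F :: "('o, 'a, 'p, 'b) func"
  assumes on_obj: "on_obj F \<in> Obj C \<rightarrow>\<^sub>E Obj D"
    and on_arr: "on_arr F \<in>
      (\<Pi>\<^sub>E x \<in> Obj C. \<Pi>\<^sub>E y \<in> Obj C. Hom C x y \<rightarrow>\<^sub>E Hom D (on_obj F x) (on_obj F y))"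
    and on_arr_Ident:
      "x \<in> Obj C \<Longrightarrow> on_arr F x x (Ident C x) = Ident D (on_obj F x)"
    and on_arr_Comp:
      "\<lbrakk>x \<in> Obj C; y \<in> Obj C; z \<in> Obj C; f \<in> Hom C x y; g \<in> Hom C y z\<rbrakk>
        \<Longrightarrow> on_arr F x z (Comp C x y z g f) =
          Comp D (on_obj F x) (on_obj F y) (on_obj F z) (on_arr F y z g) (on_arr F x y f)"

definition id_functor :: "('o, 'a, 'm) cat_scheme \<Rightarrow> ('o, 'a, 'o, 'a) func" where
  "id_functor C = \<lparr>on_obj = (\<lambda>x \<in> Obj C. x),
     on_arr = (\<lambda>x \<in> Obj C. \<lambda>y \<in> Obj C. \<lambda>f \<in> Hom C x y. f)\<rparr>"

text \<open>\<open>comp_functor C G F\<close> is \<open>G \<circ> F\<close>, where \<open>C\<close> is the source of \<open>F\<close>.\<close>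

definition comp_functor ::
  "('o, 'a, 'm) cat_scheme \<Rightarrow> ('p, 'b, 'q, 'c) func \<Rightarrow> ('o, 'a, 'p, 'b) func
    \<Rightarrow> ('o, 'a, 'q, 'c) func" where
  "comp_functor C G F = \<lparr>on_obj = (\<lambda>x \<in> Obj C. on_obj G (on_obj F x)),
     on_arr = (\<lambda>x \<in> Obj C. \<lambda>y \<in> Obj C. \<lambda>f \<in> Hom C x y.
       on_arr G (on_obj F x) (on_obj F y) (on_arr F x y f))\<rparr>"

definition nat_trans ::
  "('o, 'a, 'm) cat_scheme \<Rightarrow> ('p, 'b, 'n) cat_scheme
    \<Rightarrow> ('o, 'a, 'p, 'b) func \<Rightarrow> ('o, 'a, 'p, 'b) func \<Rightarrow> ('o \<Rightarrow> 'b) set" where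
  "nat_trans C D F G = {\<eta> \<in> (\<Pi>\<^sub>E x \<in> Obj C. Hom D (on_obj F x) (on_obj G x)).
     \<forall>x \<in> Obj C. \<forall>y \<in> Obj C. \<forall>f \<in> Hom C x y.
       Comp D (on_obj F x) (on_obj F y) (on_obj G y) (\<eta> y) (on_arr F x y f) =
       Comp D (on_obj F x) (on_obj G x) (on_obj G y) (on_arr G x y f) (\<eta> x)}"

definition nat_isomorphic ::
  "('o, 'a, 'm) cat_scheme \<Rightarrow> ('p, 'b, 'n) cat_scheme
    \<Rightarrow> ('o, 'a, 'p, 'b) func \<Rightarrow> ('o, 'a, 'p, 'b) func \<Rightarrow> bool" where
  "nat_isomorphic C D F G \<longleftrightarrow> (\<exists>\<eta> \<in> nat_trans C D F G.
     \<forall>x \<in> Obj C. iso_arrow D (on_obj F x) (on_obj G x) (\<eta> x))"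

definition equivalent_categories ::
  "('o, 'a, 'm) cat_scheme \<Rightarrow> ('p, 'b, 'n) cat_scheme \<Rightarrow> bool" where
  "equivalent_categories C D \<longleftrightarrow> (\<exists>F G. cat_functor C D F \<and> cat_functor D C G \<and>
     nat_isomorphic C C (comp_functor C G F) (id_functor C) \<and>
     nat_isomorphic D D (comp_functor D F G) (id_functor D))"

text \<open>A type cannot be quantified inside a formula, so the finite groupoid is taken with objects
  and arrows in \<open>nat\<close>; \<open>essentially_finiteI\<close> below shows that this is no
  restriction.\<close>

definition essentially_finite :: "('o, 'a, 'm) cat_scheme \<Rightarrow> bool" where
  "essentially_finite C \<longleftrightarrow>
     (\<exists>G :: (nat, nat) cat. groupoid G \<and> finite_category G \<and> equivalent_categories C G)"

lemma essentially_finiteI: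
  fixes C :: "('o, 'a, 'm) cat_scheme" and G :: "('p, 'b, 'n) cat_scheme"
  assumes gr: "groupoid G" and fin: "finite_category G" and eq: "equivalent_categories C G"
  shows "essentially_finite C"
proof -
  interpret G: groupoid G by (rule gr)
  define A where "A = (\<Union>x\<in>Obj G. \<Union>y\<in>Obj G. Hom G x y)"
  have "finite (Obj G)" "finite A"
    using fin by (auto simp: finite_category_def A_def)
  then obtain e :: "'p \<Rightarrow> nat" and h :: "'b \<Rightarrow> nat"
    where inj: "inj_on e (Obj G)" "inj_on h A"
    using finite_imp_inj_to_nat_seg by metis
  define d where "d = inv_into (Obj G) e"
  define k where "k = inv_into A h"
  have de: "d (e x) = x" if "x \<in> Obj G" for x
    using that inj by (simp add: d_def)
  have kh: "k (h a) = a" if "a \<in> Hom G x y" "x \<in> Obj G" "y \<in> Obj G" for a x y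
    using that inj by (auto simp: k_def A_def intro!: inv_into_f_f)
  define N :: "(nat, nat) cat" where
    "N = \<lparr>Obj = e ` Obj G, Hom = (\<lambda>m n. h ` Hom G (d m) (d n)), Ident = (\<lambda>m. h (Ident G (d m))),
      Comp = (\<lambda>l m n b a. h (Comp G (d l) (d m) (d n) (k b) (k a)))\<rparr>"
  have N: "Obj N = e ` Obj G" "Hom N m n = h ` Hom G (d m) (d n)" "Ident N m = h (Ident G (d m))"
    "Comp N l m n b a = h (Comp G (d l) (d m) (d n) (k b) (k a))" for l m n a b
    by (simp_all add: N_def)
  note G = G.Ident_closed G.Comp_closed G.Comp_Ident_left G.Comp_Ident_right
  have khI: "k (h (Ident G x)) = Ident G x" if "x \<in> Obj G" for x
    using kh G that by metis
  have khC: "k (h (Comp G x y z b a)) = Comp G x y z b a"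
    if "x \<in> Obj G" "y \<in> Obj G" "z \<in> Obj G" "a \<in> Hom G x y" "b \<in> Hom G y z" for x y z a b
    using kh G that by metis
  interpret N: category N
    by standard (auto simp: N de kh khI khC G G.Comp_assoc)
  have iso_N: "iso_arrow N (e x) (e y) (h a)" if a: "iso_arrow G x y a" "x \<in> Obj G" "y \<in> Obj G" for x y a
  proof -
    obtain b where b: "a \<in> Hom G x y" "b \<in> Hom G y x"
      "Comp G x y x b a = Ident G x" "Comp G y x y a b = Ident G y"
      using a(1) by (auto simp: iso_arrow_def)
    have "k (h a) = a" "k (h b) = b"
      using kh b a by metis+
    with b a(2,3) show ?thesis
      by (auto simp: iso_arrow_def N de intro!: bexI[of _ b])
  qed
  have grN: "groupoid N"
    by standard (auto simp: N(1,2) de intro!: iso_N G.all_iso)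
  have finN: "finite_category N"
    using fin by (auto simp: finite_category_def N de)
  obtain F K \<eta> \<epsilon> where F: "cat_functor C G F" and K: "cat_functor G C K"
    and \<eta>: "\<eta> \<in> nat_trans C C (comp_functor C K F) (id_functor C)"
      "\<And>x. x \<in> Obj C \<Longrightarrow> iso_arrow C (on_obj (comp_functor C K F) x) (on_obj (id_functor C) x) (\<eta> x)"
    and \<epsilon>: "\<epsilon> \<in> nat_trans G G (comp_functor G F K) (id_functor G)"
      "\<And>x. x \<in> Obj G \<Longrightarrow> iso_arrow G (on_obj (comp_functor G F K) x) (on_obj (id_functor G) x) (\<epsilon> x)"
    using eq unfolding equivalent_categories_def nat_isomorphic_def by blast
  interpret F: cat_functor C G F by (rule F)
  interpret K: cat_functor G C K by (rule K)
  have Fo: "on_obj F x \<in> Obj G" if "x \<in> Obj C" for x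
    using F.on_obj that by auto
  have Ko: "on_obj K x \<in> Obj C" if "x \<in> Obj G" for x
    using K.on_obj that by auto
  have Fa: "on_arr F x y a \<in> Hom G (on_obj F x) (on_obj F y)"
    if "x \<in> Obj C" "y \<in> Obj C" "a \<in> Hom C x y" for x y a
    using F.on_arr that by (auto simp: PiE_iff)
  have Ka: "on_arr K x y a \<in> Hom C (on_obj K x) (on_obj K y)"
    if "x \<in> Obj G" "y \<in> Obj G" "a \<in> Hom G x y" for x y a
    using K.on_arr that by (auto simp: PiE_iff)
  have khF: "k (h (on_arr F x y a)) = on_arr F x y a"
    if "x \<in> Obj C" "y \<in> Obj C" "a \<in> Hom C x y" for x y a
    using kh Fa Fo that by metis
  define F' where "F' = \<lparr>on_obj = (\<lambda>x \<in> Obj C. e (on_obj F x)),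
    on_arr = (\<lambda>x \<in> Obj C. \<lambda>y \<in> Obj C. \<lambda>a \<in> Hom C x y. h (on_arr F x y a))\<rparr>"
  define K' where "K' = \<lparr>on_obj = (\<lambda>m \<in> Obj N. on_obj K (d m)),
    on_arr = (\<lambda>m \<in> Obj N. \<lambda>n \<in> Obj N. \<lambda>b \<in> Hom N m n. on_arr K (d m) (d n) (k b))\<rparr>"
  note CG = F.dom.Ident_closed F.dom.Comp_closed
  have F': "cat_functor C N F'"
    by standard
      (auto simp: F'_def N(1,2) Fo Fa CG de, auto simp: N Fo Fa khF de F.on_arr_Ident F.on_arr_Comp)
  have K': "cat_functor N C K'"
    by standard
      (auto simp: K'_def N de kh Ko Ka G K.on_arr_Ident K.on_arr_Comp,
       metis khI kh K.on_arr_Ident, metis khC kh K.on_arr_Comp)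
  have "comp_functor C K' F' = comp_functor C K F"
    by (auto simp: comp_functor_def K'_def F'_def N Fo de Fa khF intro!: restrict_ext)
  then have 1: "nat_isomorphic C C (comp_functor C K' F') (id_functor C)"
    using \<eta> by (auto simp: nat_isomorphic_def)
  define \<epsilon>' where "\<epsilon>' = (\<lambda>m \<in> Obj N. h (\<epsilon> (d m)))"
  have \<epsilon>a: "\<epsilon> x \<in> Hom G (on_obj F (on_obj K x)) x" if "x \<in> Obj G" for x
    using \<epsilon>(1) that by (force simp: nat_trans_def comp_functor_def id_functor_def PiE_iff)
  have \<epsilon>i: "iso_arrow G (on_obj F (on_obj K x)) x (\<epsilon> x)" if "x \<in> Obj G" for x
    using \<epsilon>(2) that by (auto simp: comp_functor_def id_functor_def)
  have kh\<epsilon>: "k (h (\<epsilon> x)) = \<epsilon> x" if "x \<in> Obj G" for x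
    using kh \<epsilon>a Fo Ko that by metis
  have \<epsilon>n: "Comp G (on_obj F (on_obj K x)) (on_obj F (on_obj K y)) y (\<epsilon> y)
      (on_arr F (on_obj K x) (on_obj K y) (on_arr K x y a)) =
      Comp G (on_obj F (on_obj K x)) x y a (\<epsilon> x)"
    if "x \<in> Obj G" "y \<in> Obj G" "a \<in> Hom G x y" for x y a
    using \<epsilon>(1) that by (auto simp: nat_trans_def comp_functor_def id_functor_def)
  have "\<epsilon>' \<in> nat_trans N N (comp_functor N F' K') (id_functor N)"
    by (auto simp: nat_trans_def comp_functor_def id_functor_def \<epsilon>'_def F'_def K'_def N de kh
      Fo Ko Fa Ka khF kh\<epsilon> \<epsilon>a \<epsilon>n)
  moreover have "iso_arrow N (on_obj (comp_functor N F' K') m) (on_obj (id_functor N) m) (\<epsilon>' m)"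
    if "m \<in> Obj N" for m
    using that by (auto simp: comp_functor_def id_functor_def \<epsilon>'_def F'_def K'_def N(1) de
      Fo Ko intro!: iso_N \<epsilon>i)
  ultimately have 2: "nat_isomorphic N N (comp_functor N F' K') (id_functor N)"
    by (auto simp: nat_isomorphic_def)
  show ?thesis
    unfolding essentially_finite_def equivalent_categories_def
    using grN finN F' K' 1 2 by blast
qed

text \<open>Unit-counit form of an adjunction, \<open>L : C \<rightarrow> D\<close> being left adjoint to
  \<open>R : D \<rightarrow> C\<close>.\<close>

definition left_adjoint ::
  "('o, 'a, 'm) cat_scheme \<Rightarrow> ('p, 'b, 'n) cat_scheme
    \<Rightarrow> ('o, 'a, 'p, 'b) func \<Rightarrow> ('p, 'b, 'o, 'a) func \<Rightarrow> bool" where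
  "left_adjoint C D L R \<longleftrightarrow> cat_functor C D L \<and> cat_functor D C R \<and>
     (\<exists>\<eta> \<in> nat_trans C C (id_functor C) (comp_functor C R L).
      \<exists>\<epsilon> \<in> nat_trans D D (comp_functor D L R) (id_functor D).
        (\<forall>x \<in> Obj C.
           (let Lx = on_obj L x; RLx = on_obj R Lx; LRLx = on_obj L RLx
            in Comp D Lx LRLx Lx (\<epsilon> Lx) (on_arr L x RLx (\<eta> x)) = Ident D Lx)) \<and>
        (\<forall>y \<in> Obj D.
           (let Ry = on_obj R y; LRy = on_obj L Ry; RLRy = on_obj R LRy
            in Comp C Ry RLRy Ry (on_arr R LRy y (\<epsilon> y)) (\<eta> Ry) = Ident C Ry)))"


subsection \<open>Linear categories and 2-vector spaces\<close>

definition fd_space :: "(complex, 'v) module \<Rightarrow> bool" where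
  "fd_space V \<longleftrightarrow> vectorspace class_ring V \<and> vectorspace.fin_dim class_ring V"

abbreviation lin_hom :: "(complex, 'v) module \<Rightarrow> (complex, 'w) module \<Rightarrow> ('v \<Rightarrow> 'w) set" where
  "lin_hom V W \<equiv> LinearCombinations.module_hom class_ring V W"

definition vs_isomorphic :: "(complex, 'v) module \<Rightarrow> (complex, 'w) module \<Rightarrow> bool" where
  "vs_isomorphic V W \<longleftrightarrow>
     (\<exists>\<phi> \<in> lin_hom V W. bij_betw \<phi> (carrier V) (carrier W))"

definition complex_line :: "(complex, complex) module" where
  "complex_line = \<lparr>carrier = UNIV, mult = (*), one = 1, zero = 0, add = (+), smult = (*)\<rparr>"

record ('o, 'a) linear_cat = "('o, 'a) cat" +
  Hom_space :: "'o \<Rightarrow> 'o \<Rightarrow> (complex, 'a) module"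

locale linear_category = category C for C :: "('o, 'a) linear_cat" +
  assumes carrier_Hom_space:
      "\<lbrakk>x \<in> Obj C; y \<in> Obj C\<rbrakk> \<Longrightarrow> carrier (Hom_space C x y) = Hom C x y"
    and fd_Hom_space: "\<lbrakk>x \<in> Obj C; y \<in> Obj C\<rbrakk> \<Longrightarrow> fd_space (Hom_space C x y)"
    and Comp_linear_left:
      "\<lbrakk>x \<in> Obj C; y \<in> Obj C; z \<in> Obj C; f \<in> Hom C x y\<rbrakk>
        \<Longrightarrow> (\<lambda>g. Comp C x y z g f) \<in> lin_hom (Hom_space C y z) (Hom_space C x z)"
    and Comp_linear_right:
      "\<lbrakk>x \<in> Obj C; y \<in> Obj C; z \<in> Obj C; g \<in> Hom C y z\<rbrakk>
        \<Longrightarrow> (\<lambda>f. Comp C x y z g f) \<in> lin_hom (Hom_space C x y) (Hom_space C x z)"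

definition zero_object :: "('o, 'a, 'm) cat_scheme \<Rightarrow> 'o \<Rightarrow> bool" where
  "zero_object C z \<longleftrightarrow> z \<in> Obj C \<and>
     (\<forall>x \<in> Obj C. (\<exists>!f. f \<in> Hom C z x) \<and> (\<exists>!f. f \<in> Hom C x z))"

text \<open>\<open>biproduct C n xs s\<close>: \<open>s\<close> is a biproduct of the family
  \<open>xs 0, \<dots>, xs (n - 1)\<close>, with injections \<open>i\<close> and projections \<open>p\<close>.\<close>

definition biproduct :: "('o, 'a) linear_cat \<Rightarrow> nat \<Rightarrow> (nat \<Rightarrow> 'o) \<Rightarrow> 'o \<Rightarrow> bool" where
  "biproduct C n xs s \<longleftrightarrow> s \<in> Obj C \<and> (\<exists>i p.
     (\<forall>k < n. i k \<in> Hom C (xs k) s \<and> p k \<in> Hom C s (xs k)) \<and>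
     (\<forall>j < n. \<forall>k < n. Comp C (xs k) s (xs j) (p j) (i k) =
        (if j = k then Ident C (xs k) else \<zero>\<^bsub>Hom_space C (xs k) (xs j)\<^esub>)) \<and>
     (\<Oplus>\<^bsub>Hom_space C s s\<^esub> k \<in> {..<n}. Comp C s (xs k) s (i k) (p k)) = Ident C s)"

locale additive_linear_category = linear_category +
  assumes ex_zero_object: "\<exists>z. zero_object C z"
    and ex_biproduct: "\<forall>k < n. xs k \<in> Obj C \<Longrightarrow> \<exists>s. biproduct C n xs s"

definition simple_object :: "('o, 'a) linear_cat \<Rightarrow> 'o \<Rightarrow> bool" where
  "simple_object C x \<longleftrightarrow> x \<in> Obj C \<and> vs_isomorphic (Hom_space C x x) complex_line"

locale two_vector_space = additive_linear_category +
  assumes semisimple: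
      "x \<in> Obj C \<Longrightarrow> \<exists>n xs. (\<forall>k < n. simple_object C (xs k)) \<and> biproduct C n xs x"
    and finitely_many_simples:
      "\<exists>S. finite S \<and> (\<forall>s \<in> S. simple_object C s) \<and>
        (\<forall>x. simple_object C x \<longrightarrow> (\<exists>s \<in> S. isomorphic C x s))"

locale linear_functor = dom: linear_category C + cod: linear_category D + cat_functor C D F
  for C :: "('o, 'a) linear_cat" and D :: "('p, 'b) linear_cat"
    and F :: "('o, 'a, 'p, 'b) func" +
  assumes on_arr_linear: "\<lbrakk>x \<in> Obj C; y \<in> Obj C\<rbrakk> \<Longrightarrow>
    on_arr F x y \<in> lin_hom (Hom_space C x y) (Hom_space D (on_obj F x) (on_obj F y))"

locale two_linear_map = source: two_vector_space C + target: two_vector_space D + linear_functor C D F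
  for C :: "('o, 'a) linear_cat" and D :: "('p, 'b) linear_cat"
    and F :: "('o, 'a, 'p, 'b) func"


subsection \<open>Vector spaces and functor categories\<close>

text \<open>The finite-dimensional complex vector spaces whose underlying set lies in the type \<open>'v\<close>,
  which plays the role of the universe of sets. As soon as \<open>'v\<close> has at least the cardinality of
  the continuum, every finite-dimensional complex vector space is isomorphic to one of these.
  The fields \<open>mult\<close> and \<open>one\<close>, inherited by \<^typ>\<open>(complex, 'v) module\<close> from rings, carry no
  information.\<close>

type_synonym 'v vect_cat = "((complex, 'v) module, 'v \<Rightarrow> 'v) linear_cat"

definition linear_maps :: "(complex, 'v) module \<Rightarrow> (complex, 'v) module \<Rightarrow> ('v \<Rightarrow> 'v) set" where
  "linear_maps V W = lin_hom V W \<inter> extensional (carrier V)"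

definition Vect :: "'v vect_cat" where
  "Vect = \<lparr>Obj = {V. fd_space V},
     Hom = linear_maps,
     Ident = (\<lambda>V. \<lambda>v \<in> carrier V. v),
     Comp = (\<lambda>U V W g f. compose (carrier U) g f),
     Hom_space = (\<lambda>V W.
       \<lparr>carrier = linear_maps V W,
        mult = (\<lambda>f g. \<lambda>v \<in> carrier V. \<zero>\<^bsub>W\<^esub>),
        one = (\<lambda>v \<in> carrier V. \<zero>\<^bsub>W\<^esub>),
        zero = (\<lambda>v \<in> carrier V. \<zero>\<^bsub>W\<^esub>),
        add = (\<lambda>f g. \<lambda>v \<in> carrier V. f v \<oplus>\<^bsub>W\<^esub> g v),
        smult = (\<lambda>c f. \<lambda>v \<in> carrier V. c \<odot>\<^bsub>W\<^esub> f v)\<rparr>)\<rparr>"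

text \<open>The category \<open>[C, D]\<close>, with the pointwise linear structure of \<open>D\<close> on natural
  transformations.\<close>

definition functor_category ::
  "('o, 'a, 'm) cat_scheme \<Rightarrow> ('p, 'b) linear_cat \<Rightarrow> (('o, 'a, 'p, 'b) func, 'o \<Rightarrow> 'b) linear_cat" where
  "functor_category C D = \<lparr>Obj = {F. cat_functor C D F},
     Hom = nat_trans C D,
     Ident = (\<lambda>F. \<lambda>x \<in> Obj C. Ident D (on_obj F x)),
     Comp = (\<lambda>F G H \<theta> \<eta>. \<lambda>x \<in> Obj C. Comp D (on_obj F x) (on_obj G x) (on_obj H x) (\<theta> x) (\<eta> x)),
     Hom_space = (\<lambda>F G.
       \<lparr>carrier = nat_trans C D F G,
        mult = (\<lambda>\<eta> \<theta>. \<lambda>x \<in> Obj C. \<zero>\<^bsub>Hom_space D (on_obj F x) (on_obj G x)\<^esub>),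
        one = (\<lambda>x \<in> Obj C. \<zero>\<^bsub>Hom_space D (on_obj F x) (on_obj G x)\<^esub>),
        zero = (\<lambda>x \<in> Obj C. \<zero>\<^bsub>Hom_space D (on_obj F x) (on_obj G x)\<^esub>),
        add = (\<lambda>\<eta> \<theta>. \<lambda>x \<in> Obj C. \<eta> x \<oplus>\<^bsub>Hom_space D (on_obj F x) (on_obj G x)\<^esub> \<theta> x),
        smult = (\<lambda>c \<eta>. \<lambda>x \<in> Obj C. c \<odot>\<^bsub>Hom_space D (on_obj F x) (on_obj G x)\<^esub> \<eta> x)\<rparr>)\<rparr>"

definition pullback ::
  "('y, 'b, 'm) cat_scheme \<Rightarrow> ('x, 'a, 'n) cat_scheme \<Rightarrow> ('p, 'c) linear_cat \<Rightarrow> ('y, 'b, 'x, 'a) func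
    \<Rightarrow> (('x, 'a, 'p, 'c) func, 'x \<Rightarrow> 'c, ('y, 'b, 'p, 'c) func, 'y \<Rightarrow> 'c) func" where
  "pullback Y X D f = \<lparr>on_obj = (\<lambda>F \<in> Obj (functor_category X D). comp_functor Y F f),
     on_arr = (\<lambda>F \<in> Obj (functor_category X D). \<lambda>G \<in> Obj (functor_category X D).
       \<lambda>\<eta> \<in> Hom (functor_category X D) F G. \<lambda>y \<in> Obj Y. \<eta> (on_obj f y))\<rparr>"

end

theory Submission
  imports "HOL-Computational_Algebra.Fundamental_Theorem_Algebra" Defs
begin

text \<open>At \<open>x\<close>, the pushforward of \<open>F\<close> is a single space that is both the limit and the colimit of
  \<open>F\<close> over the pairs of an object \<open>y\<close> and an arrow \<open>a : f y \<rightarrow> x\<close>: the compatible families of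
  vectors, with cone \<open>\<pi>\<close> given by evaluation and cocone \<open>\<iota>\<close> given by summation over the arrows of
  \<open>Y\<close> between two such pairs. Let \<open>S\<close> be a finite set of objects with weights \<open>w\<close> such that
  \<open>\<Sum>s\<in>S. w s \<cdot> |Hom (s, y)|\<close> is 1 for all \<open>y\<close>. Then the sum of the \<open>w s \<cdot> \<iota> \<circ> \<pi>\<close>
  over the pairs with \<open>s \<in> S\<close> is the identity, which gives both universal properties and hence both
  adjunctions.

  The functor categories are 2-vector spaces because every arrow \<open>f\<close> has a \<open>g\<close> with
  \<open>f \<circ> g \<circ> f = f\<close> (by linear algebra pointwise, then by averaging), idempotents split,
  and there is a generator, namely the pushforward of a constant functor from the discrete groupoid
  on \<open>S\<close>. Indeed, subtracting an eigenvalue from a non-scalar endomorphism and taking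
  \<open>g \<circ> f\<close> for the result \<open>f\<close> yields a nontrivial idempotent, so every object decomposes into
  simple ones; and a nonzero arrow between simple objects, such as one from a summand of the
  generator, is invertible.\<close>

subsection \<open>Complex vector spaces\<close>

text \<open>Two obstacles shape the proof. The groupoids are only essentially finite, so a natural
  transformation or a compatible family may have infinitely many components; finite dimension comes
  from a finite set of components that determines the others, namely those at \<open>S\<close>. And
  the spaces of \<open>Vect\<close> live in one arbitrary type \<open>'v\<close>, which may be too
  small for a copy of the complex line; so each new space has to be transported back into
  \<open>'v\<close>, and the generator is built from whatever nonzero space exists. Limit and
  colimit agree because the pairs form a groupoid again: \<open>\<pi> \<circ> \<iota>\<close> is
  prescribed as the sum of \<open>F b\<close> over the arrows \<open>b\<close> between two pairs, a
  norm map, and it identifies colimit with limit because the numbers of arrows that occur can be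
  inverted in the scalars. This is the only place where the two adjoints could differ. The measure
  that replaces dimension in the inductions is the size of a finite family of functionals with
  trivial common kernel: it needs no bases and is easily inherited by subspaces.\<close>

abbreviation cspace :: "(complex, 'v) module \<Rightarrow> bool" where
  "cspace V \<equiv> vectorspace class_ring V"

lemma fd_space_cspace: "fd_space V \<Longrightarrow> cspace V"
  by (simp add: fd_space_def)

context
  fixes V :: "(complex, 'v) module"
  assumes V: "cspace V"
begin

interpretation vectorspace class_ring V by (rule V)

lemma vs_zero_closed [simp]: "\<zero>\<^bsub>V\<^esub> \<in> carrier V" by simp

lemma vs_add_closed [simp]: "u \<in> carrier V \<Longrightarrow> v \<in> carrier V \<Longrightarrow> u \<oplus>\<^bsub>V\<^esub> v \<in> carrier V" by simp

lemma vs_smult_closed [simp]: "v \<in> carrier V \<Longrightarrow> c \<odot>\<^bsub>V\<^esub> v \<in> carrier V" by simp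

lemma vs_add_zero [simp]: "v \<in> carrier V \<Longrightarrow> v \<oplus>\<^bsub>V\<^esub> \<zero>\<^bsub>V\<^esub> = v"
  and vs_zero_add [simp]: "v \<in> carrier V \<Longrightarrow> \<zero>\<^bsub>V\<^esub> \<oplus>\<^bsub>V\<^esub> v = v" by simp_all

lemma vs_add_comm: "u \<in> carrier V \<Longrightarrow> v \<in> carrier V \<Longrightarrow> u \<oplus>\<^bsub>V\<^esub> v = v \<oplus>\<^bsub>V\<^esub> u"
  by (rule M.a_comm)

lemma vs_add_assoc:
  "u \<in> carrier V \<Longrightarrow> v \<in> carrier V \<Longrightarrow> w \<in> carrier V \<Longrightarrow> u \<oplus>\<^bsub>V\<^esub> v \<oplus>\<^bsub>V\<^esub> w = u \<oplus>\<^bsub>V\<^esub> (v \<oplus>\<^bsub>V\<^esub> w)"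
  by (rule M.a_assoc)

lemma vs_add_left_comm:
  "u \<in> carrier V \<Longrightarrow> v \<in> carrier V \<Longrightarrow> w \<in> carrier V \<Longrightarrow> u \<oplus>\<^bsub>V\<^esub> (v \<oplus>\<^bsub>V\<^esub> w) = v \<oplus>\<^bsub>V\<^esub> (u \<oplus>\<^bsub>V\<^esub> w)"
  by (rule M.a_lcomm)

lemma vs_one_smult [simp]: "v \<in> carrier V \<Longrightarrow> 1 \<odot>\<^bsub>V\<^esub> v = v"
  using smult_one by simp

lemma vs_zero_smult [simp]: "v \<in> carrier V \<Longrightarrow> 0 \<odot>\<^bsub>V\<^esub> v = \<zero>\<^bsub>V\<^esub>"
  using lmult_0 by simp

lemma vs_smult_zero [simp]: "c \<odot>\<^bsub>V\<^esub> \<zero>\<^bsub>V\<^esub> = \<zero>\<^bsub>V\<^esub>"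
  using rmult_0 by simp

lemma vs_smult_add:
  "u \<in> carrier V \<Longrightarrow> v \<in> carrier V \<Longrightarrow> c \<odot>\<^bsub>V\<^esub> (u \<oplus>\<^bsub>V\<^esub> v) = c \<odot>\<^bsub>V\<^esub> u \<oplus>\<^bsub>V\<^esub> c \<odot>\<^bsub>V\<^esub> v"
  using smult_r_distr by simp

lemma vs_add_smult: "v \<in> carrier V \<Longrightarrow> (a + b) \<odot>\<^bsub>V\<^esub> v = a \<odot>\<^bsub>V\<^esub> v \<oplus>\<^bsub>V\<^esub> b \<odot>\<^bsub>V\<^esub> v"
  using smult_l_distr[of a b v] by simp

lemma vs_smult_smult: "v \<in> carrier V \<Longrightarrow> a \<odot>\<^bsub>V\<^esub> (b \<odot>\<^bsub>V\<^esub> v) = (a * b) \<odot>\<^bsub>V\<^esub> v"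
  using smult_assoc1[of a b v] by simp

lemma vs_add_cancel_smult:
  assumes "u \<in> carrier V" "v \<in> carrier V"
  shows "u \<oplus>\<^bsub>V\<^esub> (- c) \<odot>\<^bsub>V\<^esub> v \<oplus>\<^bsub>V\<^esub> c \<odot>\<^bsub>V\<^esub> v = u"
  using assms vs_add_smult[of v "- c" c] by (simp add: vs_add_assoc)

lemma vs_add_neg [simp]:
  assumes "v \<in> carrier V"
  shows "v \<oplus>\<^bsub>V\<^esub> (- 1) \<odot>\<^bsub>V\<^esub> v = \<zero>\<^bsub>V\<^esub>"
  using assms vs_add_smult[of v 1 "- 1"] by simp

lemma vs_eqI:
  assumes "u \<in> carrier V" "v \<in> carrier V" "u \<oplus>\<^bsub>V\<^esub> (- 1) \<odot>\<^bsub>V\<^esub> v = \<zero>\<^bsub>V\<^esub>"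
  shows "u = v"
  using vs_add_cancel_smult[of u v 1] assms by simp

lemma vs_finsum_closed [simp]: "g \<in> A \<rightarrow> carrier V \<Longrightarrow> (\<Oplus>\<^bsub>V\<^esub>i\<in>A. g i) \<in> carrier V"
  by (rule M.finsum_closed)

lemma vs_finsum_insert:
  "finite A \<Longrightarrow> a \<notin> A \<Longrightarrow> g \<in> A \<rightarrow> carrier V \<Longrightarrow> g a \<in> carrier V \<Longrightarrow>
    (\<Oplus>\<^bsub>V\<^esub>i\<in>insert a A. g i) = g a \<oplus>\<^bsub>V\<^esub> (\<Oplus>\<^bsub>V\<^esub>i\<in>A. g i)"
  by (rule M.finsum_insert)

lemma vs_finsum_cong:
  "A = B \<Longrightarrow> g \<in> B \<rightarrow> carrier V \<Longrightarrow> (\<And>i. i \<in> B \<Longrightarrow> f i = g i) \<Longrightarrow>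
    (\<Oplus>\<^bsub>V\<^esub>i\<in>A. f i) = (\<Oplus>\<^bsub>V\<^esub>i\<in>B. g i)"
  by (rule M.finsum_cong') auto

lemma vs_finsum_empty [simp]: "(\<Oplus>\<^bsub>V\<^esub>i\<in>{}. g i) = \<zero>\<^bsub>V\<^esub>"
  by simp

lemma vs_finsum_reindex:
  "inj_on h A \<Longrightarrow> g \<in> h ` A \<rightarrow> carrier V \<Longrightarrow> (\<Oplus>\<^bsub>V\<^esub>i\<in>h ` A. g i) = (\<Oplus>\<^bsub>V\<^esub>i\<in>A. g (h i))"
  by (simp add: M.finsum_reindex)

lemma vs_finsum_const_smult:
  assumes "v \<in> carrier V"
  shows "(\<Oplus>\<^bsub>V\<^esub>i\<in>A. c i \<odot>\<^bsub>V\<^esub> v) = (\<Sum>i\<in>A. c i) \<odot>\<^bsub>V\<^esub> v"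
  using finsum_smult_r[of v c A] assms by (simp add: class_ring_simps)

lemma vs_finsum_all_zero: "(\<And>i. i \<in> A \<Longrightarrow> g i = \<zero>\<^bsub>V\<^esub>) \<Longrightarrow> (\<Oplus>\<^bsub>V\<^esub>i\<in>A. g i) = \<zero>\<^bsub>V\<^esub>"
  by (rule M.finsum_all0)

lemma vs_finsum_single:
  assumes "finite A" "a \<in> A" "g a \<in> carrier V" "\<And>i. i \<in> A \<Longrightarrow> i \<noteq> a \<Longrightarrow> g i = \<zero>\<^bsub>V\<^esub>"
  shows "(\<Oplus>\<^bsub>V\<^esub>i\<in>A. g i) = g a"
proof -
  have "g \<in> A - {a} \<rightarrow> carrier V"
    using assms by auto
  then have "(\<Oplus>\<^bsub>V\<^esub>i\<in>insert a (A - {a}). g i) = g a \<oplus>\<^bsub>V\<^esub> (\<Oplus>\<^bsub>V\<^esub>i\<in>A - {a}. g i)"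
    using assms by (intro vs_finsum_insert) auto
  also have "(\<Oplus>\<^bsub>V\<^esub>i\<in>A - {a}. g i) = \<zero>\<^bsub>V\<^esub>"
    using assms by (intro vs_finsum_all_zero) auto
  finally show ?thesis
    using assms by (simp add: insert_absorb)
qed

lemma vs_finsum_Un_disjoint:
  "finite A \<Longrightarrow> finite B \<Longrightarrow> A \<inter> B = {} \<Longrightarrow> g \<in> A \<union> B \<rightarrow> carrier V \<Longrightarrow>
    (\<Oplus>\<^bsub>V\<^esub>i\<in>A \<union> B. g i) = (\<Oplus>\<^bsub>V\<^esub>i\<in>A. g i) \<oplus>\<^bsub>V\<^esub> (\<Oplus>\<^bsub>V\<^esub>i\<in>B. g i)"
  by (rule M.finsum_Un_disjoint) auto

end

lemma lin_homI:
  assumes "\<And>v. v \<in> carrier V \<Longrightarrow> f v \<in> carrier W"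
    and "\<And>u v. u \<in> carrier V \<Longrightarrow> v \<in> carrier V \<Longrightarrow> f (u \<oplus>\<^bsub>V\<^esub> v) = f u \<oplus>\<^bsub>W\<^esub> f v"
    and "\<And>c v. v \<in> carrier V \<Longrightarrow> f (c \<odot>\<^bsub>V\<^esub> v) = c \<odot>\<^bsub>W\<^esub> f v"
  shows "f \<in> lin_hom V W"
  using assms by (auto simp: LinearCombinations.module_hom_def)

lemma lin_hom_closed: "f \<in> lin_hom V W \<Longrightarrow> v \<in> carrier V \<Longrightarrow> f v \<in> carrier W"
  and lin_hom_add:
    "f \<in> lin_hom V W \<Longrightarrow> u \<in> carrier V \<Longrightarrow> v \<in> carrier V \<Longrightarrow> f (u \<oplus>\<^bsub>V\<^esub> v) = f u \<oplus>\<^bsub>W\<^esub> f v"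
  and lin_hom_smult: "f \<in> lin_hom V W \<Longrightarrow> v \<in> carrier V \<Longrightarrow> f (c \<odot>\<^bsub>V\<^esub> v) = c \<odot>\<^bsub>W\<^esub> f v"
  by (auto simp: LinearCombinations.module_hom_def)

lemma lin_hom_zero:
  assumes "cspace V" "cspace W" "f \<in> lin_hom V W"
  shows "f \<zero>\<^bsub>V\<^esub> = \<zero>\<^bsub>W\<^esub>"
  using lin_hom_smult[OF assms(3), of "\<zero>\<^bsub>V\<^esub>" 0] lin_hom_closed[OF assms(3), of "\<zero>\<^bsub>V\<^esub>"] assms
  by simp

lemma lin_hom_finsum:
  assumes "cspace V" "cspace W" "f \<in> lin_hom V W" "g \<in> A \<rightarrow> carrier V"
  shows "f (\<Oplus>\<^bsub>V\<^esub>i\<in>A. g i) = (\<Oplus>\<^bsub>W\<^esub>i\<in>A. f (g i))"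
proof -
  interpret V: vectorspace class_ring V by fact
  interpret W: vectorspace class_ring W by fact
  show ?thesis
    using assms(4)
  proof (induct A rule: infinite_finite_induct)
    case (insert a A)
    then have "\<forall>i\<in>A. f (g i) \<in> carrier W" "f (g a) \<in> carrier W"
      by (auto intro!: lin_hom_closed[OF assms(3)])
    with insert show ?case
      by (simp add: V.M.finsum_insert W.M.finsum_insert lin_hom_add[OF assms(3)] comp_def Pi_iff)
  qed (use lin_hom_zero[OF assms(1-3)] in auto)
qed

lemma lin_hom_comp: "f \<in> lin_hom U V \<Longrightarrow> g \<in> lin_hom V W \<Longrightarrow> (\<lambda>u. g (f u)) \<in> lin_hom U W"
  by (intro lin_homI) (simp_all add: lin_hom_add lin_hom_smult lin_hom_closed)

lemma lin_hom_cong: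
  assumes "cspace V" "f \<in> lin_hom V W" "\<And>v. v \<in> carrier V \<Longrightarrow> f v = g v"
  shows "g \<in> lin_hom V W"
  using assms by (auto intro!: lin_homI simp: lin_hom_add lin_hom_smult lin_hom_closed
    simp flip: assms(3))

lemma lin_hom_add_fun:
  assumes "cspace V" "cspace W" "f \<in> lin_hom V W" "g \<in> lin_hom V W"
  shows "(\<lambda>v. f v \<oplus>\<^bsub>W\<^esub> g v) \<in> lin_hom V W"
  using assms by (auto intro!: lin_homI simp: lin_hom_add lin_hom_smult lin_hom_closed
    vs_smult_add vs_add_assoc vs_add_left_comm)

lemma lin_hom_smult_fun:
  assumes "cspace V" "cspace W" "f \<in> lin_hom V W"
  shows "(\<lambda>v. c \<odot>\<^bsub>W\<^esub> f v) \<in> lin_hom V W"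
  using assms by (auto intro!: lin_homI simp: lin_hom_add lin_hom_smult lin_hom_closed
    vs_smult_add vs_smult_smult mult.commute)

lemma lin_hom_zero_fun: "cspace W \<Longrightarrow> (\<lambda>v. \<zero>\<^bsub>W\<^esub>) \<in> lin_hom V W"
  by (auto intro!: lin_homI)

lemma lin_hom_id: "(\<lambda>v. v) \<in> lin_hom V V"
  by (auto intro!: lin_homI)

lemma complex_line_simps [simp]:
  "carrier complex_line = UNIV" "\<zero>\<^bsub>complex_line\<^esub> = 0" "a \<oplus>\<^bsub>complex_line\<^esub> b = a + b"
  "a \<odot>\<^bsub>complex_line\<^esub> b = a * b"
  by (simp_all add: complex_line_def)

lemma cspace_complex_line: "cspace complex_line"
proof (rule vs_criteria[OF class_field]; simp add: algebra_simps)
  show "\<forall>v::complex. \<exists>w. v + w = 0"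
    by (metis add.right_inverse)
qed

lemma lin_hom_smult_vector:
  assumes "cspace V" "cspace W" "l \<in> lin_hom V complex_line" "w \<in> carrier W"
  shows "(\<lambda>v. l v \<odot>\<^bsub>W\<^esub> w) \<in> lin_hom V W"
  using assms by (auto intro!: lin_homI simp: lin_hom_add lin_hom_smult vs_add_smult vs_smult_smult)

lemma cspace_pointwise:
  assumes V: "\<And>k. k \<in> K \<Longrightarrow> cspace (V k)"
    and sub: "carrier M \<subseteq> (\<Pi>\<^sub>E k\<in>K. carrier (V k))"
    and zero: "\<zero>\<^bsub>M\<^esub> = (\<lambda>k\<in>K. \<zero>\<^bsub>V k\<^esub>)" "\<zero>\<^bsub>M\<^esub> \<in> carrier M"
    and add: "\<And>f g. f \<in> carrier M \<Longrightarrow> g \<in> carrier M \<Longrightarrow> f \<oplus>\<^bsub>M\<^esub> g = (\<lambda>k\<in>K. f k \<oplus>\<^bsub>V k\<^esub> g k)"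
      "\<And>f g. f \<in> carrier M \<Longrightarrow> g \<in> carrier M \<Longrightarrow> f \<oplus>\<^bsub>M\<^esub> g \<in> carrier M"
    and smult: "\<And>c f. f \<in> carrier M \<Longrightarrow> c \<odot>\<^bsub>M\<^esub> f = (\<lambda>k\<in>K. c \<odot>\<^bsub>V k\<^esub> f k)"
      "\<And>c f. f \<in> carrier M \<Longrightarrow> c \<odot>\<^bsub>M\<^esub> f \<in> carrier M"
  shows "cspace M"
proof -
  have mem: "f k \<in> carrier (V k)" if "f \<in> carrier M" "k \<in> K" for f k
    using sub that by auto
  have ext: "f = g" if "f \<in> carrier M" "g \<in> carrier M" "\<And>k. k \<in> K \<Longrightarrow> f k = g k" for f g
    using that sub by (intro PiE_ext[of f K "\<lambda>k. carrier (V k)" g]) auto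
  have pw: "(f \<oplus>\<^bsub>M\<^esub> g) k = f k \<oplus>\<^bsub>V k\<^esub> g k" "(c \<odot>\<^bsub>M\<^esub> f) k = c \<odot>\<^bsub>V k\<^esub> f k" "\<zero>\<^bsub>M\<^esub> k = \<zero>\<^bsub>V k\<^esub>"
    if "f \<in> carrier M" "g \<in> carrier M" "k \<in> K" for f g c k
    using that by (simp_all add: add(1) smult(1) zero(1))
  have neg: "f \<oplus>\<^bsub>M\<^esub> (- 1) \<odot>\<^bsub>M\<^esub> f = \<zero>\<^bsub>M\<^esub>" if "f \<in> carrier M" for f
    by (rule ext) (use that in \<open>simp_all add: pw add(2) smult(2) zero(2) V mem\<close>)
  show ?thesis
  proof (rule vs_criteria[OF class_field])
    show "\<forall>f\<in>carrier M. \<exists>g\<in>carrier M. f \<oplus>\<^bsub>M\<^esub> g = \<zero>\<^bsub>M\<^esub>"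
      using neg smult by blast
  qed (use zero(2) add(2) smult(2) in \<open>auto intro!: ext simp: pw V mem
      vs_add_assoc vs_smult_add vs_add_smult vs_smult_smult vs_add_comm vs_add_left_comm\<close>)
qed

subsection \<open>Separating families of functionals\<close>

text \<open>An embedding of \<open>V\<close> into a finite power of the complex numbers.
  \<open>card L\<close> is an upper bound for the dimension and the induction measure in
  \<open>sum_of_simples\<close>.\<close>

definition separates :: "((complex, 'v) module) \<Rightarrow> ('v \<Rightarrow> complex) set \<Rightarrow> bool" where
  "separates V L \<longleftrightarrow> finite L \<and> L \<subseteq> lin_hom V complex_line \<and>
     (\<forall>v\<in>carrier V. (\<forall>l\<in>L. l v = 0) \<longrightarrow> v = \<zero>\<^bsub>V\<^esub>)"

text \<open>The kernel \<open>N\<close> of one functional is separated by the remaining ones. If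
  \<open>N\<close> is not all of \<open>V\<close>, any vector outside it completes a spanning set of
  \<open>N\<close> to one of \<open>V\<close>.\<close>

lemma fd_spaceI:
  fixes V :: "(complex, 'v) module"
  assumes "cspace V" "separates V L"
  shows "fd_space V"
proof -
  have "finite L" using assms(2) by (simp add: separates_def)
  then show ?thesis
    using assms
  proof (induction L arbitrary: V rule: finite_induct)
    case empty
    interpret V: vectorspace class_ring V by fact
    have "carrier V = {\<zero>\<^bsub>V\<^esub>}"
      using empty.prems by (auto simp: separates_def)
    moreover have "submodule class_ring (V.span {}) V"
      by (rule V.span_is_submodule) simp
    ultimately have "V.span {} = carrier V"
      using submodule.subset submodule.zero_closed by fastforce
    then show ?case
      unfolding fd_space_def V.fin_dim_def using empty.prems by blast
  next
    case (insert l L)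
    interpret V: vectorspace class_ring V by fact
    have l: "l \<in> lin_hom V complex_line"
      using insert.prems by (auto simp: separates_def)
    define N where "N = {v \<in> carrier V. l v = 0}"
    have subm: "submodule class_ring N V"
      by standard (use l lin_hom_zero[OF insert.prems(1) cspace_complex_line l] insert.prems(1)
        in \<open>auto simp: N_def lin_hom_add[OF l] lin_hom_smult[OF l]\<close>)
    have "cspace (V\<lparr>carrier := N\<rparr>)"
      using V.submodule_is_module[OF subm] by (simp add: vectorspace_def class_field)
    moreover have "separates (V\<lparr>carrier := N\<rparr>) L"
      using insert.prems by (auto simp: separates_def N_def LinearCombinations.module_hom_def)
    ultimately have "fd_space (V\<lparr>carrier := N\<rparr>)"
      by (rule insert.IH)
    then obtain A where A: "finite A" "A \<subseteq> N" "LinearCombinations.module.span class_ring (V\<lparr>carrier := N\<rparr>) A = N"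
      by (auto simp: fd_space_def vectorspace.fin_dim_def)
    have spA: "V.span A = N"
      using V.span_li_not_depend(1)[OF A(2) subm] A(3) by simp
    have "\<exists>B. finite B \<and> B \<subseteq> carrier V \<and> V.span B = carrier V"
    proof (cases "N = carrier V")
      case True
      then show ?thesis using A spA by blast
    next
      case False
      then obtain w where w: "w \<in> carrier V" "l w \<noteq> 0"
        by (auto simp: N_def)
      have B: "insert w A \<subseteq> carrier V"
        using A(2) w by (auto simp: N_def)
      have sm: "submodule class_ring (V.span (insert w A)) V"
        by (rule V.span_is_submodule[OF B])
      have 1: "w \<in> V.span (insert w A)" "N \<subseteq> V.span (insert w A)"
        using V.in_own_span[OF B] V.span_is_monotone[of A "insert w A"] spA by auto
      have "v \<in> V.span (insert w A)" if v: "v \<in> carrier V" for v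
      proof -
        \<comment> \<open>Chosen so that \<open>v - c w\<close> lies in the kernel of
          \<open>l\<close>.\<close>
        define c where "c = l v / l w"
        have "v \<oplus>\<^bsub>V\<^esub> (- c) \<odot>\<^bsub>V\<^esub> w \<in> N"
          using v w insert.prems(1)
          by (simp add: N_def c_def lin_hom_add[OF l] lin_hom_smult[OF l])
        then have "v \<oplus>\<^bsub>V\<^esub> (- c) \<odot>\<^bsub>V\<^esub> w \<oplus>\<^bsub>V\<^esub> c \<odot>\<^bsub>V\<^esub> w \<in> V.span (insert w A)"
          using 1 submodule.m_closed[OF sm] submodule.smult_closed[OF sm] by auto
        then show ?thesis
          using vs_add_cancel_smult insert.prems(1) v w by metis
      qed
      then have "V.span (insert w A) = carrier V"
        using submodule.subset[OF sm] by blast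
      then show ?thesis using A(1) B by blast
    qed
    then show ?case
      unfolding fd_space_def V.fin_dim_def using insert.prems by blast
  qed
qed

text \<open>The coordinate functionals of a finite basis separate.\<close>

lemma fd_space_separates:
  assumes "fd_space V"
  obtains L where "separates V L"
proof -
  have cV: "cspace V" using assms by (simp add: fd_space_def)
  interpret V: vectorspace class_ring V by fact
  obtain B where B: "finite B" "V.basis B"
    using V.finite_basis_exists assms by (auto simp: fd_space_def)
  have BV: "B \<subseteq> carrier V" using B by (simp add: V.basis_def)
  have uniq: "\<exists>!a. a \<in> B \<rightarrow>\<^sub>E UNIV \<and> V.lincomb a B = v" if "v \<in> carrier V" for v
    using B BV that V.basis_criterion[of B] by simp
  define co where "co v = (THE a. a \<in> B \<rightarrow>\<^sub>E UNIV \<and> V.lincomb a B = v)" for v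
  have co: "co v \<in> B \<rightarrow>\<^sub>E UNIV" "V.lincomb (co v) B = v" if "v \<in> carrier V" for v
    using theI'[OF uniq[OF that]] by (simp_all add: co_def)
  \<comment> \<open>Coefficients are unique only among functions that are extensional on
    \<open>B\<close>, so arbitrary ones are restricted before they are compared with
    \<open>co v\<close>.\<close>
  have lr: "V.lincomb (restrict a B) B = V.lincomb a B" for a
    by (rule V.lincomb_cong) (use BV in auto)
  have co_eq: "co v b = a b" if "v \<in> carrier V" "V.lincomb a B = v" "b \<in> B" for v a b
  proof -
    have "co v = restrict a B"
      unfolding co_def by (rule the1_equality[OF uniq[OF that(1)]]) (use that lr in auto)
    then show ?thesis using that by simp
  qed
  have "(\<lambda>v. co v b) \<in> lin_hom V complex_line" if b: "b \<in> B" for b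
  proof (rule lin_homI)
    fix u v assume uv: "u \<in> carrier V" "v \<in> carrier V"
    have "V.lincomb (\<lambda>b. co u b + co v b) B = u \<oplus>\<^bsub>V\<^esub> v"
      using V.lincomb_sum[OF B(1) BV, of "co u" "co v"] co uv by simp
    then show "co (u \<oplus>\<^bsub>V\<^esub> v) b = co u b \<oplus>\<^bsub>complex_line\<^esub> co v b"
      using co_eq b uv by simp
  next
    fix c v assume v: "v \<in> carrier V"
    have "V.lincomb (\<lambda>b. c * co v b) B = c \<odot>\<^bsub>V\<^esub> v"
      using V.lincomb_smult[OF BV, of "co v" c] co v by simp
    then show "co (c \<odot>\<^bsub>V\<^esub> v) b = c \<odot>\<^bsub>complex_line\<^esub> co v b"
      using co_eq b v by simp
  qed simp
  moreover have "v = \<zero>\<^bsub>V\<^esub>" if "v \<in> carrier V" "\<forall>b\<in>B. co v b = 0" for v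
  proof -
    have "V.lincomb (co v) B = (\<Oplus>\<^bsub>V\<^esub>b\<in>B. \<zero>\<^bsub>V\<^esub>)"
      unfolding V.lincomb_def using that BV cV by (intro vs_finsum_cong) (auto dest: subsetD)
    then show ?thesis using co that by simp
  qed
  ultimately have "separates V ((\<lambda>b v. co v b) ` B)"
    using B(1) by (auto simp: separates_def)
  then show ?thesis by (rule that)
qed

text \<open>\<open>j\<close> embeds \<open>V\<close> into the quotient of \<open>W\<close> by the
  line through \<open>u\<close>, and this quotient gets by with one functional fewer: correct each
  \<open>l\<close> by a multiple of some \<open>m\<close> with \<open>m u \<noteq> 0\<close> so that
  it vanishes on \<open>u\<close>, then drop \<open>m\<close>.\<close>

lemma separates_fewer:
  assumes V: "cspace V" and W: "cspace W" and L: "separates W L" and j: "j \<in> lin_hom V W"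
    and u: "u \<in> carrier W" "u \<noteq> \<zero>\<^bsub>W\<^esub>"
    and inj: "\<And>v c. v \<in> carrier V \<Longrightarrow> j v = c \<odot>\<^bsub>W\<^esub> u \<Longrightarrow> v = \<zero>\<^bsub>V\<^esub>"
  obtains L' where "separates V L'" "card L' < card L"
proof -
  have lin: "finite L" "\<And>l. l \<in> L \<Longrightarrow> l \<in> lin_hom W complex_line"
    and sep: "\<And>w. w \<in> carrier W \<Longrightarrow> (\<And>l. l \<in> L \<Longrightarrow> l w = 0) \<Longrightarrow> w = \<zero>\<^bsub>W\<^esub>"
    using L by (auto simp: separates_def)
  obtain m where m: "m \<in> L" "m u \<noteq> 0"
    using sep u by blast
  define h where "h l v = l (j v) + (- l u / m u) * m (j v)" for l v
  have "h l \<in> lin_hom V complex_line" if "l \<in> L" for l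
    by (rule lin_homI) (use that m V W u in \<open>auto simp: h_def lin_hom_add[OF j] lin_hom_smult[OF j]
      lin_hom_add[OF lin(2)] lin_hom_smult[OF lin(2)] lin_hom_closed[OF j] algebra_simps\<close>)
  moreover have "v = \<zero>\<^bsub>V\<^esub>" if v: "v \<in> carrier V" "\<forall>l\<in>L - {m}. h l v = 0" for v
  proof -
    define c where "c = m (j v) / m u"
    have jv: "j v \<in> carrier W" using j v by (simp add: lin_hom_closed)
    have "l (j v \<oplus>\<^bsub>W\<^esub> (- c) \<odot>\<^bsub>W\<^esub> u) = 0" if "l \<in> L" for l
      using that v jv u W m by (cases "l = m") (auto simp: h_def c_def lin_hom_add[OF lin(2)]
        lin_hom_smult[OF lin(2)] field_simps)
    then have "j v \<oplus>\<^bsub>W\<^esub> (- c) \<odot>\<^bsub>W\<^esub> u = \<zero>\<^bsub>W\<^esub>"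
      using sep jv u W by auto
    then have "j v = c \<odot>\<^bsub>W\<^esub> u"
      using vs_add_cancel_smult[OF W jv u(1), of c] W u by simp
    with inj v show ?thesis by blast
  qed
  ultimately have "separates V (h ` (L - {m}))"
    using lin(1) by (auto simp: separates_def)
  moreover have "card (h ` (L - {m})) < card L"
    using lin(1) m(1) by (meson card_Diff1_less card_image_le finite_Diff le_less_trans)
  ultimately show ?thesis by (rule that)
qed

section \<open>Annihilating polynomials and generalized inverses\<close>

lemma poly_common_kernel:
  fixes L :: "(complex poly \<Rightarrow> complex) set"
  assumes "finite L" and "\<And>l p q. l \<in> L \<Longrightarrow> l (p + q) = l p + l q"
    and "\<And>l c p. l \<in> L \<Longrightarrow> l (Polynomial.smult c p) = c * l p"
  obtains p where "p \<noteq> 0" "\<And>l. l \<in> L \<Longrightarrow> l p = 0"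
proof -
  \<comment> \<open>A hyperplane of a space of polynomials of unbounded degree still has unbounded degree.\<close>
  have "\<exists>p. p \<noteq> 0 \<and> n \<le> degree p \<and> (\<forall>l\<in>L. l p = 0)" for n
    using assms
  proof (induction L arbitrary: n rule: finite_induct)
    case empty
    show ?case by (intro exI[of _ "monom 1 n"]) (simp add: degree_monom_eq)
  next
    case (insert l L)
    note add = insert.prems(1) and smult = insert.prems(2)
    obtain p where p: "p \<noteq> 0" "n \<le> degree p" "\<forall>m\<in>L. m p = 0"
      using insert by (metis insertCI)
    show ?case
    proof (cases "l p = 0")
      case True
      then show ?thesis using p by auto
    next
      case False
      \<comment> \<open>\<open>q\<close> is taken of larger degree than \<open>p\<close>, so that
        the correction by a multiple of \<open>p\<close> cannot cancel its leading term.\<close>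
      obtain q where q: "q \<noteq> 0" "Suc (degree p) \<le> degree q" "\<forall>m\<in>L. m q = 0"
        using insert by (metis insertCI)
      define r where "r = q + Polynomial.smult (- (l q / l p)) p"
      have "degree r = degree q"
        unfolding r_def by (rule degree_add_eq_left)
          (use q(2) degree_smult_le[of "- (l q / l p)" p] in linarith)
      then have "r \<noteq> 0" "n \<le> degree r"
        using p q by auto
      moreover have "m r = 0" if "m \<in> insert l L" for m
        using that p q False unfolding r_def by (subst add, simp, subst smult) auto
      ultimately show ?thesis by blast
    qed
  qed
  from this[of 0] show ?thesis using that by blast
qed

text \<open>Takes the place of the Cayley-Hamilton theorem: polynomials form a space of infinite
  dimension, so a linear map from them to \<open>V\<close> has a kernel. It will be applied to
  evaluation at an endomorphism.\<close>

lemma poly_annihilator: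
  fixes ev :: "complex poly \<Rightarrow> 'v"
  assumes V: "fd_space V"
    and ev: "\<And>p. ev p \<in> carrier V" "\<And>p q. ev (p + q) = ev p \<oplus>\<^bsub>V\<^esub> ev q"
      "\<And>c p. ev (Polynomial.smult c p) = c \<odot>\<^bsub>V\<^esub> ev p"
  obtains p where "p \<noteq> 0" "ev p = \<zero>\<^bsub>V\<^esub>"
proof -
  obtain L where L: "separates V L"
    using fd_space_separates[OF V] .
  then have lin: "finite L" "\<And>l. l \<in> L \<Longrightarrow> l \<in> lin_hom V complex_line"
    by (auto simp: separates_def)
  obtain p where p: "p \<noteq> 0" "\<And>m. m \<in> (\<lambda>l p. l (ev p)) ` L \<Longrightarrow> m p = 0"
    by (rule poly_common_kernel[of "(\<lambda>l p. l (ev p)) ` L"])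
      (use lin ev in \<open>auto simp: lin_hom_add[OF lin(2)] lin_hom_smult[OF lin(2)]\<close>)
  then have "ev p = \<zero>\<^bsub>V\<^esub>"
    using L ev(1) p(2)[OF imageI] by (auto simp: separates_def)
  with p(1) show ?thesis by (rule that)
qed

text \<open>Induction on a set of functionals that separates the image of \<open>f\<close>. If
  \<open>l\<close> is nonzero on that image, let \<open>Q\<close> be the projection along
  \<open>f v0\<close> onto the kernel of \<open>l\<close>. Then
  \<open>f \<circ> Q' = Q \<circ> f\<close> has an image which the remaining functionals separate,
  and a generalized inverse of this map only has to be completed on the line that was split
  off.\<close>

lemma lin_hom_pseudo_inverse:
  assumes V: "cspace V" and W: "fd_space W" and f: "f \<in> lin_hom V W"
  obtains g where "g \<in> lin_hom W V" "\<And>v. v \<in> carrier V \<Longrightarrow> f (g (f v)) = f v"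
proof -
  have cW: "cspace W" using W by (rule fd_space_cspace)
  obtain L where L: "separates W L"
    using fd_space_separates[OF W] .
  \<comment> \<open>Only the separation of the vectors \<open>f v\<close> is kept, because this
    weaker property passes to \<open>f \<circ> Q'\<close> when \<open>l\<close> is removed.\<close>
  have "finite L" "L \<subseteq> lin_hom W complex_line"
    "\<forall>v\<in>carrier V. (\<forall>l\<in>L. l (f v) = 0) \<longrightarrow> f v = \<zero>\<^bsub>W\<^esub>"
    using L lin_hom_closed[OF f] by (auto simp: separates_def)
  then have "\<exists>g. g \<in> lin_hom W V \<and> (\<forall>v\<in>carrier V. f (g (f v)) = f v)"
    using f
  proof (induction L arbitrary: f rule: finite_induct)
    case empty
    then show ?case
      using V cW lin_hom_zero_fun[OF V, of W] lin_hom_zero[of V W f]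
      by (intro exI[of _ "\<lambda>_. \<zero>\<^bsub>V\<^esub>"]) auto
  next
    case (insert l L)
    note f = insert.prems(3)
    have l: "l \<in> lin_hom W complex_line" using insert.prems by auto
    have fc: "f v \<in> carrier W" if "v \<in> carrier V" for v
      using that f by (simp add: lin_hom_closed)
    show ?case
    proof (cases "\<forall>v\<in>carrier V. l (f v) = 0")
      case True
      then show ?thesis using insert by auto
    next
      case False
      then obtain v1 where v1: "v1 \<in> carrier V" "l (f v1) \<noteq> 0" by auto
      \<comment> \<open>Normalised to \<open>l (f v0) = 1\<close>, which makes \<open>Q\<close> take
        values in the kernel of \<open>l\<close>.\<close>
      define v0 where "v0 = (1 / l (f v1)) \<odot>\<^bsub>V\<^esub> v1"
      have v0: "v0 \<in> carrier V" "l (f v0) = 1"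
        using v1 V fc by (simp_all add: v0_def lin_hom_smult[OF f] lin_hom_smult[OF l])
      define Q where "Q w = w \<oplus>\<^bsub>W\<^esub> (- l w) \<odot>\<^bsub>W\<^esub> f v0" for w
      define Q' where "Q' v = v \<oplus>\<^bsub>V\<^esub> (- l (f v)) \<odot>\<^bsub>V\<^esub> v0" for v
      have ml: "(\<lambda>w. - l w) \<in> lin_hom W complex_line"
        using lin_hom_smult_fun[OF cW cspace_complex_line l, of "- 1"] by simp
      have Q: "Q \<in> lin_hom W W"
        unfolding Q_def by (intro lin_hom_add_fun lin_hom_id lin_hom_smult_vector cW ml fc v0)
      have Q': "Q' \<in> lin_hom V V"
        unfolding Q'_def
        by (intro lin_hom_add_fun lin_hom_id lin_hom_smult_vector V v0 lin_hom_comp[OF f ml])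
      have Qf: "f (Q' v) = Q (f v)" if "v \<in> carrier V" for v
        using that v0 V by (simp add: Q'_def Q_def lin_hom_add[OF f] lin_hom_smult[OF f])
      have lQ: "l (Q w) = 0" if "w \<in> carrier W" for w
        using that v0 cW fc by (simp add: Q_def lin_hom_add[OF l] lin_hom_smult[OF l])
      have f': "(\<lambda>v. f (Q' v)) \<in> lin_hom V W"
        by (rule lin_hom_comp[OF Q' f])
      have "\<exists>g. g \<in> lin_hom W V \<and> (\<forall>v\<in>carrier V. f (Q' (g (f (Q' v)))) = f (Q' v))"
      proof (rule insert.IH[OF _ _ f'])
        show "L \<subseteq> lin_hom W complex_line" using insert.prems by auto
        show "\<forall>v\<in>carrier V. (\<forall>l\<in>L. l (f (Q' v)) = 0) \<longrightarrow> f (Q' v) = \<zero>\<^bsub>W\<^esub>"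
          using insert.prems(2) lQ Qf fc lin_hom_closed[OF Q'] by (metis insertE)
      qed
      then obtain g where g: "g \<in> lin_hom W V"
        and fg: "\<And>v. v \<in> carrier V \<Longrightarrow> f (Q' (g (f (Q' v)))) = f (Q' v)" by auto
      \<comment> \<open>Applied to \<open>f v\<close> and followed by \<open>f\<close>, the first
        summand gives \<open>Q (f v)\<close> and the second gives back the multiple of
        \<open>f v0\<close> that \<open>Q\<close> removed.\<close>
      define k where "k w = Q' (g (Q w)) \<oplus>\<^bsub>V\<^esub> l w \<odot>\<^bsub>V\<^esub> v0" for w
      have "k \<in> lin_hom W V"
        unfolding k_def
        by (intro lin_hom_add_fun lin_hom_smult_vector V cW v0 l lin_hom_comp[OF lin_hom_comp[OF Q g] Q'])
      moreover have "f (k (f v)) = f v" if v: "v \<in> carrier V" for v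
      proof -
        have "g (Q (f v)) \<in> carrier V"
          using g Q v fc by (simp add: lin_hom_closed)
        then have "f (k (f v)) = f (Q' (g (f (Q' v)))) \<oplus>\<^bsub>W\<^esub> l (f v) \<odot>\<^bsub>W\<^esub> f v0"
          using v V v0 Qf by (simp add: k_def lin_hom_add[OF f] lin_hom_smult[OF f] lin_hom_closed[OF Q'])
        also have "\<dots> = Q (f v) \<oplus>\<^bsub>W\<^esub> l (f v) \<odot>\<^bsub>W\<^esub> f v0"
          using fg Qf v by simp
        also have "\<dots> = f v"
          unfolding Q_def by (rule vs_add_cancel_smult) (use cW fc v v0 in auto)
        finally show ?thesis .
      qed
      ultimately show ?thesis by blast
    qed
  qed
  then show ?thesis using that by blast
qed

lemma fd_space_inj:
  assumes V: "cspace V" and W: "fd_space W" and j: "j \<in> lin_hom V W"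
    and inj: "\<And>v. v \<in> carrier V \<Longrightarrow> j v = \<zero>\<^bsub>W\<^esub> \<Longrightarrow> v = \<zero>\<^bsub>V\<^esub>"
  shows "fd_space V"
proof -
  obtain L where L: "separates W L"
    using fd_space_separates[OF W] .
  have "(\<lambda>v. l (j v)) \<in> lin_hom V complex_line" if "l \<in> L" for l
    by (rule lin_hom_comp[OF j]) (use L that in \<open>auto simp: separates_def\<close>)
  then have "separates V ((\<lambda>l v. l (j v)) ` L)"
    using L inj lin_hom_closed[OF j] by (auto simp: separates_def)
  with V show ?thesis by (rule fd_spaceI)
qed

text \<open>Serves spaces of linear maps, of natural transformations and of compatible families
  alike. The index set \<open>K\<close> may be infinite there, and finite dimension comes from a
  finite \<open>K\<^sub>0\<close> on which a member of \<open>M\<close> is determined.\<close>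

lemma fd_space_pointwise:
  assumes V: "\<And>k. k \<in> K \<Longrightarrow> fd_space (V k)"
    and sub: "carrier M \<subseteq> (\<Pi>\<^sub>E k\<in>K. carrier (V k))"
    and zero: "\<zero>\<^bsub>M\<^esub> = (\<lambda>k\<in>K. \<zero>\<^bsub>V k\<^esub>)" "\<zero>\<^bsub>M\<^esub> \<in> carrier M"
    and add: "\<And>f g. f \<in> carrier M \<Longrightarrow> g \<in> carrier M \<Longrightarrow> f \<oplus>\<^bsub>M\<^esub> g = (\<lambda>k\<in>K. f k \<oplus>\<^bsub>V k\<^esub> g k)"
      "\<And>f g. f \<in> carrier M \<Longrightarrow> g \<in> carrier M \<Longrightarrow> f \<oplus>\<^bsub>M\<^esub> g \<in> carrier M"
    and smult: "\<And>c f. f \<in> carrier M \<Longrightarrow> c \<odot>\<^bsub>M\<^esub> f = (\<lambda>k\<in>K. c \<odot>\<^bsub>V k\<^esub> f k)"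
      "\<And>c f. f \<in> carrier M \<Longrightarrow> c \<odot>\<^bsub>M\<^esub> f \<in> carrier M"
    and K\<^sub>0: "finite K\<^sub>0" "K\<^sub>0 \<subseteq> K"
      "\<And>f. f \<in> carrier M \<Longrightarrow> (\<And>k. k \<in> K\<^sub>0 \<Longrightarrow> f k = \<zero>\<^bsub>V k\<^esub>) \<Longrightarrow> f = \<zero>\<^bsub>M\<^esub>"
  shows "fd_space M"
proof -
  have c: "cspace M"
    by (rule cspace_pointwise[where K = K and V = V])
      (use V sub zero add smult in \<open>auto simp: fd_space_def\<close>)
  have "\<exists>L. separates (V k) L" if "k \<in> K" for k
    using fd_space_separates[OF V[OF that]] by blast
  then obtain L where L: "\<And>k. k \<in> K \<Longrightarrow> separates (V k) (L k)"
    by metis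
  have mem: "f k \<in> carrier (V k)" if "f \<in> carrier M" "k \<in> K" for f k
    using sub that by auto
  have proj: "(\<lambda>f. f k) \<in> lin_hom M (V k)" if "k \<in> K" for k
    by (rule lin_homI) (use that in \<open>auto simp: mem add(1) smult(1)\<close>)
  have lin: "(\<lambda>f. l (f k)) \<in> lin_hom M complex_line" if "l \<in> L k" "k \<in> K" for k l
    by (rule lin_hom_comp[of "\<lambda>f. f k" M "V k"])
      (use L that proj in \<open>auto simp: separates_def\<close>)
  have "f = \<zero>\<^bsub>M\<^esub>" if f: "f \<in> carrier M" "\<And>k l. k \<in> K\<^sub>0 \<Longrightarrow> l \<in> L k \<Longrightarrow> l (f k) = 0" for f
    using K\<^sub>0(2) L mem f by (intro K\<^sub>0(3)) (auto simp: separates_def)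
  moreover have "finite (L k)" if "k \<in> K\<^sub>0" for k
    using L K\<^sub>0(2) that by (auto simp: separates_def)
  ultimately have "separates M (\<Union>k\<in>K\<^sub>0. (\<lambda>l f. l (f k)) ` L k)"
    using K\<^sub>0(1,2) lin by (auto simp: separates_def subset_iff)
  with c show ?thesis by (rule fd_spaceI)
qed

subsection \<open>Transport of spaces to another type\<close>

lemma fd_space_transport:
  fixes W :: "(complex, 'w) module" and j :: "'w \<Rightarrow> 'v"
  assumes W: "fd_space W" and inj: "inj_on j (carrier W)"
  obtains P :: "(complex, 'v) module" and \<tau>
  where "fd_space P" "\<tau> \<in> lin_hom P W" "bij_betw \<tau> (carrier P) (carrier W)"
proof -
  have cW: "cspace W" using W by (rule fd_space_cspace)
  define \<tau> where "\<tau> = inv_into (carrier W) j"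
  have \<tau>: "\<tau> (j w) = w" if "w \<in> carrier W" for w
    using that inj by (simp add: \<tau>_def)
  define P :: "(complex, 'v) module" where "P = \<lparr>carrier = j ` carrier W, mult = (\<lambda>a b. a), one = j \<zero>\<^bsub>W\<^esub>,
    zero = j \<zero>\<^bsub>W\<^esub>, add = (\<lambda>a b. j (\<tau> a \<oplus>\<^bsub>W\<^esub> \<tau> b)), smult = (\<lambda>c a. j (c \<odot>\<^bsub>W\<^esub> \<tau> a))\<rparr>"
  have P: "carrier P = j ` carrier W" "\<zero>\<^bsub>P\<^esub> = j \<zero>\<^bsub>W\<^esub>" "a \<oplus>\<^bsub>P\<^esub> b = j (\<tau> a \<oplus>\<^bsub>W\<^esub> \<tau> b)"
    "c \<odot>\<^bsub>P\<^esub> a = j (c \<odot>\<^bsub>W\<^esub> \<tau> a)" for a b c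
    by (simp_all add: P_def)
  have cP: "cspace P"
  proof (rule vs_criteria[OF class_field])
    show "\<forall>v\<in>carrier P. \<exists>u\<in>carrier P. v \<oplus>\<^bsub>P\<^esub> u = \<zero>\<^bsub>P\<^esub>"
    proof
      fix v assume "v \<in> carrier P"
      then obtain w where "w \<in> carrier W" "v = j w" by (auto simp: P)
      then show "\<exists>u\<in>carrier P. v \<oplus>\<^bsub>P\<^esub> u = \<zero>\<^bsub>P\<^esub>"
        using cW by (intro bexI[of _ "j ((- 1) \<odot>\<^bsub>W\<^esub> w)"]) (simp_all add: P \<tau>)
    qed
  qed (use cW in \<open>auto simp: P \<tau> vs_add_assoc vs_smult_add vs_add_smult vs_smult_smult
      vs_add_comm vs_add_left_comm\<close>)
  have lin: "\<tau> \<in> lin_hom P W"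
    by (rule lin_homI) (use cW in \<open>auto simp: P \<tau>\<close>)
  have bij: "bij_betw \<tau> (carrier P) (carrier W)"
    by (rule bij_betw_byWitness[where f' = j]) (auto simp: P \<tau>)
  have "fd_space P"
    by (rule fd_space_inj[OF cP W lin]) (auto simp: P \<tau>)
  with lin bij show ?thesis by (intro that)
qed

text \<open>Iterates an injection of \<open>'v \<times> 'v\<close> into \<open>'v\<close>, one index
  of \<open>K\<close> at a time.\<close>

lemma infinite_power_inj:
  assumes "infinite (UNIV :: 'v set)" "finite K"
  obtains j :: "('k \<Rightarrow> 'v) \<Rightarrow> 'v" where "inj_on j (K \<rightarrow>\<^sub>E UNIV)"
proof -
  obtain h :: "'v \<times> 'v \<Rightarrow> 'v" where h: "inj h"
    using card_of_Times_same_infinite[OF assms(1)]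
    unfolding card_of_ordIso[symmetric] by (auto simp: bij_betw_def)
  have "\<exists>j :: ('k \<Rightarrow> 'v) \<Rightarrow> 'v. inj_on j (K \<rightarrow>\<^sub>E UNIV)"
    using assms(2)
  proof (induction K rule: finite_induct)
    case empty
    show ?case by auto
  next
    case (insert k K)
    then obtain j :: "('k \<Rightarrow> 'v) \<Rightarrow> 'v" where j: "inj_on j (K \<rightarrow>\<^sub>E UNIV)" by auto
    have "inj_on (\<lambda>f. h (f k, j (restrict f K))) (insert k K \<rightarrow>\<^sub>E UNIV)"
    proof (rule inj_onI)
      fix f g :: "'k \<Rightarrow> 'v"
      assume fg: "f \<in> insert k K \<rightarrow>\<^sub>E UNIV" "g \<in> insert k K \<rightarrow>\<^sub>E UNIV"
        and "h (f k, j (restrict f K)) = h (g k, j (restrict g K))"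
      then have fk: "f k = g k" and "j (restrict f K) = j (restrict g K)"
        using h by (auto dest: injD)
      from this(2) have "restrict f K = restrict g K"
        by (rule inj_onD[OF j]) auto
      then have "f i = g i" if "i \<in> K" for i
        using that by (metis restrict_apply')
      then show "f = g"
        by (intro PiE_ext[OF fg]) (auto simp: fk)
    qed
    then show ?case by blast
  qed
  then show ?thesis using that by blast
qed

text \<open>The scalar multiples of a nonzero vector would be infinitely many elements of
  \<open>'v\<close>.\<close>

lemma cspace_finite_type:
  fixes V :: "(complex, 'v) module"
  assumes V: "cspace V" and fin: "finite (UNIV :: 'v set)" and v: "v \<in> carrier V"
  shows "v = \<zero>\<^bsub>V\<^esub>"
proof -
  have "\<not> inj (\<lambda>c :: complex. c \<odot>\<^bsub>V\<^esub> v)"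
    using finite_imageD[of "\<lambda>c :: complex. c \<odot>\<^bsub>V\<^esub> v" UNIV] infinite_UNIV_char_0
      finite_subset[OF subset_UNIV fin] by blast
  then obtain c d where cd: "c \<noteq> d" "c \<odot>\<^bsub>V\<^esub> v = d \<odot>\<^bsub>V\<^esub> v" by (auto simp: inj_def)
  have "(c + - d) \<odot>\<^bsub>V\<^esub> v = (d + - d) \<odot>\<^bsub>V\<^esub> v"
    using cd(2) V v by (simp only: vs_add_smult)
  then have "(1 / (c - d)) \<odot>\<^bsub>V\<^esub> ((c - d) \<odot>\<^bsub>V\<^esub> v) = \<zero>\<^bsub>V\<^esub>"
    using V v by simp
  then show ?thesis
    using V v cd(1) by (simp add: vs_smult_smult)
qed

text \<open>A nonzero space forces \<open>'v\<close> to be infinite, hence equipotent to its finite powers; so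
  subspaces of finite products of spaces in \<open>'v\<close> again have a copy in \<open>'v\<close>.\<close>

lemma family_space:
  fixes V :: "'k \<Rightarrow> (complex, 'v) module"
  assumes V: "\<And>k. k \<in> K \<Longrightarrow> fd_space (V k)"
    and sub: "W \<subseteq> (\<Pi>\<^sub>E k\<in>K. carrier (V k))"
    and zero: "(\<lambda>k\<in>K. \<zero>\<^bsub>V k\<^esub>) \<in> W"
    and add: "\<And>f g. f \<in> W \<Longrightarrow> g \<in> W \<Longrightarrow> (\<lambda>k\<in>K. f k \<oplus>\<^bsub>V k\<^esub> g k) \<in> W"
    and smult: "\<And>c f. f \<in> W \<Longrightarrow> (\<lambda>k\<in>K. c \<odot>\<^bsub>V k\<^esub> f k) \<in> W"
    and K\<^sub>0: "finite K\<^sub>0" "K\<^sub>0 \<subseteq> K"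
      "\<And>f k. f \<in> W \<Longrightarrow> k \<in> K \<Longrightarrow> (\<And>k. k \<in> K\<^sub>0 \<Longrightarrow> f k = \<zero>\<^bsub>V k\<^esub>) \<Longrightarrow> f k = \<zero>\<^bsub>V k\<^esub>"
  obtains P :: "(complex, 'v) module" and \<tau>
  where "fd_space P" "bij_betw \<tau> (carrier P) W"
    "\<And>k. k \<in> K \<Longrightarrow> (\<lambda>u. \<tau> u k) \<in> lin_hom P (V k)"
proof -
  define M where "M = \<lparr>carrier = W, mult = (\<lambda>a b. a), one = (\<lambda>k\<in>K. \<zero>\<^bsub>V k\<^esub>),
    zero = (\<lambda>k\<in>K. \<zero>\<^bsub>V k\<^esub>), add = (\<lambda>f g. \<lambda>k\<in>K. f k \<oplus>\<^bsub>V k\<^esub> g k),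
    smult = (\<lambda>c f. \<lambda>k\<in>K. c \<odot>\<^bsub>V k\<^esub> f k)\<rparr>"
  have cV: "cspace (V k)" if "k \<in> K" for k
    using V that by (simp add: fd_space_def)
  have det: "f = (\<lambda>k\<in>K. \<zero>\<^bsub>V k\<^esub>)" if "f \<in> W" "\<And>k. k \<in> K\<^sub>0 \<Longrightarrow> f k = \<zero>\<^bsub>V k\<^esub>" for f
    using that sub zero by (intro PiE_ext[of f K "\<lambda>k. carrier (V k)"]) (auto simp: K\<^sub>0(3) cV)
  have fdM: "fd_space M"
    by (rule fd_space_pointwise[of K V _ K\<^sub>0]) (use V sub zero add smult K\<^sub>0(1,2) det in \<open>auto simp: M_def\<close>)
  have "\<exists>j :: ('k \<Rightarrow> 'v) \<Rightarrow> 'v. inj_on j W"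
  proof (cases "finite (UNIV :: 'v set)")
    case True
    \<comment> \<open>In a finite type all the spaces are zero, so \<open>W\<close> consists of a
      single family and any map on it is injective.\<close>
    have "f = (\<lambda>k\<in>K. \<zero>\<^bsub>V k\<^esub>)" if f: "f \<in> W" for f
    proof (rule det[OF f])
      fix k assume "k \<in> K\<^sub>0"
      with K\<^sub>0(2) have k: "k \<in> K" by auto
      show "f k = \<zero>\<^bsub>V k\<^esub>"
        by (rule cspace_finite_type[OF cV[OF k] True]) (use sub f k in auto)
    qed
    then have "inj_on (\<lambda>f. undefined) W" by (metis inj_onI)
    then show ?thesis by blast
  next
    case False
    then obtain j :: "('k \<Rightarrow> 'v) \<Rightarrow> 'v" where j: "inj_on j (K\<^sub>0 \<rightarrow>\<^sub>E UNIV)"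
      using infinite_power_inj K\<^sub>0(1) by blast
    have "inj_on (\<lambda>f. j (restrict f K\<^sub>0)) W"
    proof (rule inj_onI)
      fix f g assume fg: "f \<in> W" "g \<in> W" "j (restrict f K\<^sub>0) = j (restrict g K\<^sub>0)"
      then have "restrict f K\<^sub>0 = restrict g K\<^sub>0"
        by (intro inj_onD[OF j]) auto
      then have r: "f k = g k" if "k \<in> K\<^sub>0" for k
        using that by (metis restrict_apply')
      have mem: "f k \<in> carrier (V k)" "g k \<in> carrier (V k)" if "k \<in> K" for k
        using that sub fg by auto
      \<comment> \<open>\<open>K\<^sub>0\<close> controls only vanishing, so the equality of
        \<open>f\<close> and \<open>g\<close> is deduced from their difference, which lies in
        \<open>W\<close>.\<close>
      define d where "d = (\<lambda>k\<in>K. f k \<oplus>\<^bsub>V k\<^esub> (\<lambda>k\<in>K. (- 1) \<odot>\<^bsub>V k\<^esub> g k) k)"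
      have "d \<in> W" unfolding d_def by (intro add smult fg)
      moreover have "d k = \<zero>\<^bsub>V k\<^esub>" if "k \<in> K\<^sub>0" for k
        using that K\<^sub>0(2) r cV mem by (auto simp: d_def subset_iff)
      ultimately have d0: "d k = \<zero>\<^bsub>V k\<^esub>" if "k \<in> K" for k
        using det that by fastforce
      have "f k = g k" if "k \<in> K" for k
        by (rule vs_eqI[OF cV[OF that]]) (use d0[OF that] that mem in \<open>auto simp: d_def\<close>)
      then show "f = g"
        using fg sub by (intro PiE_ext[of f K "\<lambda>k. carrier (V k)" g]) auto
    qed
    then show ?thesis by blast
  qed
  then obtain j :: "('k \<Rightarrow> 'v) \<Rightarrow> 'v" where "inj_on j (carrier M)" by (auto simp: M_def)
  from fd_space_transport[OF fdM this] obtain P :: "(complex, 'v) module" and \<tau>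
    where P: "fd_space P" "\<tau> \<in> lin_hom P M" "bij_betw \<tau> (carrier P) (carrier M)" .
  show ?thesis
  proof (rule that)
    show "bij_betw \<tau> (carrier P) W" using P(3) by (simp add: M_def)
    show "(\<lambda>u. \<tau> u k) \<in> lin_hom P (V k)" if "k \<in> K" for k
      by (rule lin_hom_comp[OF P(2), of "\<lambda>f. f k"], rule lin_homI)
        (use that sub in \<open>auto simp: M_def\<close>)
  qed (rule P(1))
qed

subsection \<open>Semisimplicity of linear categories\<close>

context linear_category
begin

abbreviation hs :: "'o \<Rightarrow> 'o \<Rightarrow> (complex, 'a) module" where
  "hs \<equiv> Hom_space C"

declare Ident_closed [simp] Comp_closed [simp] Comp_Ident_left [simp] Comp_Ident_right [simp]
  carrier_Hom_space [simp]

lemma cspace_hs [simp]: "x \<in> Obj C \<Longrightarrow> y \<in> Obj C \<Longrightarrow> cspace (hs x y)"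
  by (rule fd_space_cspace[OF fd_Hom_space])

lemma hom_zero_closed [simp]: "x \<in> Obj C \<Longrightarrow> y \<in> Obj C \<Longrightarrow> \<zero>\<^bsub>hs x y\<^esub> \<in> Hom C x y"
  and hom_add_closed [simp]: "x \<in> Obj C \<Longrightarrow> y \<in> Obj C \<Longrightarrow> f \<in> Hom C x y \<Longrightarrow> g \<in> Hom C x y \<Longrightarrow>
    f \<oplus>\<^bsub>hs x y\<^esub> g \<in> Hom C x y"
  and hom_smult_closed [simp]: "x \<in> Obj C \<Longrightarrow> y \<in> Obj C \<Longrightarrow> f \<in> Hom C x y \<Longrightarrow>
    c \<odot>\<^bsub>hs x y\<^esub> f \<in> Hom C x y"
  and hom_finsum_closed [simp]: "x \<in> Obj C \<Longrightarrow> y \<in> Obj C \<Longrightarrow> h \<in> A \<rightarrow> Hom C x y \<Longrightarrow>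
    (\<Oplus>\<^bsub>hs x y\<^esub>i\<in>A. h i) \<in> Hom C x y"
  using vs_zero_closed[of "hs x y"] vs_add_closed[of "hs x y" f g] vs_smult_closed[of "hs x y" f c]
    vs_finsum_closed[of "hs x y" h A] by simp_all

context
  fixes x y z
  assumes xyz [simp]: "x \<in> Obj C" "y \<in> Obj C" "z \<in> Obj C"
begin

lemma Comp_add_left [simp]:
  "f \<in> Hom C x y \<Longrightarrow> g \<in> Hom C y z \<Longrightarrow> h \<in> Hom C y z \<Longrightarrow>
    Comp C x y z (g \<oplus>\<^bsub>hs y z\<^esub> h) f = Comp C x y z g f \<oplus>\<^bsub>hs x z\<^esub> Comp C x y z h f"
  using lin_hom_add[OF Comp_linear_left[of x y z f]] by simp

lemma Comp_add_right [simp]: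
  "f \<in> Hom C x y \<Longrightarrow> h \<in> Hom C x y \<Longrightarrow> g \<in> Hom C y z \<Longrightarrow>
    Comp C x y z g (f \<oplus>\<^bsub>hs x y\<^esub> h) = Comp C x y z g f \<oplus>\<^bsub>hs x z\<^esub> Comp C x y z g h"
  using lin_hom_add[OF Comp_linear_right[of x y z g]] by simp

lemma Comp_smult_left [simp]:
  "f \<in> Hom C x y \<Longrightarrow> g \<in> Hom C y z \<Longrightarrow>
    Comp C x y z (c \<odot>\<^bsub>hs y z\<^esub> g) f = c \<odot>\<^bsub>hs x z\<^esub> Comp C x y z g f"
  using lin_hom_smult[OF Comp_linear_left[of x y z f]] by simp

lemma Comp_smult_right [simp]:
  "f \<in> Hom C x y \<Longrightarrow> g \<in> Hom C y z \<Longrightarrow>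
    Comp C x y z g (c \<odot>\<^bsub>hs x y\<^esub> f) = c \<odot>\<^bsub>hs x z\<^esub> Comp C x y z g f"
  using lin_hom_smult[OF Comp_linear_right[of x y z g]] by simp

lemma Comp_zero_left [simp]: "f \<in> Hom C x y \<Longrightarrow> Comp C x y z \<zero>\<^bsub>hs y z\<^esub> f = \<zero>\<^bsub>hs x z\<^esub>"
  using lin_hom_zero[OF _ _ Comp_linear_left[of x y z f]] by simp

lemma Comp_zero_right [simp]: "g \<in> Hom C y z \<Longrightarrow> Comp C x y z g \<zero>\<^bsub>hs x y\<^esub> = \<zero>\<^bsub>hs x z\<^esub>"
  using lin_hom_zero[OF _ _ Comp_linear_right[of x y z g]] by simp

lemma Comp_finsum_left: "f \<in> Hom C x y \<Longrightarrow> h \<in> A \<rightarrow> Hom C y z \<Longrightarrow>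
    Comp C x y z (\<Oplus>\<^bsub>hs y z\<^esub>i\<in>A. h i) f = (\<Oplus>\<^bsub>hs x z\<^esub>i\<in>A. Comp C x y z (h i) f)"
  using lin_hom_finsum[OF _ _ Comp_linear_left[of x y z f]] by simp

lemma Comp_finsum_right: "g \<in> Hom C y z \<Longrightarrow> h \<in> A \<rightarrow> Hom C x y \<Longrightarrow>
    Comp C x y z g (\<Oplus>\<^bsub>hs x y\<^esub>i\<in>A. h i) = (\<Oplus>\<^bsub>hs x z\<^esub>i\<in>A. Comp C x y z g (h i))"
  using lin_hom_finsum[OF _ _ Comp_linear_right[of x y z g]] by simp

end

section \<open>Simple objects and scalar endomorphisms\<close>

lemma zero_if_Ident_zero:
  assumes "x \<in> Obj C" "y \<in> Obj C" "f \<in> Hom C x y" "Ident C x = \<zero>\<^bsub>hs x x\<^esub>"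
  shows "f = \<zero>\<^bsub>hs x y\<^esub>"
  using Comp_Ident_right[OF assms(1-3)] assms by simp

text \<open>Otherwise all endomorphisms would be zero, while a line has infinitely many
  elements.\<close>

lemma simple_Ident_nonzero:
  assumes "simple_object C x"
  shows "Ident C x \<noteq> \<zero>\<^bsub>hs x x\<^esub>"
proof
  assume z: "Ident C x = \<zero>\<^bsub>hs x x\<^esub>"
  have x: "x \<in> Obj C" using assms by (simp add: simple_object_def)
  obtain \<phi> where "bij_betw \<phi> (Hom C x x) (UNIV :: complex set)"
    using assms x by (auto simp: simple_object_def vs_isomorphic_def)
  moreover have "Hom C x x \<subseteq> {\<zero>\<^bsub>hs x x\<^esub>}"
    using zero_if_Ident_zero[OF x x _ z] by auto
  ultimately show False
    using infinite_UNIV_char_0 bij_betw_finite finite_subset by blast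
qed

lemma simple_End_scalar:
  assumes "simple_object C x" "T \<in> Hom C x x"
  obtains c where "T = c \<odot>\<^bsub>hs x x\<^esub> Ident C x"
proof -
  have x [simp]: "x \<in> Obj C" using assms by (simp add: simple_object_def)
  obtain \<phi> where \<phi>: "\<phi> \<in> lin_hom (hs x x) complex_line" "bij_betw \<phi> (Hom C x x) (UNIV :: complex set)"
    using assms(1) by (auto simp: simple_object_def vs_isomorphic_def)
  have inj: "inj_on \<phi> (Hom C x x)" using \<phi>(2) by (simp add: bij_betw_def)
  have "\<phi> (Ident C x) \<noteq> \<phi> \<zero>\<^bsub>hs x x\<^esub>"
    using inj_onD[OF inj] simple_Ident_nonzero[OF assms(1)] by fastforce
  then have nz: "\<phi> (Ident C x) \<noteq> 0"
    using lin_hom_zero[OF _ cspace_complex_line \<phi>(1)] by simp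
  have "T = (\<phi> T / \<phi> (Ident C x)) \<odot>\<^bsub>hs x x\<^esub> Ident C x"
    by (rule inj_onD[OF inj]) (use assms nz in \<open>simp_all add: lin_hom_smult[OF \<phi>(1)]\<close>)
  then show ?thesis by (rule that)
qed

text \<open>Its contrapositive provides a non-scalar endomorphism of a nonzero object that is not
  simple, which is where the splitting starts.\<close>

lemma simple_objectI:
  assumes x [simp]: "x \<in> Obj C" and nz: "Ident C x \<noteq> \<zero>\<^bsub>hs x x\<^esub>"
    and scalar: "\<And>T. T \<in> Hom C x x \<Longrightarrow> \<exists>c. T = c \<odot>\<^bsub>hs x x\<^esub> Ident C x"
  shows "simple_object C x"
proof -
  let ?s = "\<lambda>c. c \<odot>\<^bsub>hs x x\<^esub> Ident C x"
  have inj: "inj ?s"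
  proof (rule injI, rule ccontr)
    fix c d :: complex assume cd: "?s c = ?s d" "c \<noteq> d"
    have "?s (c + - d) = ?s (d + - d)"
      using cd(1) by (subst (1 2) vs_add_smult) simp_all
    then have "(1 / (c - d)) \<odot>\<^bsub>hs x x\<^esub> ?s (c - d) = \<zero>\<^bsub>hs x x\<^esub>"
      by simp
    then show False
      using nz cd(2) by (simp add: vs_smult_smult)
  qed
  define \<phi> where "\<phi> = inv_into UNIV ?s"
  have \<phi>s: "\<phi> (?s c) = c" for c
    using inv_f_f[OF inj] by (simp add: \<phi>_def)
  have "\<phi> \<in> lin_hom (hs x x) complex_line"
  proof (rule lin_homI)
    fix T U assume "T \<in> carrier (hs x x)" "U \<in> carrier (hs x x)"
    then obtain c d where "T = ?s c" "U = ?s d" using scalar by (metis carrier_Hom_space x)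
    then show "\<phi> (T \<oplus>\<^bsub>hs x x\<^esub> U) = \<phi> T \<oplus>\<^bsub>complex_line\<^esub> \<phi> U"
      using \<phi>s[of "c + d"] \<phi>s by (simp add: vs_add_smult)
  next
    fix a T assume "T \<in> carrier (hs x x)"
    then obtain c where "T = ?s c" using scalar by (metis carrier_Hom_space x)
    then show "\<phi> (a \<odot>\<^bsub>hs x x\<^esub> T) = a \<odot>\<^bsub>complex_line\<^esub> \<phi> T"
      using \<phi>s by (simp add: vs_smult_smult)
  qed simp
  moreover have "bij_betw \<phi> (Hom C x x) UNIV"
    by (rule bij_betw_byWitness[where f' = ?s]) (use scalar \<phi>s in \<open>fastforce+\<close>)
  ultimately show ?thesis
    by (auto simp: simple_object_def vs_isomorphic_def)
qed

text \<open>Take an annihilating polynomial of \<open>T\<close> of least degree; it is not constant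
  because the identity is nonzero. Over the complex numbers it has a linear factor with root
  \<open>z\<close> and cofactor \<open>q\<close>. The value \<open>u\<close> of \<open>q\<close> at
  \<open>T\<close> is nonzero by minimality and is killed by \<open>T - z\<close>, so
  \<open>c\<close> is \<open>- z\<close>.\<close>

lemma eigenvector:
  assumes x [simp]: "x \<in> Obj C" and T [simp]: "T \<in> Hom C x x" and nz: "Ident C x \<noteq> \<zero>\<^bsub>hs x x\<^esub>"
  obtains c u where "u \<in> Hom C x x" "u \<noteq> \<zero>\<^bsub>hs x x\<^esub>"
    "Comp C x x x (T \<oplus>\<^bsub>hs x x\<^esub> c \<odot>\<^bsub>hs x x\<^esub> Ident C x) u = \<zero>\<^bsub>hs x x\<^esub>"
proof -
  \<comment> \<open>One step of Horner's scheme: \<open>ev p\<close> is the value of the polynomial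
    \<open>p\<close> at \<open>T\<close>.\<close>
  define F where "F a r = a \<odot>\<^bsub>hs x x\<^esub> Ident C x \<oplus>\<^bsub>hs x x\<^esub> Comp C x x x T r" for a r
  define ev where "ev p = fold_coeffs F p \<zero>\<^bsub>hs x x\<^esub>" for p
  have ev_0 [simp]: "ev 0 = \<zero>\<^bsub>hs x x\<^esub>" by (simp add: ev_def)
  \<comment> \<open>The case \<open>p = 0 \<and> a = 0\<close> is separate because
    \<open>pCons 0 0\<close> is the zero polynomial, with an empty list of coefficients;
    \<open>F\<close> yields zero there as well.\<close>
  have ev_pCons: "ev (pCons a p) = F a (ev p)" for a p
    by (cases "p = 0 \<and> a = 0") (auto simp: ev_def F_def)
  have ev_closed [simp]: "ev p \<in> Hom C x x" for p
    by (induction p) (simp_all add: ev_pCons F_def)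
  have ev_add: "ev (p + q) = ev p \<oplus>\<^bsub>hs x x\<^esub> ev q" for p q
    by (induction p q rule: poly_induct2)
      (simp_all add: ev_pCons F_def vs_add_smult vs_add_assoc vs_add_left_comm)
  have ev_smult: "ev (Polynomial.smult c p) = c \<odot>\<^bsub>hs x x\<^esub> ev p" for c p
    by (induction p) (simp_all add: ev_pCons F_def vs_smult_add vs_smult_smult)
  obtain p\<^sub>0 where "p\<^sub>0 \<noteq> 0" "ev p\<^sub>0 = \<zero>\<^bsub>hs x x\<^esub>"
    by (rule poly_annihilator[of "hs x x" ev]) (simp_all add: fd_Hom_space ev_add ev_smult)
  then obtain p where p: "p \<noteq> 0" "ev p = \<zero>\<^bsub>hs x x\<^esub>"
    and min: "\<And>q. q \<noteq> 0 \<Longrightarrow> ev q = \<zero>\<^bsub>hs x x\<^esub> \<Longrightarrow> degree p \<le> degree q"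
    using ex_has_least_nat[of "\<lambda>p. p \<noteq> 0 \<and> ev p = \<zero>\<^bsub>hs x x\<^esub>" p\<^sub>0 degree] by auto
  have "degree p \<noteq> 0"
  proof
    assume "degree p = 0"
    then obtain a where a: "p = [:a:]" by (metis degree_eq_zeroE)
    then have "a \<odot>\<^bsub>hs x x\<^esub> Ident C x = \<zero>\<^bsub>hs x x\<^esub>" "a \<noteq> 0"
      using p by (simp_all add: ev_pCons F_def)
    then have "(1 / a) \<odot>\<^bsub>hs x x\<^esub> (a \<odot>\<^bsub>hs x x\<^esub> Ident C x) = \<zero>\<^bsub>hs x x\<^esub>" by simp
    with \<open>a \<noteq> 0\<close> nz show False by (simp add: vs_smult_smult)
  qed
  then obtain z where "poly p z = 0"
    using fundamental_theorem_of_algebra[of p] by (auto simp: constant_degree)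
  then obtain q where q: "p = [:- z, 1:] * q"
    by (auto simp: poly_eq_0_iff_dvd dvd_def)
  have "q \<noteq> 0" using p(1) q by auto
  then have "degree p = Suc (degree q)"
    unfolding q by (subst degree_mult_eq) auto
  with min \<open>q \<noteq> 0\<close> have "ev q \<noteq> \<zero>\<^bsub>hs x x\<^esub>" by fastforce
  moreover have "Comp C x x x (T \<oplus>\<^bsub>hs x x\<^esub> (- z) \<odot>\<^bsub>hs x x\<^esub> Ident C x) (ev q) = \<zero>\<^bsub>hs x x\<^esub>"
  proof -
    have "p = Polynomial.smult (- z) q + pCons 0 q" by (simp add: q)
    then have "ev p = (- z) \<odot>\<^bsub>hs x x\<^esub> ev q \<oplus>\<^bsub>hs x x\<^esub> Comp C x x x T (ev q)"
      by (simp only: ev_add ev_smult ev_pCons) (simp add: F_def)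
    then show ?thesis
      using p(2) vs_add_comm[OF cspace_hs[OF x x], of "(- z) \<odot>\<^bsub>hs x x\<^esub> ev q"] by simp
  qed
  ultimately show ?thesis using that ev_closed by blast
qed

section \<open>Assembling biproducts\<close>

lemma biproduct_zero:
  assumes "x \<in> Obj C" "Ident C x = \<zero>\<^bsub>hs x x\<^esub>"
  shows "biproduct C 0 xs x"
  using assms by (auto simp: biproduct_def)

lemma biproduct_one:
  assumes "x \<in> Obj C"
  shows "biproduct C 1 (\<lambda>_. x) x"
  unfolding biproduct_def
proof (intro conjI exI[of _ "\<lambda>_. Ident C x"])
  show "(\<Oplus>\<^bsub>hs x x\<^esub>k\<in>{..<1::nat}. Comp C x x x (Ident C x) (Ident C x)) = Ident C x"
    using assms vs_finsum_single[OF cspace_hs[OF assms assms], of "{..<1::nat}" 0 "\<lambda>_. Ident C x"] by simp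
qed (use assms in auto)

text \<open>Splits \<open>x\<close> into \<open>y\<close> and \<open>y'\<close> and then each of
  these further; injections and projections are composites, and the second family is shifted by
  \<open>n\<close>.\<close>

lemma biproduct_append:
  assumes obj [simp]: "x \<in> Obj C" "y \<in> Obj C" "y' \<in> Obj C"
    and xs: "\<And>k. k < n \<Longrightarrow> xs k \<in> Obj C" and ys: "\<And>k. k < m \<Longrightarrow> ys k \<in> Obj C"
    and i [simp]: "i \<in> Hom C y x" "r \<in> Hom C x y" "i' \<in> Hom C y' x" "r' \<in> Hom C x y'"
    and ri: "Comp C y x y r i = Ident C y" "Comp C y' x y' r' i' = Ident C y'"
      "Comp C y x y' r' i = \<zero>\<^bsub>hs y y'\<^esub>" "Comp C y' x y r i' = \<zero>\<^bsub>hs y' y\<^esub>"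
    and sum: "Comp C x y x i r \<oplus>\<^bsub>hs x x\<^esub> Comp C x y' x i' r' = Ident C x"
    and bi: "biproduct C n xs y" "biproduct C m ys y'"
  shows "biproduct C (n + m) (\<lambda>k. if k < n then xs k else ys (k - n)) x"
proof -
  obtain a p where a: "\<And>k. k < n \<Longrightarrow> a k \<in> Hom C (xs k) y" "\<And>k. k < n \<Longrightarrow> p k \<in> Hom C y (xs k)"
    and pa: "\<And>j k. j < n \<Longrightarrow> k < n \<Longrightarrow> Comp C (xs k) y (xs j) (p j) (a k) =
      (if j = k then Ident C (xs k) else \<zero>\<^bsub>hs (xs k) (xs j)\<^esub>)"
    and ap: "(\<Oplus>\<^bsub>hs y y\<^esub>k\<in>{..<n}. Comp C y (xs k) y (a k) (p k)) = Ident C y"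
    using bi(1) unfolding biproduct_def by blast
  obtain b q where b: "\<And>k. k < m \<Longrightarrow> b k \<in> Hom C (ys k) y'" "\<And>k. k < m \<Longrightarrow> q k \<in> Hom C y' (ys k)"
    and qb: "\<And>j k. j < m \<Longrightarrow> k < m \<Longrightarrow> Comp C (ys k) y' (ys j) (q j) (b k) =
      (if j = k then Ident C (ys k) else \<zero>\<^bsub>hs (ys k) (ys j)\<^esub>)"
    and bq: "(\<Oplus>\<^bsub>hs y' y'\<^esub>k\<in>{..<m}. Comp C y' (ys k) y' (b k) (q k)) = Ident C y'"
    using bi(2) unfolding biproduct_def by blast
  let ?z = "\<lambda>k. if k < n then xs k else ys (k - n)"
  define c where "c k = (if k < n then Comp C (xs k) y x i (a k) else Comp C (ys (k - n)) y' x i' (b (k - n)))" for k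
  define s where "s k = (if k < n then Comp C x y (xs k) (p k) r else Comp C x y' (ys (k - n)) (q (k - n)) r')" for k
  have closed: "c k \<in> Hom C (?z k) x" "s k \<in> Hom C x (?z k)" "?z k \<in> Obj C" if "k < n + m" for k
    using that a b xs ys by (auto simp: c_def s_def)
  \<comment> \<open>Regroups a composite through \<open>x\<close> so that its middle pair is one of
    the four composites evaluated in \<open>ri\<close>.\<close>
  have mid: "Comp C u x v (Comp C x w v g h) (Comp C u w' x h' g') = Comp C u w v g (Comp C u w' w (Comp C w' x w h h') g')"
    if "u \<in> Obj C" "v \<in> Obj C" "w \<in> Obj C" "w' \<in> Obj C" "g \<in> Hom C w v" "h \<in> Hom C x w" "h' \<in> Hom C w' x" "g' \<in> Hom C u w'"
    for u v w w' g h h' g'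
    using that by (simp add: Comp_assoc)
  have 1: "Comp C (?z k) x (?z j) (s j) (c k) = (if j = k then Ident C (?z k) else \<zero>\<^bsub>hs (?z k) (?z j)\<^esub>)"
    if "j < n + m" "k < n + m" for j k
    using that a b xs ys by (auto simp: c_def s_def mid ri pa qb)
  have "(\<Oplus>\<^bsub>hs x x\<^esub>k\<in>{..<n + m}. Comp C x (?z k) x (c k) (s k)) = Ident C x"
  proof -
    have "k \<in> (\<lambda>k. k + n) ` {..<m}" if "k < n + m" "\<not> k < n" for k
      using that by (intro image_eqI[of _ _ "k - n"]) auto
    then have img: "{..<n + m} = {..<n} \<union> (\<lambda>k. k + n) ` {..<m}"
      by auto
    have "(\<Oplus>\<^bsub>hs x x\<^esub>k\<in>{..<n + m}. Comp C x (?z k) x (c k) (s k)) =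
      (\<Oplus>\<^bsub>hs x x\<^esub>k\<in>{..<n}. Comp C x (?z k) x (c k) (s k)) \<oplus>\<^bsub>hs x x\<^esub>
      (\<Oplus>\<^bsub>hs x x\<^esub>k\<in>(\<lambda>k. k + n) ` {..<m}. Comp C x (?z k) x (c k) (s k))"
      unfolding img by (rule vs_finsum_Un_disjoint) (use closed in \<open>auto simp: img[symmetric] Pi_iff\<close>)
    also have "(\<Oplus>\<^bsub>hs x x\<^esub>k\<in>{..<n}. Comp C x (?z k) x (c k) (s k)) =
      (\<Oplus>\<^bsub>hs x x\<^esub>k\<in>{..<n}. Comp C x y x i (Comp C x y y (Comp C y (xs k) y (a k) (p k)) r))"
      by (rule vs_finsum_cong) (use a xs in \<open>auto simp: c_def s_def Comp_assoc\<close>)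
    also have "\<dots> = Comp C x y x i (Comp C x y y (\<Oplus>\<^bsub>hs y y\<^esub>k\<in>{..<n}. Comp C y (xs k) y (a k) (p k)) r)"
      using a xs by (subst Comp_finsum_left) (auto simp: Comp_finsum_right)
    also have "\<dots> = Comp C x y x i r" by (simp add: ap)
    also have "(\<Oplus>\<^bsub>hs x x\<^esub>k\<in>(\<lambda>k. k + n) ` {..<m}. Comp C x (?z k) x (c k) (s k)) =
      (\<Oplus>\<^bsub>hs x x\<^esub>k\<in>{..<m}. Comp C x (?z (k + n)) x (c (k + n)) (s (k + n)))"
    proof (rule vs_finsum_reindex)
      show "(\<lambda>k. Comp C x (?z k) x (c k) (s k)) \<in> (\<lambda>k. k + n) ` {..<m} \<rightarrow> carrier (hs x x)"
      proof
        fix k assume "k \<in> (\<lambda>k. k + n) ` {..<m}"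
        then have "k < n + m" by auto
        from closed[OF this] show "Comp C x (?z k) x (c k) (s k) \<in> carrier (hs x x)"
          by (simp only: carrier_Hom_space obj Comp_closed)
      qed
    qed auto
    also have "\<dots> = (\<Oplus>\<^bsub>hs x x\<^esub>k\<in>{..<m}. Comp C x y' x i' (Comp C x y' y' (Comp C y' (ys k) y' (b k) (q k)) r'))"
      by (rule vs_finsum_cong) (use b ys in \<open>auto simp: c_def s_def Comp_assoc\<close>)
    also have "\<dots> = Comp C x y' x i' (Comp C x y' y' (\<Oplus>\<^bsub>hs y' y'\<^esub>k\<in>{..<m}. Comp C y' (ys k) y' (b k) (q k)) r')"
      using b ys by (subst Comp_finsum_left) (auto simp: Comp_finsum_right)
    also have "\<dots> = Comp C x y' x i' r'" by (simp add: bq)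
    finally show ?thesis by (simp add: sum)
  qed
  then show ?thesis
    unfolding biproduct_def using 1 closed by (intro conjI exI[of _ c] exI[of _ s]) auto
qed

text \<open>Von Neumann regularity: \<open>g\<close> is a generalized inverse of \<open>f\<close>,
  which makes \<open>g \<circ> f\<close> and \<open>f \<circ> g\<close> idempotent.\<close>

definition regular :: bool where
  "regular \<longleftrightarrow> (\<forall>x\<in>Obj C. \<forall>y\<in>Obj C. \<forall>f\<in>Hom C x y. \<exists>g\<in>Hom C y x.
     Comp C x y y (Comp C y x y f g) f = f)"

definition split_idempotents :: bool where
  "split_idempotents \<longleftrightarrow> (\<forall>x\<in>Obj C. \<forall>p\<in>Hom C x x. Comp C x x x p p = p \<longrightarrow>
     (\<exists>y\<in>Obj C. \<exists>i\<in>Hom C y x. \<exists>r\<in>Hom C x y. Comp C y x y r i = Ident C y \<and> Comp C x y x i r = p))"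

text \<open>Implied by faithfulness of the functor represented by \<open>c\<close>: faithfulness is
  only asked to detect identities. A nonzero object then receives a nonzero arrow from
  \<open>c\<close>, which suffices to reach every simple object.\<close>

definition generator :: "'o \<Rightarrow> bool" where
  "generator c \<longleftrightarrow> c \<in> Obj C \<and>
     (\<forall>x\<in>Obj C. (\<forall>h\<in>Hom C c x. h = \<zero>\<^bsub>hs c x\<^esub>) \<longrightarrow> Ident C x = \<zero>\<^bsub>hs x x\<^esub>)"

text \<open>\<open>p = g \<circ> f\<close> is nonzero because \<open>f \<circ> p = f\<close> and
  \<open>T\<close> is not scalar; it is not the identity because \<open>f\<close> kills the nonzero
  \<open>u\<close>.\<close>

lemma nontrivial_idempotent:
  assumes reg: regular and x [simp]: "x \<in> Obj C" and nz: "Ident C x \<noteq> \<zero>\<^bsub>hs x x\<^esub>"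
    and ns: "\<not> simple_object C x"
  obtains p where "p \<in> Hom C x x" "Comp C x x x p p = p" "p \<noteq> \<zero>\<^bsub>hs x x\<^esub>" "p \<noteq> Ident C x"
proof -
  obtain T where T [simp]: "T \<in> Hom C x x" and Tc: "\<And>c. T \<noteq> c \<odot>\<^bsub>hs x x\<^esub> Ident C x"
    using simple_objectI[OF x nz] ns by blast
  obtain c u where u: "u \<in> Hom C x x" "u \<noteq> \<zero>\<^bsub>hs x x\<^esub>"
    "Comp C x x x (T \<oplus>\<^bsub>hs x x\<^esub> c \<odot>\<^bsub>hs x x\<^esub> Ident C x) u = \<zero>\<^bsub>hs x x\<^esub>"
    by (rule eigenvector[OF x T nz])
  define f where "f = T \<oplus>\<^bsub>hs x x\<^esub> c \<odot>\<^bsub>hs x x\<^esub> Ident C x"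
  have f: "f \<in> Hom C x x" by (simp add: f_def)
  have f0: "f \<noteq> \<zero>\<^bsub>hs x x\<^esub>"
  proof
    assume "f = \<zero>\<^bsub>hs x x\<^esub>"
    then have "f \<oplus>\<^bsub>hs x x\<^esub> (- c) \<odot>\<^bsub>hs x x\<^esub> Ident C x = (- c) \<odot>\<^bsub>hs x x\<^esub> Ident C x" by simp
    moreover have "f \<oplus>\<^bsub>hs x x\<^esub> (- c) \<odot>\<^bsub>hs x x\<^esub> Ident C x = T"
      using vs_add_cancel_smult[of "hs x x" T "Ident C x" "- c"] by (simp add: f_def)
    ultimately show False using Tc by simp
  qed
  obtain g where g: "g \<in> Hom C x x" "Comp C x x x (Comp C x x x f g) f = f"
    using reg f x unfolding regular_def by blast
  define p where "p = Comp C x x x g f"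
  have fp: "Comp C x x x f p = f"
    using g f by (simp add: p_def Comp_assoc)
  show ?thesis
  proof
    show "p \<in> Hom C x x" using f g by (simp add: p_def)
    show "Comp C x x x p p = p"
      using fp f g by (metis Comp_assoc Comp_closed p_def x)
    show "p \<noteq> \<zero>\<^bsub>hs x x\<^esub>"
      using fp f0 f by auto
    show "p \<noteq> Ident C x"
    proof
      assume "p = Ident C x"
      then have "u = Comp C x x x (Comp C x x x g f) u"
        using u by (simp add: p_def)
      also have "\<dots> = Comp C x x x g (Comp C x x x f u)"
        using u f g by (simp add: Comp_assoc)
      also have "\<dots> = \<zero>\<^bsub>hs x x\<^esub>"
        using u(3) g by (simp add: f_def)
      finally show False using u(2) by simp
    qed
  qed
qed

text \<open>Makes the repeated splitting terminate. The map
  \<open>h \<mapsto> i \<circ> h \<circ> r\<close> embeds the endomorphisms of \<open>y\<close> into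
  those of \<open>x\<close>, and \<open>r \<circ> _ \<circ> i\<close> recovers \<open>h\<close> but
  sends \<open>u\<close> to zero; so only \<open>h = 0\<close> is mapped to a multiple of
  \<open>u\<close>.\<close>

lemma split_fewer:
  assumes obj [simp]: "x \<in> Obj C" "y \<in> Obj C" and i [simp]: "i \<in> Hom C y x" "r \<in> Hom C x y"
    and ri: "Comp C y x y r i = Ident C y"
    and u: "u \<in> Hom C x x" "u \<noteq> \<zero>\<^bsub>hs x x\<^esub>" "Comp C y x y (Comp C x x y r u) i = \<zero>\<^bsub>hs y y\<^esub>"
    and L: "separates (hs x x) L"
  obtains L' where "separates (hs y y) L'" "card L' < card L"
proof -
  define j where "j h = Comp C x y x (Comp C y y x i h) r" for h
  have rji: "Comp C y x y (Comp C x x y r (j h)) i = h" if "h \<in> Hom C y y" for h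
  proof -
    have "Comp C y x y (Comp C x x y r (j h)) i =
        Comp C y y y (Comp C y x y r i) (Comp C y y y h (Comp C y x y r i))"
      using that by (simp add: j_def Comp_assoc del: Comp_Ident_left Comp_Ident_right)
    then show ?thesis using that by (simp add: ri)
  qed
  show ?thesis
  proof (rule separates_fewer[of "hs y y" "hs x x" L j u])
    show "j \<in> lin_hom (hs y y) (hs x x)"
      by (rule lin_homI) (simp_all add: j_def)
    show "h = \<zero>\<^bsub>hs y y\<^esub>" if "h \<in> carrier (hs y y)" "j h = c \<odot>\<^bsub>hs x x\<^esub> u" for h c
      using rji[of h] that u by simp
  qed (use that L u in auto)
qed

text \<open>Induction on the size of a family separating the endomorphisms of \<open>x\<close>. Both
  summands belonging to a nontrivial idempotent admit a smaller family.\<close>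

lemma sum_of_simples:
  assumes reg: regular and split: split_idempotents and x: "x \<in> Obj C"
  shows "\<exists>n xs. (\<forall>k<n. simple_object C (xs k)) \<and> biproduct C n xs x"
proof -
  obtain L where "separates (hs x x) L"
    using fd_space_separates[OF fd_Hom_space[OF x x]] .
  then show ?thesis
    using x
  proof (induction "card L" arbitrary: x L rule: less_induct)
    case less
    note x [simp] = less.prems(2)
    show ?case
    proof (cases "Ident C x = \<zero>\<^bsub>hs x x\<^esub>")
      case True
      then show ?thesis using biproduct_zero[OF x] by fastforce
    next
      case nz: False
      show ?thesis
      proof (cases "simple_object C x")
        case True
        then show ?thesis using biproduct_one[OF x] by fastforce
      next
        case False
        obtain p where p [simp]: "p \<in> Hom C x x" "Comp C x x x p p = p"
          and p': "p \<noteq> \<zero>\<^bsub>hs x x\<^esub>" "p \<noteq> Ident C x"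
          using nontrivial_idempotent[OF reg x nz False] .
        \<comment> \<open>The complementary idempotent \<open>1 - p\<close>, split off as the second
          summand.\<close>
        define p2 where "p2 = Ident C x \<oplus>\<^bsub>hs x x\<^esub> (- 1) \<odot>\<^bsub>hs x x\<^esub> p"
        have p2 [simp]: "p2 \<in> Hom C x x" "Comp C x x x p2 p = \<zero>\<^bsub>hs x x\<^esub>" "Comp C x x x p p2 = \<zero>\<^bsub>hs x x\<^esub>"
          by (simp_all add: p2_def)
        have p2p2: "Comp C x x x p2 p2 = p2"
          using Comp_add_left[OF x x x p2(1), of "Ident C x" "(- 1) \<odot>\<^bsub>hs x x\<^esub> p"]
          by (simp flip: p2_def)
        have p20: "p2 \<noteq> \<zero>\<^bsub>hs x x\<^esub>"
          using vs_eqI[of "hs x x" "Ident C x" p] p' by (auto simp: p2_def)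
        have pp2: "p \<oplus>\<^bsub>hs x x\<^esub> p2 = Ident C x"
          using vs_add_cancel_smult[of "hs x x" "Ident C x" p 1]
            vs_add_comm[OF cspace_hs[OF x x], of p p2] by (simp add: p2_def)
        obtain y i r where y [simp]: "y \<in> Obj C" "i \<in> Hom C y x" "r \<in> Hom C x y"
          and ri: "Comp C y x y r i = Ident C y" and ir: "Comp C x y x i r = p"
          using split x p unfolding split_idempotents_def by meson
        obtain y2 i2 r2 where y2 [simp]: "y2 \<in> Obj C" "i2 \<in> Hom C y2 x" "r2 \<in> Hom C x y2"
          and ri2: "Comp C y2 x y2 r2 i2 = Ident C y2" and ir2: "Comp C x y2 x i2 r2 = p2"
          using split x p2(1) p2p2 unfolding split_idempotents_def by meson
        have pi: "Comp C y x x p i = i"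
          by (simp add: ir[symmetric] Comp_assoc ri)
        have rp: "Comp C x x y r p = r"
          using Comp_assoc[of x y x y r i r] by (simp add: ir[symmetric] ri)
        have pi2: "Comp C y2 x x p2 i2 = i2"
          by (simp add: ir2[symmetric] Comp_assoc ri2)
        have rp2: "Comp C x x y2 r2 p2 = r2"
          using Comp_assoc[of x y2 x y2 r2 i2 r2] by (simp add: ir2[symmetric] ri2)
        have rp2': "Comp C x x y r p2 = \<zero>\<^bsub>hs x y\<^esub>"
          using Comp_assoc[of x x x y p2 p r] by (simp add: rp)
        have r2p: "Comp C x x y2 r2 p = \<zero>\<^bsub>hs x y2\<^esub>"
          using Comp_assoc[of x x x y2 p p2 r2] by (simp add: rp2)
        have r2i: "Comp C y x y2 r2 i = \<zero>\<^bsub>hs y y2\<^esub>"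
          using Comp_assoc[of y x x y2 i p r2] by (simp add: pi r2p)
        have ri2': "Comp C y2 x y r i2 = \<zero>\<^bsub>hs y2 y\<^esub>"
          using Comp_assoc[of y2 x x y i2 p2 r] by (simp add: pi2 rp2')
        \<comment> \<open>On each summand the idempotent of the other one compresses to zero, so it
          can serve as the vector \<open>u\<close> of \<open>split_fewer\<close>.\<close>
        obtain L1 where L1: "separates (hs y y) L1" "card L1 < card L"
          by (rule split_fewer[OF x y ri p2(1) p20 _ less.prems(1)]) (simp add: rp2')
        obtain L2 where L2: "separates (hs y2 y2) L2" "card L2 < card L"
          by (rule split_fewer[OF x y2 ri2 p(1) p'(1) _ less.prems(1)]) (simp add: r2p)
        obtain n xs where xs: "\<And>k. k < n \<Longrightarrow> simple_object C (xs k)" "biproduct C n xs y"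
          using less.hyps[OF L1(2,1) y(1)] by auto
        obtain m ys where ys: "\<And>k. k < m \<Longrightarrow> simple_object C (ys k)" "biproduct C m ys y2"
          using less.hyps[OF L2(2,1) y2(1)] by auto
        have "biproduct C (n + m) (\<lambda>k. if k < n then xs k else ys (k - n)) x"
          by (rule biproduct_append[OF x y(1) y2(1) _ _ y(2,3) y2(2,3) ri ri2 r2i ri2' _ xs(2) ys(2)])
            (use xs(1) ys(1) in \<open>auto simp: simple_object_def ir ir2 pp2\<close>)
        moreover have "\<forall>k<n + m. simple_object C (if k < n then xs k else ys (k - n))"
          using xs(1) ys(1) by auto
        ultimately show ?thesis
          by (intro exI[of _ "n + m"] exI[of _ "\<lambda>k. if k < n then xs k else ys (k - n)"] conjI)
      qed
    qed
  qed
qed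

text \<open>Schur's lemma. Both composites of \<open>f\<close> with its generalized inverse are
  scalars, and \<open>f \<circ> g \<circ> f = f\<close> with \<open>f\<close> nonzero forces both
  scalars to be 1.\<close>

lemma simple_isomorphic:
  assumes reg: regular and s: "simple_object C s" and x: "simple_object C x"
    and f: "f \<in> Hom C s x" "f \<noteq> \<zero>\<^bsub>hs s x\<^esub>"
  shows "isomorphic C x s"
proof -
  have obj [simp]: "s \<in> Obj C" "x \<in> Obj C" using s x by (auto simp: simple_object_def)
  note f(1) [simp]
  obtain g where g [simp]: "g \<in> Hom C x s" and fgf: "Comp C s x x (Comp C x s x f g) f = f"
    using reg f unfolding regular_def by (meson obj)
  obtain c where c: "Comp C s x s g f = c \<odot>\<^bsub>hs s s\<^esub> Ident C s"
    using simple_End_scalar[OF s] Comp_closed by (metis f(1) g obj)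
  obtain d where d: "Comp C x s x f g = d \<odot>\<^bsub>hs x x\<^esub> Ident C x"
    using simple_End_scalar[OF x] Comp_closed by (metis f(1) g obj)
  have cf: "c \<odot>\<^bsub>hs s x\<^esub> f = f"
    using fgf by (simp add: Comp_assoc c)
  have df: "d \<odot>\<^bsub>hs s x\<^esub> f = f"
    using fgf by (simp add: d)
  have one: "e = 1" if e: "e \<odot>\<^bsub>hs s x\<^esub> f = f" for e
  proof (rule ccontr)
    assume "e \<noteq> 1"
    have "(e + - 1) \<odot>\<^bsub>hs s x\<^esub> f = \<zero>\<^bsub>hs s x\<^esub>"
      by (subst vs_add_smult) (simp_all add: e)
    then have "(1 / (e - 1)) \<odot>\<^bsub>hs s x\<^esub> ((e - 1) \<odot>\<^bsub>hs s x\<^esub> f) = \<zero>\<^bsub>hs s x\<^esub>" by simp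
    with \<open>e \<noteq> 1\<close> f(2) show False by (simp add: vs_smult_smult)
  qed
  have "iso_arrow C x s g"
    using one[OF cf] one[OF df] c d unfolding iso_arrow_def by (auto intro!: bexI[of _ f])
  then show ?thesis by (auto simp: isomorphic_def)
qed

end

theorem (in additive_linear_category) two_vector_spaceI:
  assumes reg: regular and split: split_idempotents and gen: "generator c"
  shows "two_vector_space C"
proof unfold_locales
  show "\<exists>n xs. (\<forall>k<n. simple_object C (xs k)) \<and> biproduct C n xs x" if "x \<in> Obj C" for x
    by (rule sum_of_simples[OF reg split that])
  have c: "c \<in> Obj C" using gen by (simp add: generator_def)
  obtain n xs where xs: "\<And>k. k < n \<Longrightarrow> simple_object C (xs k)" and bi: "biproduct C n xs c"
    using sum_of_simples[OF reg split c] by auto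
  then obtain i p where ip: "\<And>k. k < n \<Longrightarrow> i k \<in> Hom C (xs k) c" "\<And>k. k < n \<Longrightarrow> p k \<in> Hom C c (xs k)"
    and sum: "(\<Oplus>\<^bsub>hs c c\<^esub>k\<in>{..<n}. Comp C c (xs k) c (i k) (p k)) = Ident C c"
    unfolding biproduct_def by blast
  have xo: "xs k \<in> Obj C" if "k < n" for k using xs[OF that] by (simp add: simple_object_def)
  have "\<exists>s\<in>xs ` {..<n}. isomorphic C x s" if x: "simple_object C x" for x
  proof -
    have xO: "x \<in> Obj C" using x by (simp add: simple_object_def)
    obtain h where h: "h \<in> Hom C c x" "h \<noteq> \<zero>\<^bsub>hs c x\<^esub>"
      using gen simple_Ident_nonzero[OF x] xO unfolding generator_def by blast
    \<comment> \<open>The identity of \<open>c\<close> is the sum over its simple summands, so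
      \<open>h\<close> has a nonzero component on one of them.\<close>
    have "h = Comp C c c x h (\<Oplus>\<^bsub>hs c c\<^esub>k\<in>{..<n}. Comp C c (xs k) c (i k) (p k))"
      using h c xO by (simp add: sum)
    also have "\<dots> = (\<Oplus>\<^bsub>hs c x\<^esub>k\<in>{..<n}. Comp C c c x h (Comp C c (xs k) c (i k) (p k)))"
      using ip xo c xO h by (intro Comp_finsum_right) auto
    finally have "\<not> (\<forall>k\<in>{..<n}. Comp C c c x h (Comp C c (xs k) c (i k) (p k)) = \<zero>\<^bsub>hs c x\<^esub>)"
      using vs_finsum_all_zero[of "hs c x" "{..<n}" "\<lambda>k. Comp C c c x h (Comp C c (xs k) c (i k) (p k))"]
        c xO h(2) by auto
    then obtain k where k: "k < n" "Comp C c c x h (Comp C c (xs k) c (i k) (p k)) \<noteq> \<zero>\<^bsub>hs c x\<^esub>"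
      by auto
    then have "Comp C c (xs k) x (Comp C (xs k) c x h (i k)) (p k) \<noteq> \<zero>\<^bsub>hs c x\<^esub>"
      using ip xo c xO h by (simp add: Comp_assoc)
    then have "Comp C (xs k) c x h (i k) \<noteq> \<zero>\<^bsub>hs (xs k) x\<^esub>"
      using k ip xo c xO by auto
    then have "isomorphic C x (xs k)"
      using k h ip xo c xO by (intro simple_isomorphic[OF reg xs x]) auto
    with k(1) show ?thesis by blast
  qed
  then show "\<exists>S. finite S \<and> (\<forall>s\<in>S. simple_object C s) \<and>
      (\<forall>x. simple_object C x \<longrightarrow> (\<exists>s\<in>S. isomorphic C x s))"
    using xs by (intro exI[of _ "xs ` {..<n}"]) auto
qed

subsection \<open>Groupoids with averaging weights\<close>

lemma iso_arrow_cancel: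
  assumes "category C" "iso_arrow C x y f" "x \<in> Obj C" "y \<in> Obj C" "z \<in> Obj C"
    and "g \<in> Hom C y z" "h \<in> Hom C y z" "Comp C x y z g f = Comp C x y z h f"
  shows "g = h"
proof -
  interpret category C by fact
  obtain k where k: "k \<in> Hom C y x" "Comp C y x y f k = Ident C y" "f \<in> Hom C x y"
    using assms(2) by (auto simp: iso_arrow_def)
  have "Comp C y y z g (Comp C y x y f k) = Comp C y y z h (Comp C y x y f k)"
    using assms k(1,3) by (simp flip: Comp_assoc)
  then show ?thesis using assms k by (simp add: Comp_Ident_right)
qed

context groupoid
begin

definition ginv :: "'a \<Rightarrow> 'a \<Rightarrow> 'b \<Rightarrow> 'b" where
  "ginv x y f = (SOME g. g \<in> Hom C y x \<and> Comp C x y x g f = Ident C x \<and> Comp C y x y f g = Ident C y)"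

lemma ginv:
  assumes "x \<in> Obj C" "y \<in> Obj C" "f \<in> Hom C x y"
  shows "ginv x y f \<in> Hom C y x" "Comp C x y x (ginv x y f) f = Ident C x"
    "Comp C y x y f (ginv x y f) = Ident C y"
proof -
  have "\<exists>g. g \<in> Hom C y x \<and> Comp C x y x g f = Ident C x \<and> Comp C y x y f g = Ident C y"
    using all_iso[OF assms] by (auto simp: iso_arrow_def)
  from someI_ex[OF this] show "ginv x y f \<in> Hom C y x" "Comp C x y x (ginv x y f) f = Ident C x"
    "Comp C y x y f (ginv x y f) = Ident C y"
    by (simp_all add: ginv_def)
qed

lemma comp_inj_right:
  assumes "x \<in> Obj C" "y \<in> Obj C" "z \<in> Obj C" "f \<in> Hom C x y" "g \<in> Hom C y z" "h \<in> Hom C y z"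
    "Comp C x y z g f = Comp C x y z h f"
  shows "g = h"
  by (rule iso_arrow_cancel[OF category_axioms all_iso]) (use assms in auto)

text \<open>The rule for the inverse of a composite, in the forms where that inverse meets one of
  the two factors. They are what changes of index \<open>a \<mapsto> g \<circ> a\<close>
  produce.\<close>

lemma ginv_comp_left:
  assumes "x \<in> Obj C" "y \<in> Obj C" "z \<in> Obj C" "f \<in> Hom C x y" "g \<in> Hom C y z"
  shows "Comp C z y z g (Comp C z x y f (ginv x z (Comp C x y z g f))) = Ident C z" (is ?A)
    and "Comp C z x y f (ginv x z (Comp C x y z g f)) = ginv y z g" (is ?B)
    and "Comp C y z x (ginv x z (Comp C x y z g f)) g = ginv x y f" (is ?C)
proof -
  note [simp] = Comp_closed Comp_Ident_left Comp_Ident_right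
  let ?h = "Comp C x y z g f"
  have h: "?h \<in> Hom C x z" using assms by simp
  note i = ginv[OF assms(1,3) h] and ig = ginv[OF assms(2,3,5)] and i_f = ginv[OF assms(1,2,4)]
  show A: ?A
    using i(1,3) assms Comp_assoc[of z x y z "ginv x z ?h" f g] by simp
  show ?B
    using assms i(1) ig A Comp_assoc[of z y z y "Comp C z x y f (ginv x z ?h)" g "ginv y z g"] by simp
  show ?C
  proof (rule comp_inj_right[of x y x f])
    show "Comp C x y x (Comp C y z x (ginv x z ?h) g) f = Comp C x y x (ginv x y f) f"
      using assms i i_f Comp_assoc[of x y z x f g "ginv x z ?h"] by simp
  qed (use assms i i_f in auto)
qed

lemma bij_comp_left:
  assumes [simp]: "x \<in> Obj C" "y \<in> Obj C" "z \<in> Obj C" and g: "g \<in> Hom C y z"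
  shows "bij_betw (\<lambda>f. Comp C x y z g f) (Hom C x y) (Hom C x z)"
  by (rule bij_betw_byWitness[where f' = "\<lambda>h. Comp C x z y (ginv y z g) h"])
    (use g ginv[OF assms(2,3) g] in \<open>auto simp: Comp_closed Comp_Ident_left simp flip: Comp_assoc\<close>)

lemma bij_comp_right:
  assumes [simp]: "x \<in> Obj C" "y \<in> Obj C" "z \<in> Obj C" and f: "f \<in> Hom C x y"
  shows "bij_betw (\<lambda>g. Comp C x y z g f) (Hom C y z) (Hom C x z)"
  by (rule bij_betw_byWitness[where f' = "\<lambda>h. Comp C y x z h (ginv x y f)"])
    (use f ginv[OF assms(1,2) f] in \<open>auto simp: Comp_closed Comp_Ident_right Comp_assoc\<close>)

lemma bij_ginv:
  assumes [simp]: "x \<in> Obj C" "y \<in> Obj C"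
  shows "bij_betw (ginv x y) (Hom C x y) (Hom C y x)"
proof (rule bij_betw_byWitness[where f' = "ginv y x"])
  have "ginv x y (ginv y x f) = f" if f: "f \<in> Hom C y x" and [simp]: "x \<in> Obj C" "y \<in> Obj C" for x y f
  proof (rule comp_inj_right[of x y x "ginv y x f"])
    note i = ginv[OF that(3,2) f] and j = ginv[OF that(2,3) ginv(1)[OF that(3,2) f]]
    show "ginv y x f \<in> Hom C x y" "ginv x y (ginv y x f) \<in> Hom C y x" "f \<in> Hom C y x"
      "Comp C x y x (ginv x y (ginv y x f)) (ginv y x f) = Comp C x y x f (ginv y x f)"
      using i j f by simp_all
  qed auto
  then show "\<forall>f\<in>Hom C x y. ginv y x (ginv x y f) = f" "\<forall>f\<in>Hom C y x. ginv x y (ginv y x f) = f"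
    by simp_all
qed (auto simp: ginv)

end

text \<open>If \<open>S\<close> has exactly one object in each isomorphism class, the weight of \<open>s\<close> is the
  inverse of the order of its automorphism group.\<close>

locale averaging = groupoid X for X :: "('x, 'a, 'm) cat_scheme" +
  fixes S :: "'x set" and w :: "'x \<Rightarrow> complex"
  assumes finite_S: "finite S" and S_Obj: "s \<in> S \<Longrightarrow> s \<in> Obj X"
    and finite_Hom: "x \<in> Obj X \<Longrightarrow> y \<in> Obj X \<Longrightarrow> finite (Hom X x y)"
    and weights: "y \<in> Obj X \<Longrightarrow> (\<Sum>s\<in>S. w s * of_nat (card (Hom X s y))) = 1"
begin

text \<open>A sum with value 1 has a nonzero term, so \<open>S\<close> meets every isomorphism
  class.\<close>

lemma ex_arrow:
  assumes "y \<in> Obj X"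
  obtains s a where "s \<in> S" "a \<in> Hom X s y"
proof -
  have "\<exists>s\<in>S. Hom X s y \<noteq> {}"
  proof (rule ccontr)
    assume "\<not> (\<exists>s\<in>S. Hom X s y \<noteq> {})"
    then have "(\<Sum>s\<in>S. w s * of_nat (card (Hom X s y))) = 0" by (intro sum.neutral) auto
    with weights[OF assms] show False by simp
  qed
  then show ?thesis using that by blast
qed

lemma weights': "y \<in> Obj X \<Longrightarrow> (\<Sum>s\<in>S. w s * of_nat (card (Hom X y s))) = 1"
  using weights[of y] bij_betw_same_card[OF bij_ginv, of _ y] by (simp add: S_Obj cong: sum.cong)

lemma sum_weights:
  assumes "y \<in> Obj X"
  shows "(\<Sum>(s, a)\<in>Sigma S (\<lambda>s. Hom X s y). w s) = 1"
  using weights[OF assms] assms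
  by (subst sum.Sigma[symmetric]) (auto simp: finite_S finite_Hom S_Obj mult.commute)

end

text \<open>\<open>S\<close> is the image of the finite groupoid and may contain several isomorphic
  objects, so the weight of \<open>s\<close> is the inverse of the number \<open>N s\<close> of all
  arrows from \<open>s\<close> into \<open>S\<close>. This number depends only on the isomorphism
  class, and inversion exchanges \<open>Hom X s y\<close> with \<open>Hom X y s\<close>; hence the
  sum at \<open>y\<close> is \<open>N y / N y\<close>.\<close>

lemma essentially_finite_averaging:
  assumes "groupoid X" "essentially_finite X"
  obtains S w where "averaging X S w"
proof -
  interpret groupoid X by fact
  obtain G :: "(nat, nat) cat" and F K \<eta> where G: "finite_category G"
    and F: "cat_functor X G F" and K: "cat_functor G X K"
    and \<eta>: "\<eta> \<in> nat_trans X X (comp_functor X K F) (id_functor X)"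
      "\<And>x. x \<in> Obj X \<Longrightarrow> iso_arrow X (on_obj (comp_functor X K F) x) (on_obj (id_functor X) x) (\<eta> x)"
    using assms(2) unfolding essentially_finite_def equivalent_categories_def nat_isomorphic_def by blast
  interpret F: cat_functor X G F by fact
  interpret K: cat_functor G X K by fact
  have Fo: "on_obj F x \<in> Obj G" if "x \<in> Obj X" for x
    using F.on_obj that by auto
  have Ko: "on_obj K x \<in> Obj X" if "x \<in> Obj G" for x
    using K.on_obj that by auto
  have Fa: "on_arr F x y a \<in> Hom G (on_obj F x) (on_obj F y)"
    if "x \<in> Obj X" "y \<in> Obj X" "a \<in> Hom X x y" for x y a
    using F.on_arr that by (auto simp: PiE_iff)
  have \<eta>i: "iso_arrow X (on_obj K (on_obj F x)) x (\<eta> x)" if "x \<in> Obj X" for x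
    using \<eta>(2)[OF that] that by (simp add: comp_functor_def id_functor_def)
  have \<eta>n: "Comp X (on_obj K (on_obj F x)) (on_obj K (on_obj F y)) y (\<eta> y)
      (on_arr K (on_obj F x) (on_obj F y) (on_arr F x y a)) = Comp X (on_obj K (on_obj F x)) x y a (\<eta> x)"
    if "x \<in> Obj X" "y \<in> Obj X" "a \<in> Hom X x y" for x y a
    using \<eta>(1) that by (auto simp: nat_trans_def comp_functor_def id_functor_def)
  define S where "S = on_obj K ` Obj G"
  have S: "finite S" "S \<subseteq> Obj X"
    using G Ko by (auto simp: S_def finite_category_def)
  \<comment> \<open>\<open>F\<close> is faithful: by naturality of \<open>\<eta>\<close>, the arrow
    \<open>F a\<close> determines the composite of \<open>a\<close> with the invertible
    \<open>\<eta> x\<close>.\<close>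
  have fin: "finite (Hom X x y)" if xy: "x \<in> Obj X" "y \<in> Obj X" for x y
  proof (rule inj_on_finite)
    show "inj_on (on_arr F x y) (Hom X x y)"
    proof (rule inj_onI)
      fix a b assume ab: "a \<in> Hom X x y" "b \<in> Hom X x y" "on_arr F x y a = on_arr F x y b"
      have "Comp X (on_obj K (on_obj F x)) x y a (\<eta> x) = Comp X (on_obj K (on_obj F x)) x y b (\<eta> x)"
        using \<eta>n[OF xy ab(1)] \<eta>n[OF xy ab(2)] unfolding ab(3) by metis
      note e = this
      show "a = b"
        by (rule iso_arrow_cancel[OF category_axioms \<eta>i[OF xy(1)]])
          (use e ab xy Fo Ko in simp_all)
    qed
    show "on_arr F x y ` Hom X x y \<subseteq> Hom G (on_obj F x) (on_obj F y)"
      using Fa xy by auto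
    show "finite (Hom G (on_obj F x) (on_obj F y))"
      using G Fo xy by (simp add: finite_category_def)
  qed
  define N where "N x = (\<Sum>s\<in>S. card (Hom X x s))" for x
  have "averaging X S (\<lambda>s. 1 / of_nat (N s))"
  proof unfold_locales
    fix y assume y: "y \<in> Obj X"
    have card: "card (Hom X s t) = card (Hom X y t)" if s: "s \<in> S" "Hom X s y \<noteq> {}" and t: "t \<in> S" for s t
    proof -
      obtain a where "a \<in> Hom X s y" using s by auto
      from bij_betw_same_card[OF bij_comp_right[OF _ y _ this, of t]] show ?thesis
        using subsetD[OF S(2) s(1)] subsetD[OF S(2) t] by simp
    qed
    have "(\<Sum>s\<in>S. 1 / complex_of_nat (N s) * of_nat (card (Hom X s y))) =
      (\<Sum>s\<in>S. 1 / of_nat (N y) * of_nat (card (Hom X y s)))"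
    proof (rule sum.cong)
      fix s assume s: "s \<in> S"
      have inv: "card (Hom X s y) = card (Hom X y s)"
        using bij_betw_same_card[OF bij_ginv[of s y]] s y S by auto
      \<comment> \<open>Without an arrow from \<open>s\<close> to \<open>y\<close> the two numbers
        may differ, but then both cardinalities are 0.\<close>
      have "N s = N y" if "Hom X s y \<noteq> {}"
        using card[OF s that] by (simp add: N_def)
      then show "1 / complex_of_nat (N s) * of_nat (card (Hom X s y)) =
          1 / of_nat (N y) * of_nat (card (Hom X y s))"
        using inv by (cases "Hom X s y = {}") auto
    qed simp
    also have "\<dots> = 1 / of_nat (N y) * of_nat (N y)"
      unfolding N_def by (simp flip: sum_distrib_left sum_divide_distrib)
    \<comment> \<open>The inverse of \<open>\<eta> y\<close> is an arrow from \<open>y\<close> into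
      \<open>S\<close>.\<close>
    also have "N y \<noteq> 0"
    proof -
      have s: "on_obj K (on_obj F y) \<in> S" using Fo y by (auto simp: S_def)
      have "\<eta> y \<in> Hom X (on_obj K (on_obj F y)) y" using \<eta>i[OF y] by (simp add: iso_arrow_def)
      then have "ginv (on_obj K (on_obj F y)) y (\<eta> y) \<in> Hom X y (on_obj K (on_obj F y))"
        using ginv(1) s S y by auto
      then have "card (Hom X y (on_obj K (on_obj F y))) \<noteq> 0"
        using fin s S y by (auto simp: card_eq_0_iff)
      then show ?thesis using s S(1) by (auto simp: N_def)
    qed
    then have "1 / complex_of_nat (N y) * of_nat (N y) = 1" by simp
    finally show "(\<Sum>s\<in>S. 1 / complex_of_nat (N s) * of_nat (card (Hom X s y))) = 1" .
  qed (use S fin in auto)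
  then show ?thesis by (rule that)
qed

subsection \<open>Functors and natural transformations\<close>

lemma functor_obj: "cat_functor C D F \<Longrightarrow> x \<in> Obj C \<Longrightarrow> on_obj F x \<in> Obj D"
  using cat_functor.on_obj by fastforce

lemma functor_arr:
  "cat_functor C D F \<Longrightarrow> x \<in> Obj C \<Longrightarrow> y \<in> Obj C \<Longrightarrow> f \<in> Hom C x y \<Longrightarrow>
    on_arr F x y f \<in> Hom D (on_obj F x) (on_obj F y)"
  using cat_functor.on_arr[of C D F] by (auto simp: PiE_iff)

lemma nat_transI:
  assumes "\<And>x. x \<in> Obj C \<Longrightarrow> \<eta> x \<in> Hom D (on_obj F x) (on_obj G x)" "\<eta> \<in> extensional (Obj C)"
    and "\<And>x y f. x \<in> Obj C \<Longrightarrow> y \<in> Obj C \<Longrightarrow> f \<in> Hom C x y \<Longrightarrow>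
      Comp D (on_obj F x) (on_obj F y) (on_obj G y) (\<eta> y) (on_arr F x y f) =
      Comp D (on_obj F x) (on_obj G x) (on_obj G y) (on_arr G x y f) (\<eta> x)"
  shows "\<eta> \<in> nat_trans C D F G"
  using assms by (auto simp: nat_trans_def PiE_iff)

lemma nat_trans_arr: "\<eta> \<in> nat_trans C D F G \<Longrightarrow> x \<in> Obj C \<Longrightarrow> \<eta> x \<in> Hom D (on_obj F x) (on_obj G x)"
  by (auto simp: nat_trans_def)

lemma nat_trans_ext: "\<eta> \<in> nat_trans C D F G \<Longrightarrow> \<eta> \<in> extensional (Obj C)"
  by (auto simp: nat_trans_def PiE_iff)

lemma nat_trans_natural:
  "\<eta> \<in> nat_trans C D F G \<Longrightarrow> x \<in> Obj C \<Longrightarrow> y \<in> Obj C \<Longrightarrow> f \<in> Hom C x y \<Longrightarrow>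
      Comp D (on_obj F x) (on_obj F y) (on_obj G y) (\<eta> y) (on_arr F x y f) =
      Comp D (on_obj F x) (on_obj G x) (on_obj G y) (on_arr G x y f) (\<eta> x)"
  by (auto simp: nat_trans_def)

lemma nat_trans_eqI:
  "\<eta> \<in> nat_trans C D F G \<Longrightarrow> \<theta> \<in> nat_trans C D F' G' \<Longrightarrow> (\<And>x. x \<in> Obj C \<Longrightarrow> \<eta> x = \<theta> x) \<Longrightarrow> \<eta> = \<theta>"
  using extensionalityI[OF nat_trans_ext nat_trans_ext] by blast

lemma nat_trans_restrictI:
  "\<eta> \<in> nat_trans C D F G \<Longrightarrow> (\<And>x. x \<in> Obj C \<Longrightarrow> g x = \<eta> x) \<Longrightarrow> restrict g (Obj C) = \<eta>"
  by (rule extensionalityI[OF restrict_extensional nat_trans_ext]) auto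

lemma comp_functor_simps [simp]:
  "x \<in> Obj C \<Longrightarrow> on_obj (comp_functor C G F) x = on_obj G (on_obj F x)"
  "x \<in> Obj C \<Longrightarrow> y \<in> Obj C \<Longrightarrow> f \<in> Hom C x y \<Longrightarrow>
    on_arr (comp_functor C G F) x y f = on_arr G (on_obj F x) (on_obj F y) (on_arr F x y f)"
  by (simp_all add: comp_functor_def)

lemma id_functor_simps [simp]:
  "x \<in> Obj C \<Longrightarrow> on_obj (id_functor C) x = x"
  "x \<in> Obj C \<Longrightarrow> y \<in> Obj C \<Longrightarrow> f \<in> Hom C x y \<Longrightarrow> on_arr (id_functor C) x y f = f"
  by (simp_all add: id_functor_def)

lemma cat_functorI:
  assumes "category C" "category D"
    and "\<And>x. x \<in> Obj C \<Longrightarrow> h x \<in> Obj D"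
    and "\<And>x y f. x \<in> Obj C \<Longrightarrow> y \<in> Obj C \<Longrightarrow> f \<in> Hom C x y \<Longrightarrow> k x y f \<in> Hom D (h x) (h y)"
    and "\<And>x. x \<in> Obj C \<Longrightarrow> k x x (Ident C x) = Ident D (h x)"
    and "\<And>x y z f g. x \<in> Obj C \<Longrightarrow> y \<in> Obj C \<Longrightarrow> z \<in> Obj C \<Longrightarrow> f \<in> Hom C x y \<Longrightarrow> g \<in> Hom C y z \<Longrightarrow>
      k x z (Comp C x y z g f) = Comp D (h x) (h y) (h z) (k y z g) (k x y f)"
  shows "cat_functor C D \<lparr>on_obj = (\<lambda>x\<in>Obj C. h x), on_arr = (\<lambda>x\<in>Obj C. \<lambda>y\<in>Obj C. \<lambda>f\<in>Hom C x y. k x y f)\<rparr>"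
proof -
  interpret C: category C by fact
  interpret D: category D by fact
  show ?thesis
    by unfold_locales (use assms in \<open>auto simp: C.Ident_closed C.Comp_closed\<close>)
qed

lemma cat_functor_comp:
  assumes F: "cat_functor B C F" and G: "cat_functor C D G"
  shows "cat_functor B D (comp_functor B G F)"
  unfolding comp_functor_def
  by (rule cat_functorI)
    (use assms in \<open>auto simp: functor_obj[OF F] functor_obj[OF G] functor_arr[OF F] functor_arr[OF G]
      cat_functor.on_arr_Ident cat_functor.on_arr_Comp cat_functor_def\<close>)

lemma functor_category_simps [simp]:
  "Obj (functor_category C D) = {F. cat_functor C D F}"
  "Hom (functor_category C D) = nat_trans C D"
  "Ident (functor_category C D) F = (\<lambda>x \<in> Obj C. Ident D (on_obj F x))"
  "Comp (functor_category C D) F G H \<theta> \<eta> =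
     (\<lambda>x \<in> Obj C. Comp D (on_obj F x) (on_obj G x) (on_obj H x) (\<theta> x) (\<eta> x))"
  "carrier (Hom_space (functor_category C D) F G) = nat_trans C D F G"
  "\<zero>\<^bsub>Hom_space (functor_category C D) F G\<^esub> = (\<lambda>x \<in> Obj C. \<zero>\<^bsub>Hom_space D (on_obj F x) (on_obj G x)\<^esub>)"
  "\<eta> \<oplus>\<^bsub>Hom_space (functor_category C D) F G\<^esub> \<eta>' =
     (\<lambda>x \<in> Obj C. \<eta> x \<oplus>\<^bsub>Hom_space D (on_obj F x) (on_obj G x)\<^esub> \<eta>' x)"
  "c \<odot>\<^bsub>Hom_space (functor_category C D) F G\<^esub> \<eta> =
     (\<lambda>x \<in> Obj C. c \<odot>\<^bsub>Hom_space D (on_obj F x) (on_obj G x)\<^esub> \<eta> x)"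
  by (simp_all add: functor_category_def)

subsection \<open>The functor category\<close>

lemma zero_objectI:
  assumes "linear_category C" "z \<in> Obj C" "Ident C z = \<zero>\<^bsub>Hom_space C z z\<^esub>"
  shows "zero_object C z"
proof -
  interpret linear_category C by fact
  have "f = \<zero>\<^bsub>hs z x\<^esub>" if "x \<in> Obj C" "f \<in> Hom C z x" for x f
    using Comp_Ident_right[of z x f] that assms(2,3) by simp
  moreover have "f = \<zero>\<^bsub>hs x z\<^esub>" if "x \<in> Obj C" "f \<in> Hom C x z" for x f
    using Comp_Ident_left[of x z f] that assms(2,3) by simp
  ultimately show ?thesis
    unfolding zero_object_def using assms(2) by (metis hom_zero_closed)
qed

lemma zero_object_Ident:
  assumes "linear_category C" "zero_object C z"
  shows "Ident C z = \<zero>\<^bsub>Hom_space C z z\<^esub>"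
proof -
  interpret linear_category C by fact
  show ?thesis
    using assms(2) unfolding zero_object_def by (metis Ident_closed hom_zero_closed)
qed

text \<open>The target \<open>D\<close> is an arbitrary linear category, so that these arguments use
  arrows only. Elements of \<open>'v\<close> come in where vector spaces have to be
  constructed.\<close>

locale groupoid_functors = averaging X S w + D: linear_category D
  for X :: "('x, 'a, 'm) cat_scheme" and S w and D :: "('p, 'c) linear_cat"
begin

abbreviation Fun :: "(('x, 'a, 'p, 'c) func, 'x \<Rightarrow> 'c) linear_cat" where
  "Fun \<equiv> functor_category X D"

declare Ident_closed [simp] Comp_closed [simp] Comp_Ident_left [simp] Comp_Ident_right [simp]

lemma arr [simp]: "cat_functor X D F \<Longrightarrow> x \<in> Obj X \<Longrightarrow> y \<in> Obj X \<Longrightarrow> f \<in> Hom X x y \<Longrightarrow>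
    on_arr F x y f \<in> Hom D (on_obj F x) (on_obj F y)"
  by (rule functor_arr)

lemma obj [simp]: "cat_functor X D F \<Longrightarrow> x \<in> Obj X \<Longrightarrow> on_obj F x \<in> Obj D"
  by (rule functor_obj)

lemma Ident' [simp]: "cat_functor X D F \<Longrightarrow> x \<in> Obj X \<Longrightarrow> on_arr F x x (Ident X x) = Ident D (on_obj F x)"
  by (rule cat_functor.on_arr_Ident)

lemma functor_Comp: "cat_functor X D F \<Longrightarrow> x \<in> Obj X \<Longrightarrow> y \<in> Obj X \<Longrightarrow> z \<in> Obj X \<Longrightarrow>
    f \<in> Hom X x y \<Longrightarrow> g \<in> Hom X y z \<Longrightarrow>
    Comp D (on_obj F x) (on_obj F y) (on_obj F z) (on_arr F y z g) (on_arr F x y f) =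
    on_arr F x z (Comp X x y z g f)"
  by (simp add: cat_functor.on_arr_Comp)

declare nat_trans_arr [simp]

lemma nat_trans_Ident: "cat_functor X D F \<Longrightarrow> (\<lambda>x\<in>Obj X. Ident D (on_obj F x)) \<in> nat_trans X D F F"
  by (rule nat_transI) simp_all

lemma nat_trans_Comp:
  assumes F: "cat_functor X D F" "cat_functor X D G" "cat_functor X D H"
    and \<eta>: "\<eta> \<in> nat_trans X D F G" "\<theta> \<in> nat_trans X D G H"
  shows "(\<lambda>x\<in>Obj X. Comp D (on_obj F x) (on_obj G x) (on_obj H x) (\<theta> x) (\<eta> x)) \<in> nat_trans X D F H"
proof (rule nat_transI)
  fix x y f assume xy: "x \<in> Obj X" "y \<in> Obj X" "f \<in> Hom X x y"
  have "Comp D (on_obj F x) (on_obj F y) (on_obj H y)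
      (Comp D (on_obj F y) (on_obj G y) (on_obj H y) (\<theta> y) (\<eta> y)) (on_arr F x y f) =
    Comp D (on_obj F x) (on_obj G y) (on_obj H y) (\<theta> y)
      (Comp D (on_obj F x) (on_obj F y) (on_obj G y) (\<eta> y) (on_arr F x y f))"
    using xy F \<eta> by (simp add: D.Comp_assoc)
  also have "\<dots> = Comp D (on_obj F x) (on_obj G y) (on_obj H y) (\<theta> y)
      (Comp D (on_obj F x) (on_obj G x) (on_obj G y) (on_arr G x y f) (\<eta> x))"
    using xy \<eta> by (simp add: nat_trans_natural)
  also have "\<dots> = Comp D (on_obj F x) (on_obj G x) (on_obj H y)
      (Comp D (on_obj G x) (on_obj G y) (on_obj H y) (\<theta> y) (on_arr G x y f)) (\<eta> x)"
    using xy F \<eta> by (simp add: D.Comp_assoc)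
  also have "\<dots> = Comp D (on_obj F x) (on_obj H x) (on_obj H y) (on_arr H x y f)
      (Comp D (on_obj F x) (on_obj G x) (on_obj H x) (\<theta> x) (\<eta> x))"
    using xy F \<eta> by (simp add: D.Comp_assoc nat_trans_natural)
  finally show "Comp D (on_obj F x) (on_obj F y) (on_obj H y)
      ((\<lambda>x\<in>Obj X. Comp D (on_obj F x) (on_obj G x) (on_obj H x) (\<theta> x) (\<eta> x)) y) (on_arr F x y f) =
    Comp D (on_obj F x) (on_obj H x) (on_obj H y) (on_arr H x y f)
      ((\<lambda>x\<in>Obj X. Comp D (on_obj F x) (on_obj G x) (on_obj H x) (\<theta> x) (\<eta> x)) x)"
    using xy by simp
qed (use F \<eta> in simp_all)

lemma nat_trans_add:
  assumes F: "cat_functor X D F" "cat_functor X D G"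
    and \<eta>: "\<eta> \<in> nat_trans X D F G" "\<theta> \<in> nat_trans X D F G"
  shows "(\<lambda>x\<in>Obj X. \<eta> x \<oplus>\<^bsub>D.hs (on_obj F x) (on_obj G x)\<^esub> \<theta> x) \<in> nat_trans X D F G"
  by (rule nat_transI) (use F \<eta> in \<open>simp_all add: nat_trans_natural\<close>)

lemma nat_trans_smult:
  assumes F: "cat_functor X D F" "cat_functor X D G" and \<eta>: "\<eta> \<in> nat_trans X D F G"
  shows "(\<lambda>x\<in>Obj X. c \<odot>\<^bsub>D.hs (on_obj F x) (on_obj G x)\<^esub> \<eta> x) \<in> nat_trans X D F G"
  by (rule nat_transI) (use F \<eta> in \<open>simp_all add: nat_trans_natural\<close>)

lemma nat_trans_zero:
  assumes F: "cat_functor X D F" "cat_functor X D G"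
  shows "(\<lambda>x\<in>Obj X. \<zero>\<^bsub>D.hs (on_obj F x) (on_obj G x)\<^esub>) \<in> nat_trans X D F G"
  by (rule nat_transI) (use F in simp_all)

text \<open>An arrow from some \<open>s \<in> S\<close> to \<open>x\<close> expresses the component
  at \<open>x\<close> through the one at \<open>s\<close>. Hence \<open>S\<close> is the finite
  determining set that makes the hom-spaces finite-dimensional.\<close>

lemma nat_trans_zeroI:
  assumes F: "cat_functor X D F" "cat_functor X D G" and \<eta>: "\<eta> \<in> nat_trans X D F G"
    and zero: "\<And>s. s \<in> S \<Longrightarrow> \<eta> s = \<zero>\<^bsub>D.hs (on_obj F s) (on_obj G s)\<^esub>" and x: "x \<in> Obj X"
  shows "\<eta> x = \<zero>\<^bsub>D.hs (on_obj F x) (on_obj G x)\<^esub>"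
proof -
  obtain s a where sa: "s \<in> S" "a \<in> Hom X s x" using ex_arrow[OF x] .
  note s = S_Obj[OF sa(1)]
  note b = ginv[OF s x sa(2)]
  have "\<eta> x = Comp D (on_obj F x) (on_obj F x) (on_obj G x) (\<eta> x) (on_arr F x x (Comp X x s x a (ginv s x a)))"
    using F \<eta> x b by simp
  also have "\<dots> = Comp D (on_obj F x) (on_obj F s) (on_obj G x)
      (Comp D (on_obj F s) (on_obj F x) (on_obj G x) (\<eta> x) (on_arr F s x a)) (on_arr F x s (ginv s x a))"
    using F \<eta> x s sa b by (simp add: D.Comp_assoc functor_Comp)
  also have "\<dots> = \<zero>\<^bsub>D.hs (on_obj F x) (on_obj G x)\<^esub>"
    using F \<eta> x s sa b by (simp add: nat_trans_natural zero)
  finally show ?thesis .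
qed

lemma category_Fun: "category Fun"
proof unfold_locales
  fix F G H K \<eta> \<theta> \<kappa>
  assume "F \<in> Obj Fun" "G \<in> Obj Fun" "H \<in> Obj Fun" "K \<in> Obj Fun"
    "\<eta> \<in> Hom Fun F G" "\<theta> \<in> Hom Fun G H" "\<kappa> \<in> Hom Fun H K"
  then show "Comp Fun F G K (Comp Fun G H K \<kappa> \<theta>) \<eta> = Comp Fun F H K \<kappa> (Comp Fun F G H \<theta> \<eta>)"
    by (auto intro!: restrict_ext simp: D.Comp_assoc)
next
  fix F G \<eta> assume "F \<in> Obj Fun" "G \<in> Obj Fun" "\<eta> \<in> Hom Fun F G"
  then show "Comp Fun F G G (Ident Fun G) \<eta> = \<eta>" "Comp Fun F F G \<eta> (Ident Fun F) = \<eta>"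
    by (auto intro!: nat_trans_restrictI)
qed (auto intro: nat_trans_Ident nat_trans_Comp)

lemma fd_Hom_space_Fun:
  assumes F: "cat_functor X D F" "cat_functor X D G"
  shows "fd_space (Hom_space Fun F G)"
proof (rule fd_space_pointwise[where K = "Obj X" and V = "\<lambda>x. D.hs (on_obj F x) (on_obj G x)" and K\<^sub>0 = S])
  show "\<eta> = \<zero>\<^bsub>Hom_space Fun F G\<^esub>"
    if "\<eta> \<in> carrier (Hom_space Fun F G)" "\<And>s. s \<in> S \<Longrightarrow> \<eta> s = \<zero>\<^bsub>D.hs (on_obj F s) (on_obj G s)\<^esub>" for \<eta>
    using that nat_trans_zeroI[OF F, of \<eta>] by (auto intro!: nat_trans_restrictI[symmetric])
  show "carrier (Hom_space Fun F G) \<subseteq> (\<Pi>\<^sub>E x\<in>Obj X. carrier (D.hs (on_obj F x) (on_obj G x)))"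
  proof
    fix \<eta> assume "\<eta> \<in> carrier (Hom_space Fun F G)"
    then have \<eta>: "\<eta> \<in> nat_trans X D F G" by simp
    show "\<eta> \<in> (\<Pi>\<^sub>E x\<in>Obj X. carrier (D.hs (on_obj F x) (on_obj G x)))"
      using F nat_trans_ext[OF \<eta>] nat_trans_arr[OF \<eta>] by (simp add: PiE_iff)
  qed
qed (use F in \<open>auto simp: finite_S S_Obj D.fd_Hom_space nat_trans_zero nat_trans_add nat_trans_smult\<close>)

lemma linear_category_Fun: "linear_category Fun"
proof -
  interpret category Fun by (rule category_Fun)
  show ?thesis
  proof unfold_locales
    fix F G assume "F \<in> Obj Fun" "G \<in> Obj Fun"
    then show "fd_space (Hom_space Fun F G)" by (simp add: fd_Hom_space_Fun)
  next
    fix F G H \<eta> assume *: "F \<in> Obj Fun" "G \<in> Obj Fun" "H \<in> Obj Fun" "\<eta> \<in> Hom Fun F G"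
    show "(\<lambda>\<theta>. Comp Fun F G H \<theta> \<eta>) \<in> lin_hom (Hom_space Fun G H) (Hom_space Fun F H)"
      by (rule lin_homI) (use * in \<open>auto intro!: restrict_ext nat_trans_Comp\<close>)
  next
    fix F G H \<theta> assume *: "F \<in> Obj Fun" "G \<in> Obj Fun" "H \<in> Obj Fun" "\<theta> \<in> Hom Fun G H"
    show "(\<lambda>\<eta>. Comp Fun F G H \<theta> \<eta>) \<in> lin_hom (Hom_space Fun F G) (Hom_space Fun F H)"
      by (rule lin_homI) (use * in \<open>auto intro!: restrict_ext nat_trans_Comp\<close>)
  qed simp
qed

sublocale Fun: linear_category Fun
  by (rule linear_category_Fun)

lemma finsum_Fun:
  assumes F: "cat_functor X D F" "cat_functor X D G" and \<eta>: "\<eta> \<in> A \<rightarrow> nat_trans X D F G" and x: "x \<in> Obj X"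
  shows "(\<Oplus>\<^bsub>Hom_space Fun F G\<^esub>i\<in>A. \<eta> i) x = (\<Oplus>\<^bsub>D.hs (on_obj F x) (on_obj G x)\<^esub>i\<in>A. \<eta> i x)"
  by (rule lin_hom_finsum[of _ _ "\<lambda>\<eta>. \<eta> x"]) (use F \<eta> x in \<open>auto intro!: lin_homI Fun.cspace_hs\<close>)

section \<open>Zero objects, biproducts, idempotents and generalized inverses of functors\<close>

definition const_functor :: "'p \<Rightarrow> ('x, 'a, 'p, 'c) func" where
  "const_functor c = \<lparr>on_obj = (\<lambda>x\<in>Obj X. c),
     on_arr = (\<lambda>x\<in>Obj X. \<lambda>y\<in>Obj X. \<lambda>f\<in>Hom X x y. Ident D c)\<rparr>"

lemma const_functor_simps [simp]:
  "x \<in> Obj X \<Longrightarrow> on_obj (const_functor c) x = c"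
  "x \<in> Obj X \<Longrightarrow> y \<in> Obj X \<Longrightarrow> f \<in> Hom X x y \<Longrightarrow> on_arr (const_functor c) x y f = Ident D c"
  by (simp_all add: const_functor_def)

lemma cat_functor_const: "c \<in> Obj D \<Longrightarrow> cat_functor X D (const_functor c)"
  unfolding const_functor_def
  by (rule cat_functorI) (simp_all add: category_axioms D.category_axioms)

lemma zero_object_Fun:
  assumes "zero_object D z"
  shows "zero_object Fun (const_functor z)"
proof (rule zero_objectI[OF linear_category_Fun])
  have z: "z \<in> Obj D" using assms by (simp add: zero_object_def)
  then show "const_functor z \<in> Obj Fun" by (simp add: cat_functor_const)
  show "Ident Fun (const_functor z) = \<zero>\<^bsub>Hom_space Fun (const_functor z) (const_functor z)\<^esub>"
    using zero_object_Ident[OF D.linear_category_axioms assms] by (auto intro!: restrict_ext)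
qed

text \<open>The biproducts chosen at the various objects are unrelated, so the action on arrows is
  defined through them as the block diagonal sum of the \<open>F k\<close>. The rules
  \<open>bi\<close> and \<open>pb\<close> proved for it are the naturality of injections and
  projections, and functoriality follows from \<open>bi\<close>.\<close>

lemma biproduct_Fun:
  assumes F: "\<And>k. k < n \<Longrightarrow> cat_functor X D (F k)"
    and bi: "\<And>x. x \<in> Obj X \<Longrightarrow> \<exists>s. biproduct D n (\<lambda>k. on_obj (F k) x) s"
  shows "\<exists>B. biproduct Fun n F B"
proof -
  let ?o = "\<lambda>k. on_obj (F k)"
  note F [simp]
  \<comment> \<open>Bundles the whole biproduct structure at \<open>x\<close>, so that object,
    injections and projections are chosen together.\<close>
  define R where "R x s i p \<longleftrightarrow> s \<in> Obj D \<and>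
     (\<forall>k < n. i k \<in> Hom D (?o k x) s \<and> p k \<in> Hom D s (?o k x)) \<and>
     (\<forall>j < n. \<forall>k < n. Comp D (?o k x) s (?o j x) (p j) (i k) =
        (if j = k then Ident D (?o k x) else \<zero>\<^bsub>Hom_space D (?o k x) (?o j x)\<^esub>)) \<and>
     (\<Oplus>\<^bsub>Hom_space D s s\<^esub> k \<in> {..<n}. Comp D s (?o k x) s (i k) (p k)) = Ident D s" for x s i p
  have "\<exists>s i p. R x s i p" if "x \<in> Obj X" for x
    using bi[OF that] unfolding biproduct_def R_def by blast
  then obtain s i p where R: "\<And>x. x \<in> Obj X \<Longrightarrow> R x (s x) (i x) (p x)"
    by metis
  have s [simp]: "\<And>x. x \<in> Obj X \<Longrightarrow> s x \<in> Obj D"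
    and i [simp]: "\<And>x k. x \<in> Obj X \<Longrightarrow> k < n \<Longrightarrow> i x k \<in> Hom D (?o k x) (s x)"
    and p [simp]: "\<And>x k. x \<in> Obj X \<Longrightarrow> k < n \<Longrightarrow> p x k \<in> Hom D (s x) (?o k x)"
    and pi: "\<And>x j k. x \<in> Obj X \<Longrightarrow> j < n \<Longrightarrow> k < n \<Longrightarrow> Comp D (?o k x) (s x) (?o j x) (p x j) (i x k) =
        (if j = k then Ident D (?o k x) else \<zero>\<^bsub>D.hs (?o k x) (?o j x)\<^esub>)"
    and ip: "\<And>x. x \<in> Obj X \<Longrightarrow>
        (\<Oplus>\<^bsub>D.hs (s x) (s x)\<^esub> k \<in> {..<n}. Comp D (s x) (?o k x) (s x) (i x k) (p x k)) = Ident D (s x)"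
    using R unfolding R_def by blast+
  define t where "t x y f k = Comp D (s x) (?o k y) (s y) (i y k)
    (Comp D (s x) (?o k x) (?o k y) (on_arr (F k) x y f) (p x k))" for x y f k
  define b where "b x y f = (\<Oplus>\<^bsub>D.hs (s x) (s y)\<^esub> k \<in> {..<n}. t x y f k)" for x y f
  have t [simp]: "t x y f k \<in> Hom D (s x) (s y)"
    if "x \<in> Obj X" "y \<in> Obj X" "f \<in> Hom X x y" "k < n" for x y f k
    using that by (simp add: t_def)
  have b [simp]: "b x y f \<in> Hom D (s x) (s y)"
    if "x \<in> Obj X" "y \<in> Obj X" "f \<in> Hom X x y" for x y f
    using that by (simp add: b_def)
  have bi: "Comp D (?o k x) (s x) (s y) (b x y f) (i x k) = Comp D (?o k x) (?o k y) (s y) (i y k) (on_arr (F k) x y f)"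
    if [simp]: "x \<in> Obj X" "y \<in> Obj X" "f \<in> Hom X x y" "k < n" for x y f k
  proof -
    have "Comp D (?o k x) (s x) (s y) (b x y f) (i x k) =
        (\<Oplus>\<^bsub>D.hs (?o k x) (s y)\<^esub> j \<in> {..<n}. Comp D (?o k x) (s x) (s y) (t x y f j) (i x k))"
      unfolding b_def by (rule D.Comp_finsum_left) simp_all
    also have "\<dots> = Comp D (?o k x) (s x) (s y) (t x y f k) (i x k)"
      by (rule vs_finsum_single) (simp_all add: t_def D.Comp_assoc pi)
    finally show ?thesis by (simp add: t_def D.Comp_assoc pi)
  qed
  have pb: "Comp D (s x) (s y) (?o k y) (p y k) (b x y f) = Comp D (s x) (?o k x) (?o k y) (on_arr (F k) x y f) (p x k)"
    if [simp]: "x \<in> Obj X" "y \<in> Obj X" "f \<in> Hom X x y" "k < n" for x y f k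
  proof -
    have pt: "Comp D (s x) (s y) (?o k y) (p y k) (t x y f j) = (if j = k then
        Comp D (s x) (?o k x) (?o k y) (on_arr (F k) x y f) (p x k) else \<zero>\<^bsub>D.hs (s x) (?o k y)\<^esub>)" if "j < n" for j
      using that pi[of y k j] by (simp add: t_def flip: D.Comp_assoc)
    have "Comp D (s x) (s y) (?o k y) (p y k) (b x y f) =
        (\<Oplus>\<^bsub>D.hs (s x) (?o k y)\<^esub> j \<in> {..<n}. Comp D (s x) (s y) (?o k y) (p y k) (t x y f j))"
      unfolding b_def by (rule D.Comp_finsum_right) simp_all
    also have "\<dots> = Comp D (s x) (s y) (?o k y) (p y k) (t x y f k)"
      by (rule vs_finsum_single) (simp_all add: pt)
    finally show ?thesis by (simp add: pt)
  qed
  define B where "B = \<lparr>on_obj = (\<lambda>x\<in>Obj X. s x), on_arr = (\<lambda>x\<in>Obj X. \<lambda>y\<in>Obj X. \<lambda>f\<in>Hom X x y. b x y f)\<rparr>"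
  have B [simp]: "cat_functor X D B"
    unfolding B_def
  proof (rule cat_functorI)
    show "b x x (Ident X x) = Ident D (s x)" if "x \<in> Obj X" for x
      unfolding b_def using that by (subst ip[symmetric]) (auto intro!: vs_finsum_cong simp: t_def)
  next
    fix x y z f g
    assume [simp]: "x \<in> Obj X" "y \<in> Obj X" "z \<in> Obj X" "f \<in> Hom X x y" "g \<in> Hom X y z"
    have "Comp D (s x) (s y) (s z) (b y z g) (b x y f) =
        (\<Oplus>\<^bsub>D.hs (s x) (s z)\<^esub> k \<in> {..<n}. Comp D (s x) (s y) (s z) (b y z g) (t x y f k))"
      unfolding b_def[of x] by (rule D.Comp_finsum_right) simp_all
    also have "\<dots> = (\<Oplus>\<^bsub>D.hs (s x) (s z)\<^esub> k \<in> {..<n}. t x z (Comp X x y z g f) k)"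
    proof (rule vs_finsum_cong)
      fix k assume "k \<in> {..<n}"
      then have [simp]: "k < n" by simp
      have "Comp D (s x) (s y) (s z) (b y z g) (t x y f k) =
        Comp D (s x) (?o k y) (s z) (Comp D (?o k y) (s y) (s z) (b y z g) (i y k))
          (Comp D (s x) (?o k x) (?o k y) (on_arr (F k) x y f) (p x k))"
        by (simp add: t_def D.Comp_assoc)
      also have "\<dots> = Comp D (s x) (?o k z) (s z) (i z k) (Comp D (s x) (?o k x) (?o k z)
          (Comp D (?o k x) (?o k y) (?o k z) (on_arr (F k) y z g) (on_arr (F k) x y f)) (p x k))"
        by (simp add: bi D.Comp_assoc)
      finally show "Comp D (s x) (s y) (s z) (b y z g) (t x y f k) = t x z (Comp X x y z g f) k"
        by (simp add: functor_Comp) (simp add: t_def)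
    qed auto
    finally show "b x z (Comp X x y z g f) = Comp D (s x) (s y) (s z) (b y z g) (b x y f)"
      by (simp add: b_def)
  qed (simp_all add: category_axioms D.category_axioms)
  have Bs [simp]: "on_obj B x = s x" if "x \<in> Obj X" for x using that by (simp add: B_def)
  have Bb [simp]: "on_arr B x y f = b x y f" if "x \<in> Obj X" "y \<in> Obj X" "f \<in> Hom X x y" for x y f
    using that by (simp add: B_def)
  define I where "I k = (\<lambda>x\<in>Obj X. i x k)" for k
  define P where "P k = (\<lambda>x\<in>Obj X. p x k)" for k
  have I: "I k \<in> nat_trans X D (F k) B" if "k < n" for k
    by (rule nat_transI) (use that in \<open>simp_all add: I_def bi\<close>)
  have P: "P k \<in> nat_trans X D B (F k)" if "k < n" for k
    by (rule nat_transI) (use that in \<open>simp_all add: P_def pb\<close>)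
  have sum: "(\<Oplus>\<^bsub>Hom_space Fun B B\<^esub> k \<in> {..<n}. Comp Fun B (F k) B (I k) (P k)) = Ident Fun B" (is "?l = ?r")
  proof (rule nat_trans_eqI)
    have c: "(\<lambda>k. Comp Fun B (F k) B (I k) (P k)) \<in> {..<n} \<rightarrow> nat_trans X D B B"
      using I P nat_trans_Comp[OF B _ B] by auto
    then show "?l \<in> nat_trans X D B B"
      using Fun.hom_finsum_closed[of B B] by simp
    show "?r \<in> nat_trans X D B B" by (simp add: nat_trans_Ident)
    show "?l x = ?r x" if x: "x \<in> Obj X" for x
      unfolding finsum_Fun[OF B B c x] using x by (auto intro!: vs_finsum_cong simp: I_def P_def simp flip: ip)
  qed
  have IP: "\<forall>k<n. I k \<in> Hom Fun (F k) B \<and> P k \<in> Hom Fun B (F k)"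
    by (simp add: I P)
  have PI: "\<forall>j<n. \<forall>k<n. Comp Fun (F k) B (F j) (P j) (I k) =
      (if j = k then Ident Fun (F k) else \<zero>\<^bsub>Hom_space Fun (F k) (F j)\<^esub>)"
    by (auto simp: I_def P_def pi intro!: restrict_ext)
  have "B \<in> Obj Fun" by simp
  then show ?thesis
    unfolding biproduct_def using IP PI sum by blast
qed

lemma additive_Fun:
  assumes "additive_linear_category D"
  shows "additive_linear_category Fun"
proof -
  interpret D: additive_linear_category D by fact
  show ?thesis
  proof unfold_locales
    show "\<exists>z. zero_object Fun z" using D.ex_zero_object zero_object_Fun by blast
    show "\<exists>s. biproduct Fun n xs s" if "\<forall>k<n. xs k \<in> Obj Fun" for n xs
      using that by (intro biproduct_Fun D.ex_biproduct) auto
  qed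
qed

text \<open>Splitting each component gives objects without an action of arrows; compressing
  \<open>F\<close> by \<open>i\<close> and \<open>r\<close> supplies one. Naturality of
  \<open>p = i \<circ> r\<close> makes \<open>i\<close> and \<open>r\<close> natural and the
  compression compatible with composition.\<close>

lemma split_idempotents_Fun:
  assumes split: "D.split_idempotents"
  shows "Fun.split_idempotents"
  unfolding Fun.split_idempotents_def
proof (intro ballI impI)
  fix F p assume "F \<in> Obj Fun" "p \<in> Hom Fun F F" and pp: "Comp Fun F F F p p = p"
  then have F [simp]: "cat_functor X D F" and p: "p \<in> nat_trans X D F F" by simp_all
  let ?o = "on_obj F"
  have px [simp]: "p x \<in> Hom D (?o x) (?o x)" if "x \<in> Obj X" for x using p that by simp
  have "Comp D (?o x) (?o x) (?o x) (p x) (p x) = p x" if "x \<in> Obj X" for x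
    using fun_cong[OF pp, of x] that by simp
  then have "\<forall>x. \<exists>y i r. x \<in> Obj X \<longrightarrow> y \<in> Obj D \<and> i \<in> Hom D y (?o x) \<and> r \<in> Hom D (?o x) y \<and>
      Comp D y (?o x) y r i = Ident D y \<and> Comp D (?o x) y (?o x) i r = p x"
    using split px obj[OF F] unfolding D.split_idempotents_def by metis
  then obtain y i r where y [simp]: "\<And>x. x \<in> Obj X \<Longrightarrow> y x \<in> Obj D"
    and i [simp]: "\<And>x. x \<in> Obj X \<Longrightarrow> i x \<in> Hom D (y x) (?o x)"
    and r [simp]: "\<And>x. x \<in> Obj X \<Longrightarrow> r x \<in> Hom D (?o x) (y x)"
    and ri: "\<And>x. x \<in> Obj X \<Longrightarrow> Comp D (y x) (?o x) (y x) (r x) (i x) = Ident D (y x)"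
    and ir: "\<And>x. x \<in> Obj X \<Longrightarrow> Comp D (?o x) (y x) (?o x) (i x) (r x) = p x"
    by metis
  have pi: "Comp D (y x) (?o x) (?o x) (p x) (i x) = i x" if "x \<in> Obj X" for x
    using that by (simp add: ir[symmetric] D.Comp_assoc ri)
  have rp: "Comp D (?o x) (?o x) (y x) (r x) (p x) = r x" if "x \<in> Obj X" for x
    using that D.Comp_assoc[of "?o x" "y x" "?o x" "y x" "r x" "i x" "r x"] by (simp add: ir[symmetric] ri)
  define b where "b u v f = Comp D (y u) (?o v) (y v) (r v) (Comp D (y u) (?o u) (?o v) (on_arr F u v f) (i u))" for u v f
  have b [simp]: "b u v f \<in> Hom D (y u) (y v)" if "u \<in> Obj X" "v \<in> Obj X" "f \<in> Hom X u v" for u v f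
    using that by (simp add: b_def)
  have pF: "Comp D (?o u) (?o v) (?o v) (p v) (on_arr F u v f) = Comp D (?o u) (?o u) (?o v) (on_arr F u v f) (p u)"
    if "u \<in> Obj X" "v \<in> Obj X" "f \<in> Hom X u v" for u v f
    using that p by (simp add: nat_trans_natural)
  have ib: "Comp D (y u) (y v) (?o v) (i v) (b u v f) = Comp D (y u) (?o u) (?o v) (on_arr F u v f) (i u)"
    if [simp]: "u \<in> Obj X" "v \<in> Obj X" "f \<in> Hom X u v" for u v f
  proof -
    have "Comp D (y u) (y v) (?o v) (i v) (b u v f) =
        Comp D (y u) (?o u) (?o v) (Comp D (?o u) (?o v) (?o v) (p v) (on_arr F u v f)) (i u)"
      by (simp add: b_def ir[symmetric] D.Comp_assoc)
    then show ?thesis by (simp add: pF D.Comp_assoc pi)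
  qed
  have br: "Comp D (?o u) (y u) (y v) (b u v f) (r u) = Comp D (?o u) (?o v) (y v) (r v) (on_arr F u v f)"
    if [simp]: "u \<in> Obj X" "v \<in> Obj X" "f \<in> Hom X u v" for u v f
  proof -
    have "Comp D (?o u) (y u) (y v) (b u v f) (r u) =
        Comp D (?o u) (?o v) (y v) (r v) (Comp D (?o u) (?o u) (?o v) (on_arr F u v f) (p u))"
      by (simp add: b_def ir[symmetric] D.Comp_assoc)
    also have "\<dots> = Comp D (?o u) (?o v) (y v) (Comp D (?o v) (?o v) (y v) (r v) (p v)) (on_arr F u v f)"
      by (simp add: D.Comp_assoc flip: pF)
    finally show ?thesis by (simp add: rp)
  qed
  define B where "B = \<lparr>on_obj = (\<lambda>x\<in>Obj X. y x), on_arr = (\<lambda>u\<in>Obj X. \<lambda>v\<in>Obj X. \<lambda>f\<in>Hom X u v. b u v f)\<rparr>"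
  have B [simp]: "cat_functor X D B"
    unfolding B_def
  proof (rule cat_functorI)
    show "b x x (Ident X x) = Ident D (y x)" if "x \<in> Obj X" for x
      using that by (simp add: b_def ri)
  next
    fix u v x f g
    assume [simp]: "u \<in> Obj X" "v \<in> Obj X" "x \<in> Obj X" "f \<in> Hom X u v" "g \<in> Hom X v x"
    have "Comp D (y u) (y v) (y x) (b v x g) (b u v f) = Comp D (y u) (?o v) (y x)
        (Comp D (?o v) (y v) (y x) (b v x g) (r v)) (Comp D (y u) (?o u) (?o v) (on_arr F u v f) (i u))"
      by (simp add: b_def[of u] D.Comp_assoc)
    also have "\<dots> = Comp D (y u) (?o x) (y x) (r x) (Comp D (y u) (?o u) (?o x)
        (Comp D (?o u) (?o v) (?o x) (on_arr F v x g) (on_arr F u v f)) (i u))"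
      by (simp add: br D.Comp_assoc)
    finally show "b u x (Comp X u v x g f) = Comp D (y u) (y v) (y x) (b v x g) (b u v f)"
      by (simp add: functor_Comp) (simp add: b_def)
  qed (simp_all add: category_axioms D.category_axioms)
  have Bs [simp]: "on_obj B x = y x" if "x \<in> Obj X" for x using that by (simp add: B_def)
  have Bb [simp]: "on_arr B u v f = b u v f" if "u \<in> Obj X" "v \<in> Obj X" "f \<in> Hom X u v" for u v f
    using that by (simp add: B_def)
  show "\<exists>B\<in>Obj Fun. \<exists>i\<in>Hom Fun B F. \<exists>r\<in>Hom Fun F B. Comp Fun B F B r i = Ident Fun B \<and> Comp Fun F B F i r = p"
  proof (intro bexI conjI)
    show "restrict i (Obj X) \<in> Hom Fun B F" "restrict r (Obj X) \<in> Hom Fun F B"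
      by (auto intro!: nat_transI simp: ib br)
    show "Comp Fun B F B (restrict r (Obj X)) (restrict i (Obj X)) = Ident Fun B"
      by (auto intro!: restrict_ext simp: ri)
    show "Comp Fun F B F (restrict i (Obj X)) (restrict r (Obj X)) = p"
      using p by (auto intro!: nat_trans_restrictI simp: ir)
  qed simp
qed

text \<open>The identity \<open>f \<circ> g \<circ> f = f\<close> is affine in \<open>g\<close>, so it survives averaging
  pointwise solutions \<open>g\<close> over the groupoid.\<close>

lemma regular_Fun:
  assumes reg: "D.regular"
  shows "Fun.regular"
  unfolding Fun.regular_def
proof (intro ballI)
  fix F G \<phi> assume "F \<in> Obj Fun" "G \<in> Obj Fun" "\<phi> \<in> Hom Fun F G"
  then have F [simp]: "cat_functor X D F" and G [simp]: "cat_functor X D G"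
    and \<phi> [simp]: "\<phi> \<in> nat_trans X D F G" by simp_all
  let ?o = "on_obj F" and ?u = "on_obj G"
  have \<phi>x [simp]: "\<phi> x \<in> Hom D (?o x) (?u x)" if "x \<in> Obj X" for x
    using \<phi> that by (rule nat_trans_arr)
  have "\<forall>x. \<exists>g. x \<in> Obj X \<longrightarrow> g \<in> Hom D (?u x) (?o x) \<and>
      Comp D (?o x) (?u x) (?u x) (Comp D (?u x) (?o x) (?u x) (\<phi> x) g) (\<phi> x) = \<phi> x"
    using reg obj[OF F] obj[OF G] \<phi>x unfolding D.regular_def by meson
  then obtain g where g [simp]: "\<And>x. x \<in> Obj X \<Longrightarrow> g x \<in> Hom D (?u x) (?o x)"
    and fgf: "\<And>x. x \<in> Obj X \<Longrightarrow> Comp D (?o x) (?u x) (?u x) (Comp D (?u x) (?o x) (?u x) (\<phi> x) (g x)) (\<phi> x) = \<phi> x"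
    by metis
  let ?I = "\<lambda>x. Sigma S (\<lambda>s. Hom X s x)"
  \<comment> \<open>The solution at \<open>s\<close>, conjugated to \<open>x\<close> by the arrow
    \<open>a\<close> and weighted; \<open>h\<close> is the average of these conjugates.\<close>
  define t where "t x = (\<lambda>(s, a). w s \<odot>\<^bsub>D.hs (?u x) (?o x)\<^esub> Comp D (?u x) (?o s) (?o x) (on_arr F s x a)
    (Comp D (?u x) (?u s) (?o s) (g s) (on_arr G x s (ginv s x a))))" for x
  define h where "h x = (\<Oplus>\<^bsub>D.hs (?u x) (?o x)\<^esub>k\<in>?I x. t x k)" for x
  have t [simp]: "t x k \<in> Hom D (?u x) (?o x)" if "x \<in> Obj X" "k \<in> ?I x" for x k
    using that S_Obj ginv(1) by (auto simp: t_def)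
  have h [simp]: "h x \<in> Hom D (?u x) (?o x)" if "x \<in> Obj X" for x
    using that by (simp add: h_def)
  have nat: "Comp D (?u x) (?u y) (?o y) (h y) (on_arr G x y c) = Comp D (?u x) (?o x) (?o y) (on_arr F x y c) (h x)"
    if [simp]: "x \<in> Obj X" "y \<in> Obj X" and c [simp]: "c \<in> Hom X x y" for x y c
  proof -
    \<comment> \<open>Composition with \<open>c\<close> permutes the terms: it carries the index set
      at \<open>x\<close> bijectively to the one at \<open>y\<close>, which makes the average
      natural.\<close>
    define m where "m = (\<lambda>(s, a). (s, Comp X s x y c a))"
    have bij: "bij_betw m (?I x) (?I y)"
      unfolding bij_betw_def
    proof
      have b: "bij_betw (Comp X s x y c) (Hom X s x) (Hom X s y)" if "s \<in> S" for s
        using bij_comp_left[OF S_Obj[OF that]] by simp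
      then show "inj_on m (?I x)"
        by (auto simp: m_def inj_on_def bij_betw_def)
      show "m ` ?I x = ?I y"
        using b by (fastforce simp: m_def bij_betw_def image_iff)
    qed
    have tm: "Comp D (?u x) (?u y) (?o y) (t y (m k)) (on_arr G x y c) = Comp D (?u x) (?o x) (?o y) (on_arr F x y c) (t x k)"
      if kI: "k \<in> ?I x" for k
    proof -
      obtain s a where k: "k = (s, a)" and s: "s \<in> S" and a [simp]: "a \<in> Hom X s x" using kI by (cases k) auto
      have [simp]: "s \<in> Obj X" using s by (rule S_Obj)
      note [simp] = ginv(1)
      have "Comp D (?u x) (?u y) (?o y) (t y (m k)) (on_arr G x y c) =
        w s \<odot>\<^bsub>D.hs (?u x) (?o y)\<^esub> Comp D (?u x) (?o s) (?o y) (on_arr F s y (Comp X s x y c a))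
          (Comp D (?u x) (?u s) (?o s) (g s) (Comp D (?u x) (?u y) (?u s)
            (on_arr G y s (ginv s y (Comp X s x y c a))) (on_arr G x y c)))"
        by (simp add: t_def m_def k D.Comp_assoc)
      also have "Comp D (?u x) (?u y) (?u s) (on_arr G y s (ginv s y (Comp X s x y c a))) (on_arr G x y c) =
          on_arr G x s (ginv s x a)"
        by (simp add: functor_Comp ginv_comp_left(3))
      also have "on_arr F s y (Comp X s x y c a) = Comp D (?o s) (?o x) (?o y) (on_arr F x y c) (on_arr F s x a)"
        by (simp add: functor_Comp)
      finally show ?thesis
        by (simp add: t_def k D.Comp_assoc)
    qed
    have "Comp D (?u x) (?u y) (?o y) (h y) (on_arr G x y c) =
        (\<Oplus>\<^bsub>D.hs (?u x) (?o y)\<^esub>k\<in>?I y. Comp D (?u x) (?u y) (?o y) (t y k) (on_arr G x y c))"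
      unfolding h_def by (rule D.Comp_finsum_left) simp_all
    also have "\<dots> = (\<Oplus>\<^bsub>D.hs (?u x) (?o y)\<^esub>k\<in>m ` ?I x. Comp D (?u x) (?u y) (?o y) (t y k) (on_arr G x y c))"
      using bij by (simp add: bij_betw_def)
    also have "\<dots> = (\<Oplus>\<^bsub>D.hs (?u x) (?o y)\<^esub>k\<in>?I x. Comp D (?u x) (?u y) (?o y) (t y (m k)) (on_arr G x y c))"
      by (rule vs_finsum_reindex) (use bij in \<open>auto simp: bij_betw_def\<close>)
    also have "\<dots> = (\<Oplus>\<^bsub>D.hs (?u x) (?o y)\<^esub>k\<in>?I x. Comp D (?u x) (?o x) (?o y) (on_arr F x y c) (t x k))"
      by (rule vs_finsum_cong) (auto simp: tm)
    also have "\<dots> = Comp D (?u x) (?o x) (?o y) (on_arr F x y c) (h x)"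
      unfolding h_def by (rule D.Comp_finsum_right[symmetric]) simp_all
    finally show ?thesis .
  qed
  have fhf: "Comp D (?o x) (?u x) (?u x) (Comp D (?u x) (?o x) (?u x) (\<phi> x) (h x)) (\<phi> x) = \<phi> x"
    if [simp]: "x \<in> Obj X" for x
  proof -
    \<comment> \<open>By naturality of \<open>\<phi>\<close>, a conjugate of a solution is again a
      solution. Each term therefore gives \<open>\<phi> x\<close> times its weight, and the weights
      add up to 1.\<close>
    have ftf: "Comp D (?o x) (?u x) (?u x) (Comp D (?u x) (?o x) (?u x) (\<phi> x) (t x k)) (\<phi> x) =
      w (fst k) \<odot>\<^bsub>D.hs (?o x) (?u x)\<^esub> \<phi> x" if kI: "k \<in> ?I x" for k
    proof -
      obtain s a where k: "k = (s, a)" and s: "s \<in> S" and a [simp]: "a \<in> Hom X s x" using kI by (cases k) auto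
      have [simp]: "s \<in> Obj X" using s by (rule S_Obj)
      note [simp] = ginv(1)
      let ?a = "ginv s x a"
      have e: "Comp D (?o x) (?u x) (?u s) (on_arr G x s ?a) (\<phi> x) = Comp D (?o x) (?o s) (?u s) (\<phi> s) (on_arr F x s ?a)"
        using nat_trans_natural[OF \<phi>, of x s ?a] by simp
      have "Comp D (?o x) (?u x) (?u x) (Comp D (?u x) (?o x) (?u x) (\<phi> x) (t x k)) (\<phi> x) =
        w s \<odot>\<^bsub>D.hs (?o x) (?u x)\<^esub> Comp D (?o x) (?o s) (?u x) (Comp D (?o s) (?o x) (?u x) (\<phi> x) (on_arr F s x a))
          (Comp D (?o x) (?u s) (?o s) (g s) (Comp D (?o x) (?u x) (?u s) (on_arr G x s ?a) (\<phi> x)))"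
        by (simp add: t_def k D.Comp_assoc)
      also have "\<dots> = w s \<odot>\<^bsub>D.hs (?o x) (?u x)\<^esub> Comp D (?o x) (?u s) (?u x) (on_arr G s x a)
          (Comp D (?o x) (?o s) (?u s) (Comp D (?o s) (?u s) (?u s) (Comp D (?u s) (?o s) (?u s) (\<phi> s) (g s)) (\<phi> s))
            (on_arr F x s ?a))"
        by (simp add: nat_trans_natural[OF \<phi>, of s x a] e D.Comp_assoc)
      also have "\<dots> = w s \<odot>\<^bsub>D.hs (?o x) (?u x)\<^esub> Comp D (?o x) (?u x) (?u x) (on_arr G x x (Comp X x s x a ?a)) (\<phi> x)"
        by (simp add: fgf functor_Comp flip: e D.Comp_assoc)
      finally show ?thesis by (simp add: k ginv)
    qed
    have "Comp D (?o x) (?u x) (?u x) (Comp D (?u x) (?o x) (?u x) (\<phi> x) (h x)) (\<phi> x) =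
      Comp D (?o x) (?u x) (?u x) (\<Oplus>\<^bsub>D.hs (?u x) (?u x)\<^esub>k\<in>?I x. Comp D (?u x) (?o x) (?u x) (\<phi> x) (t x k)) (\<phi> x)"
      unfolding h_def by (subst D.Comp_finsum_right) simp_all
    also have "\<dots> = (\<Oplus>\<^bsub>D.hs (?o x) (?u x)\<^esub>k\<in>?I x. Comp D (?o x) (?u x) (?u x) (Comp D (?u x) (?o x) (?u x) (\<phi> x) (t x k)) (\<phi> x))"
      by (rule D.Comp_finsum_left) simp_all
    also have "\<dots> = (\<Oplus>\<^bsub>D.hs (?o x) (?u x)\<^esub>k\<in>?I x. w (fst k) \<odot>\<^bsub>D.hs (?o x) (?u x)\<^esub> \<phi> x)"
      by (rule vs_finsum_cong) (simp_all add: ftf)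
    also have "\<dots> = (\<Sum>k\<in>?I x. w (fst k)) \<odot>\<^bsub>D.hs (?o x) (?u x)\<^esub> \<phi> x"
      by (rule vs_finsum_const_smult) simp_all
    also have "(\<Sum>k\<in>?I x. w (fst k)) = 1"
      using sum_weights[of x] by (simp add: case_prod_unfold)
    finally show ?thesis by simp
  qed
  have hn: "restrict h (Obj X) \<in> Hom Fun G F"
    unfolding functor_category_simps by (rule nat_transI) (simp_all add: nat)
  have "Comp Fun F G G (Comp Fun G F G \<phi> (restrict h (Obj X))) \<phi> = \<phi>"
    using \<phi> by (auto intro!: nat_trans_restrictI[OF \<phi>] simp: fhf)
  then show "\<exists>\<gamma>\<in>Hom Fun G F. Comp Fun F G G (Comp Fun G F G \<phi> \<gamma>) \<phi> = \<phi>"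
    by (rule bexI[OF _ hn])
qed

end

subsection \<open>The pushforward\<close>

text \<open>The value at \<open>x\<close> of the Kan extension of \<open>F\<close> along \<open>f\<close>: an object \<open>P\<close> that is at the same
  time a colimit, with cocone \<open>\<iota>\<close>, and a limit, with cone \<open>\<pi>\<close>, of \<open>F\<close> over the category of
  pairs of an object \<open>y\<close> and an arrow \<open>a : f y \<rightarrow> x\<close>.\<close>

definition kan_data ::
  "('y, 'b, 'n) cat_scheme \<Rightarrow> 'y set \<Rightarrow> ('y \<Rightarrow> complex) \<Rightarrow> ('x, 'a, 'm) cat_scheme \<Rightarrow> ('y, 'b, 'x, 'a) func \<Rightarrow>
   ('p, 'c) linear_cat \<Rightarrow> ('y, 'b, 'p, 'c) func \<Rightarrow> 'x \<Rightarrow> 'p \<Rightarrow> ('y \<Rightarrow> 'a \<Rightarrow> 'c) \<Rightarrow> ('y \<Rightarrow> 'a \<Rightarrow> 'c) \<Rightarrow> bool" where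
  "kan_data Y S w X f D F x P \<iota> \<pi> \<longleftrightarrow> P \<in> Obj D \<and>
     (\<forall>y\<in>Obj Y. \<forall>a\<in>Hom X (on_obj f y) x. \<iota> y a \<in> Hom D (on_obj F y) P \<and> \<pi> y a \<in> Hom D P (on_obj F y)) \<and>
     (\<forall>y\<in>Obj Y. \<forall>y'\<in>Obj Y. \<forall>b\<in>Hom Y y y'. \<forall>a\<in>Hom X (on_obj f y') x.
        Comp D (on_obj F y) (on_obj F y') P (\<iota> y' a) (on_arr F y y' b) =
          \<iota> y (Comp X (on_obj f y) (on_obj f y') x a (on_arr f y y' b)) \<and>
        Comp D P (on_obj F y) (on_obj F y') (on_arr F y y' b)
          (\<pi> y (Comp X (on_obj f y) (on_obj f y') x a (on_arr f y y' b))) = \<pi> y' a) \<and>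
     (\<forall>y\<in>Obj Y. \<forall>y'\<in>Obj Y. \<forall>a\<in>Hom X (on_obj f y) x. \<forall>a'\<in>Hom X (on_obj f y') x.
        Comp D (on_obj F y) P (on_obj F y') (\<pi> y' a') (\<iota> y a) =
        (\<Oplus>\<^bsub>Hom_space D (on_obj F y) (on_obj F y')\<^esub>
           b \<in> {b \<in> Hom Y y y'. Comp X (on_obj f y) (on_obj f y') x a' (on_arr f y y' b) = a}. on_arr F y y' b)) \<and>
     (\<Oplus>\<^bsub>Hom_space D P P\<^esub> k \<in> Sigma S (\<lambda>s. Hom X (on_obj f s) x).
        w (fst k) \<odot>\<^bsub>Hom_space D P P\<^esub> Comp D P (on_obj F (fst k)) P (\<iota> (fst k) (snd k)) (\<pi> (fst k) (snd k))) = Ident D P"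

locale kan_context = YF: groupoid_functors Y S w D + XF: groupoid_functors X S' w' D + f: cat_functor Y X f
  for Y :: "('y, 'b, 'n) cat_scheme" and S w and D :: "('p, 'c) linear_cat"
    and X :: "('x, 'a, 'm) cat_scheme" and S' w' and f :: "('y, 'b, 'x, 'a) func"
begin

abbreviation fo :: "'y \<Rightarrow> 'x" where "fo \<equiv> on_obj f"
abbreviation fa :: "'y \<Rightarrow> 'y \<Rightarrow> 'b \<Rightarrow> 'a" where "fa \<equiv> on_arr f"

lemma fo [simp]: "y \<in> Obj Y \<Longrightarrow> fo y \<in> Obj X"
  by (rule functor_obj[OF f.cat_functor_axioms])

lemma fa [simp]: "y \<in> Obj Y \<Longrightarrow> y' \<in> Obj Y \<Longrightarrow> b \<in> Hom Y y y' \<Longrightarrow> fa y y' b \<in> Hom X (fo y) (fo y')"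
  by (rule functor_arr[OF f.cat_functor_axioms])

abbreviation "I x \<equiv> Sigma S (\<lambda>s. Hom X (fo s) x)"

lemma I_D: "k \<in> I x \<Longrightarrow> fst k \<in> Obj Y" "k \<in> I x \<Longrightarrow> snd k \<in> Hom X (fo (fst k)) x"
  using YF.S_Obj by auto

section \<open>Counting the arrows of \<open>Y\<close> over an arrow of \<open>X\<close>\<close>

context
  fixes x
  assumes x: "x \<in> Obj X"
begin

text \<open>For fixed \<open>s\<close>, every \<open>b : s \<rightarrow> y\<close> is counted at
  exactly one arrow to \<open>x\<close>, namely \<open>a \<circ> f b\<close>, so the condition on
  the weights remains. This is the count behind the limit property.\<close>

lemma count_into:
  assumes y: "y \<in> Obj Y" and a: "a \<in> Hom X (fo y) x"
  shows "(\<Sum>k\<in>I x. w (fst k) * of_nat (card {b \<in> Hom Y (fst k) y. Comp X (fo (fst k)) (fo y) x a (fa (fst k) y b) = snd k})) = 1"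
proof -
  note [simp] = x y a YF.S_Obj YF.finite_Hom XF.finite_Hom
  have "(\<Sum>k\<in>I x. w (fst k) * of_nat (card {b \<in> Hom Y (fst k) y. Comp X (fo (fst k)) (fo y) x a (fa (fst k) y b) = snd k})) =
    (\<Sum>s\<in>S. \<Sum>c\<in>Hom X (fo s) x. w s * of_nat (card {b \<in> Hom Y s y. Comp X (fo s) (fo y) x a (fa s y b) = c}))"
    by (subst sum.Sigma) (auto simp: YF.finite_S case_prod_unfold)
  also have "\<dots> = (\<Sum>s\<in>S. w s * of_nat (card (Hom Y s y)))"
  proof (rule sum.cong)
    fix s assume [simp]: "s \<in> S"
    have "(\<Sum>c\<in>Hom X (fo s) x. card {b \<in> Hom Y s y. Comp X (fo s) (fo y) x a (fa s y b) = c}) =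
        (\<Sum>c\<in>Hom X (fo s) x. \<Sum>b\<in>Hom Y s y. if Comp X (fo s) (fo y) x a (fa s y b) = c then 1 else 0)"
      by (simp add: sum.If_cases Int_def)
    also have "\<dots> = (\<Sum>b\<in>Hom Y s y. \<Sum>c\<in>Hom X (fo s) x. if Comp X (fo s) (fo y) x a (fa s y b) = c then 1 else 0)"
      by (rule sum.swap)
    also have "\<dots> = (\<Sum>b\<in>Hom Y s y. 1)"
      by (rule sum.cong) (simp_all add: sum.delta)
    finally show "(\<Sum>c\<in>Hom X (fo s) x. w s * of_nat (card {b \<in> Hom Y s y. Comp X (fo s) (fo y) x a (fa s y b) = c})) =
        w s * of_nat (card (Hom Y s y))"
      by (simp flip: sum_distrib_left of_nat_sum)
  qed simp
  also have "\<dots> = 1" using YF.weights by simp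
  finally show ?thesis .
qed

text \<open>Here \<open>b : y \<rightarrow> s\<close> is counted at the unique \<open>c\<close> with
  \<open>c \<circ> f b = a\<close>, which exists because \<open>f b\<close> is invertible. This is
  the count behind the colimit property.\<close>

lemma count_from:
  assumes y: "y \<in> Obj Y" and a: "a \<in> Hom X (fo y) x"
  shows "(\<Sum>k\<in>I x. w (fst k) * of_nat (card {b \<in> Hom Y y (fst k). Comp X (fo y) (fo (fst k)) x (snd k) (fa y (fst k) b) = a})) = 1"
proof -
  note [simp] = x y a YF.S_Obj YF.finite_Hom XF.finite_Hom
  have "(\<Sum>k\<in>I x. w (fst k) * of_nat (card {b \<in> Hom Y y (fst k). Comp X (fo y) (fo (fst k)) x (snd k) (fa y (fst k) b) = a})) =
    (\<Sum>s\<in>S. \<Sum>c\<in>Hom X (fo s) x. w s * of_nat (card {b \<in> Hom Y y s. Comp X (fo y) (fo s) x c (fa y s b) = a}))"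
    by (subst sum.Sigma) (auto simp: YF.finite_S case_prod_unfold)
  also have "\<dots> = (\<Sum>s\<in>S. w s * of_nat (card (Hom Y y s)))"
  proof (rule sum.cong)
    fix s assume [simp]: "s \<in> S"
    have uniq: "\<exists>c\<^sub>0\<in>Hom X (fo s) x. \<forall>c\<in>Hom X (fo s) x. Comp X (fo y) (fo s) x c (fa y s b) = a \<longleftrightarrow> c = c\<^sub>0"
      if "b \<in> Hom Y y s" for b
    proof -
      have bij: "bij_betw (\<lambda>c. Comp X (fo y) (fo s) x c (fa y s b)) (Hom X (fo s) x) (Hom X (fo y) x)"
        using that by (intro XF.bij_comp_right) auto
      then obtain c\<^sub>0 where c\<^sub>0: "c\<^sub>0 \<in> Hom X (fo s) x" "a = Comp X (fo y) (fo s) x c\<^sub>0 (fa y s b)"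
        using a unfolding bij_betw_def by blast
      then have "\<forall>c\<in>Hom X (fo s) x. Comp X (fo y) (fo s) x c (fa y s b) = a \<longleftrightarrow> c = c\<^sub>0"
        using bij_betw_imp_inj_on[OF bij] inj_onD by fastforce
      with c\<^sub>0(1) show ?thesis by blast
    qed
    have "(\<Sum>c\<in>Hom X (fo s) x. card {b \<in> Hom Y y s. Comp X (fo y) (fo s) x c (fa y s b) = a}) =
        (\<Sum>c\<in>Hom X (fo s) x. \<Sum>b\<in>Hom Y y s. if Comp X (fo y) (fo s) x c (fa y s b) = a then 1 else 0)"
      by (simp add: sum.If_cases Int_def)
    also have "\<dots> = (\<Sum>b\<in>Hom Y y s. \<Sum>c\<in>Hom X (fo s) x. if Comp X (fo y) (fo s) x c (fa y s b) = a then 1 else 0)"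
      by (rule sum.swap)
    also have "\<dots> = (\<Sum>b\<in>Hom Y y s. 1)"
    proof (rule sum.cong)
      fix b assume "b \<in> Hom Y y s"
      from uniq[OF this] obtain c\<^sub>0 where c\<^sub>0: "c\<^sub>0 \<in> Hom X (fo s) x"
        "\<And>c. c \<in> Hom X (fo s) x \<Longrightarrow> Comp X (fo y) (fo s) x c (fa y s b) = a \<longleftrightarrow> c = c\<^sub>0" by auto
      then have "(\<Sum>c\<in>Hom X (fo s) x. if Comp X (fo y) (fo s) x c (fa y s b) = a then 1 else 0) =
          (\<Sum>c\<in>Hom X (fo s) x. if c = c\<^sub>0 then 1 else 0 :: nat)"
        by (intro sum.cong) auto
      then show "(\<Sum>c\<in>Hom X (fo s) x. if Comp X (fo y) (fo s) x c (fa y s b) = a then 1 else 0) = (1::nat)"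
        using c\<^sub>0(1) by simp
    qed simp
    finally show "(\<Sum>c\<in>Hom X (fo s) x. w s * of_nat (card {b \<in> Hom Y y s. Comp X (fo y) (fo s) x c (fa y s b) = a})) =
        w s * of_nat (card (Hom Y y s))"
      by (simp flip: sum_distrib_left of_nat_sum)
  qed simp
  also have "\<dots> = 1" using YF.weights' by simp
  finally show ?thesis .
qed

end

end

text \<open>The values are postulated here and constructed for vector spaces in
  \<open>ex_kan_data_Vect\<close>. Functoriality and both adjunctions follow from the equations of
  \<open>kan_data\<close> alone.\<close>

locale pushforward = kan_context Y S w D X S' w' f
  for Y :: "('y, 'b, 'n) cat_scheme" and S w and D :: "('p, 'c) linear_cat"
    and X :: "('x, 'a, 'm) cat_scheme" and S' w' and f :: "('y, 'b, 'x, 'a) func" +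
  assumes ex_kan_data: "cat_functor Y D F \<Longrightarrow> x \<in> Obj X \<Longrightarrow> \<exists>P \<iota> \<pi>. kan_data Y S w X f D F x P \<iota> \<pi>"
begin

text \<open>One choice for the whole triple, so that object, cocone and cone belong
  together.\<close>

definition kan :: "('y, 'b, 'p, 'c) func \<Rightarrow> 'x \<Rightarrow> 'p \<times> ('y \<Rightarrow> 'a \<Rightarrow> 'c) \<times> ('y \<Rightarrow> 'a \<Rightarrow> 'c)" where
  "kan F x = (SOME k. kan_data Y S w X f D F x (fst k) (fst (snd k)) (snd (snd k)))"

abbreviation "P F x \<equiv> fst (kan F x)"
abbreviation "inc F x \<equiv> fst (snd (kan F x))"
abbreviation "prj F x \<equiv> snd (snd (kan F x))"

section \<open>The universal properties of a single value\<close>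

context
  fixes F x
  assumes F: "cat_functor Y D F" and x: "x \<in> Obj X"
begin

interpretation F: cat_functor Y D F by (rule F)

lemma kan_data_kan: "kan_data Y S w X f D F x (P F x) (inc F x) (prj F x)"
proof -
  have "\<exists>k. kan_data Y S w X f D F x (fst k) (fst (snd k)) (snd (snd k))"
    using ex_kan_data[OF F x] by auto
  then show ?thesis unfolding kan_def by (rule someI_ex)
qed

lemma P_closed [simp]: "P F x \<in> Obj D"
  and inc_closed [simp]: "y \<in> Obj Y \<Longrightarrow> a \<in> Hom X (fo y) x \<Longrightarrow> inc F x y a \<in> Hom D (on_obj F y) (P F x)"
  and prj_closed [simp]: "y \<in> Obj Y \<Longrightarrow> a \<in> Hom X (fo y) x \<Longrightarrow> prj F x y a \<in> Hom D (P F x) (on_obj F y)"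
  using kan_data_kan unfolding kan_data_def by blast+

lemma inc_natural: "y \<in> Obj Y \<Longrightarrow> y' \<in> Obj Y \<Longrightarrow> b \<in> Hom Y y y' \<Longrightarrow> a \<in> Hom X (fo y') x \<Longrightarrow>
    Comp D (on_obj F y) (on_obj F y') (P F x) (inc F x y' a) (on_arr F y y' b) =
      inc F x y (Comp X (fo y) (fo y') x a (fa y y' b))"
  and prj_natural: "y \<in> Obj Y \<Longrightarrow> y' \<in> Obj Y \<Longrightarrow> b \<in> Hom Y y y' \<Longrightarrow> a \<in> Hom X (fo y') x \<Longrightarrow>
    Comp D (P F x) (on_obj F y) (on_obj F y') (on_arr F y y' b)
      (prj F x y (Comp X (fo y) (fo y') x a (fa y y' b))) = prj F x y' a"
  and prj_inc: "y \<in> Obj Y \<Longrightarrow> y' \<in> Obj Y \<Longrightarrow> a \<in> Hom X (fo y) x \<Longrightarrow> a' \<in> Hom X (fo y') x \<Longrightarrow>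
    Comp D (on_obj F y) (P F x) (on_obj F y') (prj F x y' a') (inc F x y a) =
      (\<Oplus>\<^bsub>Hom_space D (on_obj F y) (on_obj F y')\<^esub>
         b \<in> {b \<in> Hom Y y y'. Comp X (fo y) (fo y') x a' (fa y y' b) = a}. on_arr F y y' b)"
  using kan_data_kan unfolding kan_data_def by blast+

lemma sum_inc_prj: "(\<Oplus>\<^bsub>YF.D.hs (P F x) (P F x)\<^esub> k \<in> I x. w (fst k) \<odot>\<^bsub>YF.D.hs (P F x) (P F x)\<^esub>
    Comp D (P F x) (on_obj F (fst k)) (P F x) (inc F x (fst k) (snd k)) (prj F x (fst k) (snd k))) = Ident D (P F x)"
  using kan_data_kan unfolding kan_data_def by blast

text \<open>\<open>sum_inc_prj\<close> writes the identity of \<open>P F x\<close> as a combination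
  of arrows \<open>inc \<circ> prj\<close>, so an arrow out of \<open>P F x\<close> is a combination
  of its composites with \<open>inc\<close>, each taken after \<open>prj\<close>.\<close>

lemma inc_epi:
  assumes d [simp]: "d \<in> Obj D" and hk [simp]: "h \<in> Hom D (P F x) d" "k \<in> Hom D (P F x) d"
    and eq: "\<And>y a. y \<in> Obj Y \<Longrightarrow> a \<in> Hom X (fo y) x \<Longrightarrow>
      Comp D (on_obj F y) (P F x) d h (inc F x y a) = Comp D (on_obj F y) (P F x) d k (inc F x y a)"
  shows "h = k"
proof -
  let ?t = "\<lambda>h i. w (fst i) \<odot>\<^bsub>YF.D.hs (P F x) d\<^esub> Comp D (P F x) (on_obj F (fst i)) d
    (Comp D (on_obj F (fst i)) (P F x) d h (inc F x (fst i) (snd i))) (prj F x (fst i) (snd i))"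
  note [simp] = F x I_D[where x = x]
  have e: "h = (\<Oplus>\<^bsub>YF.D.hs (P F x) d\<^esub>i\<in>I x. ?t h i)" if [simp]: "h \<in> Hom D (P F x) d" for h
  proof -
    have "h = Comp D (P F x) (P F x) d h (Ident D (P F x))" by simp
    also have "\<dots> = (\<Oplus>\<^bsub>YF.D.hs (P F x) d\<^esub>i\<in>I x. Comp D (P F x) (P F x) d h (w (fst i) \<odot>\<^bsub>YF.D.hs (P F x) (P F x)\<^esub>
      Comp D (P F x) (on_obj F (fst i)) (P F x) (inc F x (fst i) (snd i)) (prj F x (fst i) (snd i))))"
      unfolding sum_inc_prj[symmetric] by (rule YF.D.Comp_finsum_right) auto
    also have "\<dots> = (\<Oplus>\<^bsub>YF.D.hs (P F x) d\<^esub>i\<in>I x. ?t h i)"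
      by (rule vs_finsum_cong) (auto simp: YF.D.Comp_assoc)
    finally show ?thesis .
  qed
  have "(\<Oplus>\<^bsub>YF.D.hs (P F x) d\<^esub>i\<in>I x. ?t h i) = (\<Oplus>\<^bsub>YF.D.hs (P F x) d\<^esub>i\<in>I x. ?t k i)"
    by (rule vs_finsum_cong) (auto simp: eq)
  then show ?thesis using e[OF hk(1)] e[OF hk(2)] by simp
qed

text \<open>Dual to \<open>inc_epi\<close>, from the same expression of the identity.\<close>

lemma prj_mono:
  assumes d [simp]: "d \<in> Obj D" and hk [simp]: "h \<in> Hom D d (P F x)" "k \<in> Hom D d (P F x)"
    and eq: "\<And>y a. y \<in> Obj Y \<Longrightarrow> a \<in> Hom X (fo y) x \<Longrightarrow>
      Comp D d (P F x) (on_obj F y) (prj F x y a) h = Comp D d (P F x) (on_obj F y) (prj F x y a) k"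
  shows "h = k"
proof -
  let ?t = "\<lambda>h i. w (fst i) \<odot>\<^bsub>YF.D.hs d (P F x)\<^esub> Comp D d (on_obj F (fst i)) (P F x)
    (inc F x (fst i) (snd i)) (Comp D d (P F x) (on_obj F (fst i)) (prj F x (fst i) (snd i)) h)"
  note [simp] = F x I_D[where x = x]
  have e: "h = (\<Oplus>\<^bsub>YF.D.hs d (P F x)\<^esub>i\<in>I x. ?t h i)" if [simp]: "h \<in> Hom D d (P F x)" for h
  proof -
    have "h = Comp D d (P F x) (P F x) (Ident D (P F x)) h" by simp
    also have "\<dots> = (\<Oplus>\<^bsub>YF.D.hs d (P F x)\<^esub>i\<in>I x. Comp D d (P F x) (P F x) (w (fst i) \<odot>\<^bsub>YF.D.hs (P F x) (P F x)\<^esub>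
      Comp D (P F x) (on_obj F (fst i)) (P F x) (inc F x (fst i) (snd i)) (prj F x (fst i) (snd i))) h)"
      unfolding sum_inc_prj[symmetric] by (rule YF.D.Comp_finsum_left) auto
    also have "\<dots> = (\<Oplus>\<^bsub>YF.D.hs d (P F x)\<^esub>i\<in>I x. ?t h i)"
      by (rule vs_finsum_cong) (auto simp: YF.D.Comp_assoc)
    finally show ?thesis .
  qed
  have "(\<Oplus>\<^bsub>YF.D.hs d (P F x)\<^esub>i\<in>I x. ?t h i) = (\<Oplus>\<^bsub>YF.D.hs d (P F x)\<^esub>i\<in>I x. ?t k i)"
    by (rule vs_finsum_cong) (auto simp: eq)
  then show ?thesis using e[OF hk(1)] e[OF hk(2)] by simp
qed

text \<open>The formula is forced: composing an \<open>h\<close> that satisfies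
  \<open>h \<circ> inc = m\<close> with the identity in the form \<open>sum_inc_prj\<close> gives
  this sum.\<close>

definition desc :: "'p \<Rightarrow> ('y \<Rightarrow> 'a \<Rightarrow> 'c) \<Rightarrow> 'c" where
  "desc d m = (\<Oplus>\<^bsub>YF.D.hs (P F x) d\<^esub>k\<in>I x. w (fst k) \<odot>\<^bsub>YF.D.hs (P F x) d\<^esub>
     Comp D (P F x) (on_obj F (fst k)) d (m (fst k) (snd k)) (prj F x (fst k) (snd k)))"

text \<open>Forced in the same way by \<open>prj \<circ> h = m\<close>.\<close>

definition lift :: "'p \<Rightarrow> ('y \<Rightarrow> 'a \<Rightarrow> 'c) \<Rightarrow> 'c" where
  "lift d m = (\<Oplus>\<^bsub>YF.D.hs d (P F x)\<^esub>k\<in>I x. w (fst k) \<odot>\<^bsub>YF.D.hs d (P F x)\<^esub>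
     Comp D d (on_obj F (fst k)) (P F x) (inc F x (fst k) (snd k)) (m (fst k) (snd k)))"

text \<open>By \<open>prj_inc\<close>, composing the term at \<open>k\<close> with
  \<open>inc\<close> at \<open>(y, a)\<close> gives a sum over the arrows \<open>b\<close> in
  \<open>?B k\<close>, and compatibility of \<open>m\<close> turns every summand into
  \<open>m y a\<close>. The total weight is 1 by \<open>count_from\<close>.\<close>

lemma desc:
  assumes d [simp]: "d \<in> Obj D"
    and m [simp]: "\<And>y a. y \<in> Obj Y \<Longrightarrow> a \<in> Hom X (fo y) x \<Longrightarrow> m y a \<in> Hom D (on_obj F y) d"
    and nat: "\<And>y y' b a. y \<in> Obj Y \<Longrightarrow> y' \<in> Obj Y \<Longrightarrow> b \<in> Hom Y y y' \<Longrightarrow> a \<in> Hom X (fo y') x \<Longrightarrow>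
      Comp D (on_obj F y) (on_obj F y') d (m y' a) (on_arr F y y' b) = m y (Comp X (fo y) (fo y') x a (fa y y' b))"
  shows desc_closed: "desc d m \<in> Hom D (P F x) d"
    and desc_inc: "y \<in> Obj Y \<Longrightarrow> a \<in> Hom X (fo y) x \<Longrightarrow> Comp D (on_obj F y) (P F x) d (desc d m) (inc F x y a) = m y a"
proof -
  note [simp] = F x I_D[where x = x]
  let ?t = "\<lambda>k. w (fst k) \<odot>\<^bsub>YF.D.hs (P F x) d\<^esub>
     Comp D (P F x) (on_obj F (fst k)) d (m (fst k) (snd k)) (prj F x (fst k) (snd k))"
  have t [simp]: "?t k \<in> Hom D (P F x) d" if "k \<in> I x" for k
    using that by simp
  show "desc d m \<in> Hom D (P F x) d"
    unfolding desc_def by (intro YF.D.hom_finsum_closed funcsetI t P_closed d)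
  assume y [simp]: "y \<in> Obj Y" and a [simp]: "a \<in> Hom X (fo y) x"
  let ?B = "\<lambda>k. {b \<in> Hom Y y (fst k). Comp X (fo y) (fo (fst k)) x (snd k) (fa y (fst k) b) = a}"
  have "Comp D (on_obj F y) (P F x) d (desc d m) (inc F x y a) =
      (\<Oplus>\<^bsub>YF.D.hs (on_obj F y) d\<^esub>k\<in>I x. Comp D (on_obj F y) (P F x) d (?t k) (inc F x y a))"
    unfolding desc_def by (rule YF.D.Comp_finsum_left) auto
  also have "\<dots> = (\<Oplus>\<^bsub>YF.D.hs (on_obj F y) d\<^esub>k\<in>I x. (w (fst k) * of_nat (card (?B k))) \<odot>\<^bsub>YF.D.hs (on_obj F y) d\<^esub> m y a)"
  proof (rule vs_finsum_cong)
    fix k assume k [simp]: "k \<in> I x"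
    have "Comp D (on_obj F y) (P F x) d (?t k) (inc F x y a) = w (fst k) \<odot>\<^bsub>YF.D.hs (on_obj F y) d\<^esub>
      Comp D (on_obj F y) (on_obj F (fst k)) d (m (fst k) (snd k))
        (\<Oplus>\<^bsub>YF.D.hs (on_obj F y) (on_obj F (fst k))\<^esub>b\<in>?B k. on_arr F y (fst k) b)"
      by (simp add: YF.D.Comp_assoc prj_inc)
    also have "Comp D (on_obj F y) (on_obj F (fst k)) d (m (fst k) (snd k))
        (\<Oplus>\<^bsub>YF.D.hs (on_obj F y) (on_obj F (fst k))\<^esub>b\<in>?B k. on_arr F y (fst k) b) =
      (\<Oplus>\<^bsub>YF.D.hs (on_obj F y) d\<^esub>b\<in>?B k. Comp D (on_obj F y) (on_obj F (fst k)) d (m (fst k) (snd k)) (on_arr F y (fst k) b))"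
      by (rule YF.D.Comp_finsum_right) auto
    also have "\<dots> = (\<Oplus>\<^bsub>YF.D.hs (on_obj F y) d\<^esub>b\<in>?B k. 1 \<odot>\<^bsub>YF.D.hs (on_obj F y) d\<^esub> m y a)"
      by (rule vs_finsum_cong) (auto simp: nat)
    also have "\<dots> = (\<Sum>b\<in>?B k. 1) \<odot>\<^bsub>YF.D.hs (on_obj F y) d\<^esub> m y a"
      by (rule vs_finsum_const_smult) auto
    finally show "Comp D (on_obj F y) (P F x) d (?t k) (inc F x y a) =
        (w (fst k) * of_nat (card (?B k))) \<odot>\<^bsub>YF.D.hs (on_obj F y) d\<^esub> m y a"
      by (simp add: vs_smult_smult)
  qed auto
  also have "\<dots> = (\<Sum>k\<in>I x. w (fst k) * of_nat (card (?B k))) \<odot>\<^bsub>YF.D.hs (on_obj F y) d\<^esub> m y a"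
    by (rule vs_finsum_const_smult) auto
  finally show "Comp D (on_obj F y) (P F x) d (desc d m) (inc F x y a) = m y a"
    by (simp add: count_from[OF x])
qed

text \<open>Dual computation: each arrow \<open>b\<close> into \<open>y\<close> contributes one copy
  of \<open>m y a\<close>, and \<open>count_into\<close> gives total weight 1.\<close>

lemma lift:
  assumes d [simp]: "d \<in> Obj D"
    and m [simp]: "\<And>y a. y \<in> Obj Y \<Longrightarrow> a \<in> Hom X (fo y) x \<Longrightarrow> m y a \<in> Hom D d (on_obj F y)"
    and nat: "\<And>y y' b a. y \<in> Obj Y \<Longrightarrow> y' \<in> Obj Y \<Longrightarrow> b \<in> Hom Y y y' \<Longrightarrow> a \<in> Hom X (fo y') x \<Longrightarrow>
      Comp D d (on_obj F y) (on_obj F y') (on_arr F y y' b) (m y (Comp X (fo y) (fo y') x a (fa y y' b))) = m y' a"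
  shows lift_closed: "lift d m \<in> Hom D d (P F x)"
    and prj_lift: "y \<in> Obj Y \<Longrightarrow> a \<in> Hom X (fo y) x \<Longrightarrow> Comp D d (P F x) (on_obj F y) (prj F x y a) (lift d m) = m y a"
proof -
  note [simp] = F x I_D[where x = x]
  let ?t = "\<lambda>k. w (fst k) \<odot>\<^bsub>YF.D.hs d (P F x)\<^esub>
     Comp D d (on_obj F (fst k)) (P F x) (inc F x (fst k) (snd k)) (m (fst k) (snd k))"
  have t [simp]: "?t k \<in> Hom D d (P F x)" if "k \<in> I x" for k
    using that by simp
  show "lift d m \<in> Hom D d (P F x)"
    unfolding lift_def by (intro YF.D.hom_finsum_closed funcsetI t P_closed d)
  assume y [simp]: "y \<in> Obj Y" and a [simp]: "a \<in> Hom X (fo y) x"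
  let ?B = "\<lambda>k. {b \<in> Hom Y (fst k) y. Comp X (fo (fst k)) (fo y) x a (fa (fst k) y b) = snd k}"
  have "Comp D d (P F x) (on_obj F y) (prj F x y a) (lift d m) =
      (\<Oplus>\<^bsub>YF.D.hs d (on_obj F y)\<^esub>k\<in>I x. Comp D d (P F x) (on_obj F y) (prj F x y a) (?t k))"
    unfolding lift_def by (rule YF.D.Comp_finsum_right) auto
  also have "\<dots> = (\<Oplus>\<^bsub>YF.D.hs d (on_obj F y)\<^esub>k\<in>I x. (w (fst k) * of_nat (card (?B k))) \<odot>\<^bsub>YF.D.hs d (on_obj F y)\<^esub> m y a)"
  proof (rule vs_finsum_cong)
    fix k assume k [simp]: "k \<in> I x"
    have "Comp D d (P F x) (on_obj F y) (prj F x y a) (?t k) = w (fst k) \<odot>\<^bsub>YF.D.hs d (on_obj F y)\<^esub>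
      Comp D d (on_obj F (fst k)) (on_obj F y)
        (\<Oplus>\<^bsub>YF.D.hs (on_obj F (fst k)) (on_obj F y)\<^esub>b\<in>?B k. on_arr F (fst k) y b) (m (fst k) (snd k))"
      by (simp add: prj_inc flip: YF.D.Comp_assoc)
    also have "Comp D d (on_obj F (fst k)) (on_obj F y)
        (\<Oplus>\<^bsub>YF.D.hs (on_obj F (fst k)) (on_obj F y)\<^esub>b\<in>?B k. on_arr F (fst k) y b) (m (fst k) (snd k)) =
      (\<Oplus>\<^bsub>YF.D.hs d (on_obj F y)\<^esub>b\<in>?B k. Comp D d (on_obj F (fst k)) (on_obj F y) (on_arr F (fst k) y b) (m (fst k) (snd k)))"
      by (rule YF.D.Comp_finsum_left) auto
    also have "\<dots> = (\<Oplus>\<^bsub>YF.D.hs d (on_obj F y)\<^esub>b\<in>?B k. 1 \<odot>\<^bsub>YF.D.hs d (on_obj F y)\<^esub> m y a)"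
    proof (rule vs_finsum_cong)
      fix b assume "b \<in> ?B k"
      then show "Comp D d (on_obj F (fst k)) (on_obj F y) (on_arr F (fst k) y b) (m (fst k) (snd k)) =
          1 \<odot>\<^bsub>YF.D.hs d (on_obj F y)\<^esub> m y a"
        using nat[of "fst k" y b a] by auto
    qed auto
    also have "\<dots> = (\<Sum>b\<in>?B k. 1) \<odot>\<^bsub>YF.D.hs d (on_obj F y)\<^esub> m y a"
      by (rule vs_finsum_const_smult) auto
    finally show "Comp D d (P F x) (on_obj F y) (prj F x y a) (?t k) =
        (w (fst k) * of_nat (card (?B k))) \<odot>\<^bsub>YF.D.hs d (on_obj F y)\<^esub> m y a"
      by (simp add: vs_smult_smult)
  qed auto
  also have "\<dots> = (\<Sum>k\<in>I x. w (fst k) * of_nat (card (?B k))) \<odot>\<^bsub>YF.D.hs d (on_obj F y)\<^esub> m y a"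
    by (rule vs_finsum_const_smult) auto
  finally show "Comp D d (P F x) (on_obj F y) (prj F x y a) (lift d m) = m y a"
    by (simp add: count_into[OF x])
qed

end

end

section \<open>Functoriality of the pushforward\<close>

context pushforward
begin

declare P_closed [simp] inc_closed [simp] prj_closed [simp]

abbreviation "g_inc F x x' g \<equiv> (\<lambda>y a. inc F x' y (Comp X (fo y) x x' g a))"

lemma g_inc_natural: "cat_functor Y D F \<Longrightarrow> x \<in> Obj X \<Longrightarrow> x' \<in> Obj X \<Longrightarrow> g \<in> Hom X x x' \<Longrightarrow>
    y \<in> Obj Y \<Longrightarrow> y' \<in> Obj Y \<Longrightarrow> b \<in> Hom Y y y' \<Longrightarrow> a \<in> Hom X (fo y') x \<Longrightarrow>
    Comp D (on_obj F y) (on_obj F y') (P F x') (g_inc F x x' g y' a) (on_arr F y y' b) =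
      g_inc F x x' g y (Comp X (fo y) (fo y') x a (fa y y' b))"
  by (simp add: inc_natural XF.Comp_assoc)

definition push_arr :: "('y, 'b, 'p, 'c) func \<Rightarrow> 'x \<Rightarrow> 'x \<Rightarrow> 'a \<Rightarrow> 'c" where
  "push_arr F x x' g = desc F x (P F x') (g_inc F x x' g)"

definition push_obj :: "('y, 'b, 'p, 'c) func \<Rightarrow> ('x, 'a, 'p, 'c) func" where
  "push_obj F = \<lparr>on_obj = (\<lambda>x\<in>Obj X. P F x),
     on_arr = (\<lambda>x\<in>Obj X. \<lambda>x'\<in>Obj X. \<lambda>g\<in>Hom X x x'. push_arr F x x' g)\<rparr>"

lemma push_obj_simps [simp]:
  "x \<in> Obj X \<Longrightarrow> on_obj (push_obj F) x = P F x"
  "x \<in> Obj X \<Longrightarrow> x' \<in> Obj X \<Longrightarrow> g \<in> Hom X x x' \<Longrightarrow> on_arr (push_obj F) x x' g = push_arr F x x' g"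
  by (simp_all add: push_obj_def)

context
  fixes F
  assumes F [simp]: "cat_functor Y D F"
begin

lemma push_arr_closed [simp]: "x \<in> Obj X \<Longrightarrow> x' \<in> Obj X \<Longrightarrow> g \<in> Hom X x x' \<Longrightarrow>
    push_arr F x x' g \<in> Hom D (P F x) (P F x')"
  unfolding push_arr_def by (rule desc_closed) (simp_all add: g_inc_natural)

lemma push_arr_inc: "x \<in> Obj X \<Longrightarrow> x' \<in> Obj X \<Longrightarrow> g \<in> Hom X x x' \<Longrightarrow> y \<in> Obj Y \<Longrightarrow> a \<in> Hom X (fo y) x \<Longrightarrow>
    Comp D (on_obj F y) (P F x) (P F x') (push_arr F x x' g) (inc F x y a) = inc F x' y (Comp X (fo y) x x' g a)"
  unfolding push_arr_def by (rule desc_inc) (simp_all add: g_inc_natural)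

text \<open>The arrow induced on colimits is also the one induced on limits. Tested against
  \<open>inc\<close>, both sides are sums over the same set of arrows \<open>b\<close>, because the
  invertible \<open>g\<close> cancels.\<close>

lemma prj_push_arr:
  assumes [simp]: "x \<in> Obj X" "x' \<in> Obj X" "g \<in> Hom X x x'" "y \<in> Obj Y" "a \<in> Hom X (fo y) x"
  shows "Comp D (P F x) (P F x') (on_obj F y) (prj F x' y (Comp X (fo y) x x' g a)) (push_arr F x x' g) = prj F x y a"
proof (rule inc_epi[OF F])
  fix y' a' assume [simp]: "y' \<in> Obj Y" "a' \<in> Hom X (fo y') x"
  have "{b \<in> Hom Y y' y. Comp X (fo y') (fo y) x' (Comp X (fo y) x x' g a) (fa y' y b) = Comp X (fo y') x x' g a'} =
      {b \<in> Hom Y y' y. Comp X (fo y') (fo y) x a (fa y' y b) = a'}"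
    using bij_betw_imp_inj_on[OF XF.bij_comp_left[of "fo y'" x x' g]]
    by (auto simp: XF.Comp_assoc inj_on_eq_iff)
  then show "Comp D (on_obj F y') (P F x) (on_obj F y)
      (Comp D (P F x) (P F x') (on_obj F y) (prj F x' y (Comp X (fo y) x x' g a)) (push_arr F x x' g)) (inc F x y' a') =
    Comp D (on_obj F y') (P F x) (on_obj F y) (prj F x y a) (inc F x y' a')"
    by (simp add: YF.D.Comp_assoc push_arr_inc prj_inc)
qed simp_all

lemma prj_push_arr':
  assumes [simp]: "x \<in> Obj X" "x' \<in> Obj X" "g \<in> Hom X x x'" "y \<in> Obj Y" "a \<in> Hom X (fo y) x'"
  shows "Comp D (P F x) (P F x') (on_obj F y) (prj F x' y a) (push_arr F x x' g) =
    prj F x y (Comp X (fo y) x' x (XF.ginv x x' g) a)"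
proof -
  have g [simp]: "XF.ginv x x' g \<in> Hom X x' x" by (simp add: XF.ginv)
  have "Comp X (fo y) x x' g (Comp X (fo y) x' x (XF.ginv x x' g) a) = a"
    by (simp add: XF.ginv flip: XF.Comp_assoc)
  then show ?thesis
    using prj_push_arr[of x x' g y "Comp X (fo y) x' x (XF.ginv x x' g) a"] by simp
qed

lemma push_obj_functor [simp]: "cat_functor X D (push_obj F)"
  unfolding push_obj_def
proof (rule cat_functorI)
  show "push_arr F x x (Ident X x) = Ident D (P F x)" if [simp]: "x \<in> Obj X" for x
    by (rule inc_epi[OF F, where x = x and d = "P F x"]) (simp_all add: push_arr_inc)
  show "push_arr F x z (Comp X x y z g h) = Comp D (P F x) (P F y) (P F z) (push_arr F y z g) (push_arr F x y h)"
    if [simp]: "x \<in> Obj X" "y \<in> Obj X" "z \<in> Obj X" "h \<in> Hom X x y" "g \<in> Hom X y z" for x y z g h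
    by (rule inc_epi[OF F, where x = x and d = "P F z"]) (simp_all add: push_arr_inc XF.Comp_assoc YF.D.Comp_assoc)
qed (simp_all add: XF.category_axioms YF.D.category_axioms)

end

definition push_nat :: "('y, 'b, 'p, 'c) func \<Rightarrow> ('y, 'b, 'p, 'c) func \<Rightarrow> ('y \<Rightarrow> 'c) \<Rightarrow> 'x \<Rightarrow> 'c" where
  "push_nat F F' \<theta> = (\<lambda>x\<in>Obj X. desc F x (P F' x)
     (\<lambda>y a. Comp D (on_obj F y) (on_obj F' y) (P F' x) (inc F' x y a) (\<theta> y)))"

context
  fixes F F' \<theta>
  assumes F [simp]: "cat_functor Y D F" and F' [simp]: "cat_functor Y D F'" and \<theta>: "\<theta> \<in> nat_trans Y D F F'"
begin

lemma component_closed [simp]: "y \<in> Obj Y \<Longrightarrow> \<theta> y \<in> Hom D (on_obj F y) (on_obj F' y)"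
  using \<theta> by (rule nat_trans_arr)

lemma push_nat_natural: "x \<in> Obj X \<Longrightarrow> y \<in> Obj Y \<Longrightarrow> y' \<in> Obj Y \<Longrightarrow> b \<in> Hom Y y y' \<Longrightarrow> a \<in> Hom X (fo y') x \<Longrightarrow>
    Comp D (on_obj F y) (on_obj F y') (P F' x)
      (Comp D (on_obj F y') (on_obj F' y') (P F' x) (inc F' x y' a) (\<theta> y')) (on_arr F y y' b) =
    Comp D (on_obj F y) (on_obj F' y) (P F' x) (inc F' x y (Comp X (fo y) (fo y') x a (fa y y' b))) (\<theta> y)"
  by (simp add: YF.D.Comp_assoc nat_trans_natural[OF \<theta>]) (simp flip: YF.D.Comp_assoc add: inc_natural)

lemma push_nat_closed [simp]: "x \<in> Obj X \<Longrightarrow> push_nat F F' \<theta> x \<in> Hom D (P F x) (P F' x)"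
  unfolding push_nat_def restrict_apply
  by (simp, rule desc_closed) (simp_all add: push_nat_natural)

lemma push_nat_inc: "x \<in> Obj X \<Longrightarrow> y \<in> Obj Y \<Longrightarrow> a \<in> Hom X (fo y) x \<Longrightarrow>
    Comp D (on_obj F y) (P F x) (P F' x) (push_nat F F' \<theta> x) (inc F x y a) =
    Comp D (on_obj F y) (on_obj F' y) (P F' x) (inc F' x y a) (\<theta> y)"
  unfolding push_nat_def restrict_apply
  by (simp, rule desc_inc) (simp_all add: push_nat_natural)

text \<open>The same agreement of colimit and limit for a natural transformation: tested against
  \<open>inc\<close>, \<open>\<theta>\<close> is moved across the sum over \<open>b\<close> by
  naturality.\<close>

lemma prj_push_nat:
  assumes [simp]: "x \<in> Obj X" "y \<in> Obj Y" "a \<in> Hom X (fo y) x"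
  shows "Comp D (P F x) (P F' x) (on_obj F' y) (prj F' x y a) (push_nat F F' \<theta> x) =
    Comp D (P F x) (on_obj F y) (on_obj F' y) (\<theta> y) (prj F x y a)"
proof (rule inc_epi[OF F])
  fix y' a' assume [simp]: "y' \<in> Obj Y" "a' \<in> Hom X (fo y') x"
  let ?B = "{b \<in> Hom Y y' y. Comp X (fo y') (fo y) x a (fa y' y b) = a'}"
  have "Comp D (on_obj F y') (P F x) (on_obj F' y)
      (Comp D (P F x) (P F' x) (on_obj F' y) (prj F' x y a) (push_nat F F' \<theta> x)) (inc F x y' a') =
    Comp D (on_obj F y') (on_obj F' y') (on_obj F' y)
      (\<Oplus>\<^bsub>YF.D.hs (on_obj F' y') (on_obj F' y)\<^esub>b\<in>?B. on_arr F' y' y b) (\<theta> y')"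
    by (simp add: YF.D.Comp_assoc push_nat_inc) (simp add: prj_inc flip: YF.D.Comp_assoc)
  also have "\<dots> = (\<Oplus>\<^bsub>YF.D.hs (on_obj F y') (on_obj F' y)\<^esub>b\<in>?B.
      Comp D (on_obj F y') (on_obj F' y') (on_obj F' y) (on_arr F' y' y b) (\<theta> y'))"
    by (rule YF.D.Comp_finsum_left) auto
  also have "\<dots> = (\<Oplus>\<^bsub>YF.D.hs (on_obj F y') (on_obj F' y)\<^esub>b\<in>?B.
      Comp D (on_obj F y') (on_obj F y) (on_obj F' y) (\<theta> y) (on_arr F y' y b))"
    by (rule vs_finsum_cong) (auto simp: nat_trans_natural[OF \<theta>])
  also have "\<dots> = Comp D (on_obj F y') (on_obj F y) (on_obj F' y) (\<theta> y)
      (\<Oplus>\<^bsub>YF.D.hs (on_obj F y') (on_obj F y)\<^esub>b\<in>?B. on_arr F y' y b)"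
    by (rule YF.D.Comp_finsum_right[symmetric]) auto
  also have "\<dots> = Comp D (on_obj F y') (P F x) (on_obj F' y)
      (Comp D (P F x) (on_obj F y) (on_obj F' y) (\<theta> y) (prj F x y a)) (inc F x y' a')"
    by (simp add: YF.D.Comp_assoc prj_inc)
  finally show "Comp D (on_obj F y') (P F x) (on_obj F' y)
      (Comp D (P F x) (P F' x) (on_obj F' y) (prj F' x y a) (push_nat F F' \<theta> x)) (inc F x y' a') =
    Comp D (on_obj F y') (P F x) (on_obj F' y)
      (Comp D (P F x) (on_obj F y) (on_obj F' y) (\<theta> y) (prj F x y a)) (inc F x y' a')" .
qed simp_all

lemma push_nat_trans: "push_nat F F' \<theta> \<in> nat_trans X D (push_obj F) (push_obj F')"
proof (rule nat_transI)
  fix x x' g assume [simp]: "x \<in> Obj X" "x' \<in> Obj X" "g \<in> Hom X x x'"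
  have "Comp D (P F x) (P F x') (P F' x') (push_nat F F' \<theta> x') (push_arr F x x' g) =
      Comp D (P F x) (P F' x) (P F' x') (push_arr F' x x' g) (push_nat F F' \<theta> x)"
  proof (rule inc_epi[OF F])
    fix y a assume [simp]: "y \<in> Obj Y" "a \<in> Hom X (fo y) x"
    show "Comp D (on_obj F y) (P F x) (P F' x') (Comp D (P F x) (P F x') (P F' x') (push_nat F F' \<theta> x') (push_arr F x x' g)) (inc F x y a) =
        Comp D (on_obj F y) (P F x) (P F' x') (Comp D (P F x) (P F' x) (P F' x') (push_arr F' x x' g) (push_nat F F' \<theta> x)) (inc F x y a)"
      by (simp add: YF.D.Comp_assoc push_arr_inc push_nat_inc) (simp add: push_arr_inc flip: YF.D.Comp_assoc)
  qed simp_all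
  then show "Comp D (on_obj (push_obj F) x) (on_obj (push_obj F) x') (on_obj (push_obj F') x') (push_nat F F' \<theta> x') (on_arr (push_obj F) x x' g) =
      Comp D (on_obj (push_obj F) x) (on_obj (push_obj F') x) (on_obj (push_obj F') x') (on_arr (push_obj F') x x' g) (push_nat F F' \<theta> x)"
    by simp
next
  show "push_nat F F' \<theta> \<in> extensional (Obj X)" by (simp add: push_nat_def)
qed simp_all

text \<open>The uniqueness half of the colimit property; functoriality and linearity of
  \<open>push\<close> are reduced to it.\<close>

lemma push_nat_eqI:
  assumes "\<kappa> \<in> extensional (Obj X)" "\<And>x. x \<in> Obj X \<Longrightarrow> \<kappa> x \<in> Hom D (P F x) (P F' x)"
    and "\<And>x y a. x \<in> Obj X \<Longrightarrow> y \<in> Obj Y \<Longrightarrow> a \<in> Hom X (fo y) x \<Longrightarrow>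
      Comp D (on_obj F y) (P F x) (P F' x) (\<kappa> x) (inc F x y a) =
      Comp D (on_obj F y) (on_obj F' y) (P F' x) (inc F' x y a) (\<theta> y)"
  shows "push_nat F F' \<theta> = \<kappa>"
proof (rule extensionalityI)
  show "push_nat F F' \<theta> \<in> extensional (Obj X)" by (simp add: push_nat_def)
  show "push_nat F F' \<theta> x = \<kappa> x" if "x \<in> Obj X" for x
    by (rule inc_epi[OF F that, where d = "P F' x"]) (use assms that in \<open>simp_all add: push_nat_inc\<close>)
qed (rule assms(1))

end

definition push :: "(('y, 'b, 'p, 'c) func, 'y \<Rightarrow> 'c, ('x, 'a, 'p, 'c) func, 'x \<Rightarrow> 'c) func" where
  "push = \<lparr>on_obj = (\<lambda>F \<in> Obj YF.Fun. push_obj F),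
     on_arr = (\<lambda>F \<in> Obj YF.Fun. \<lambda>F' \<in> Obj YF.Fun. \<lambda>\<theta> \<in> Hom YF.Fun F F'. push_nat F F' \<theta>)\<rparr>"

lemma push_simps [simp]:
  "cat_functor Y D F \<Longrightarrow> on_obj push F = push_obj F"
  "cat_functor Y D F \<Longrightarrow> cat_functor Y D F' \<Longrightarrow> \<theta> \<in> nat_trans Y D F F' \<Longrightarrow> on_arr push F F' \<theta> = push_nat F F' \<theta>"
  by (simp_all add: push_def)

lemma push_functor: "cat_functor YF.Fun XF.Fun push"
  unfolding push_def
proof (rule cat_functorI)
  fix F G H \<eta> \<theta>
  assume "F \<in> Obj YF.Fun" "G \<in> Obj YF.Fun" "H \<in> Obj YF.Fun" "\<eta> \<in> Hom YF.Fun F G" "\<theta> \<in> Hom YF.Fun G H"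
  then have F [simp]: "cat_functor Y D F" "cat_functor Y D G" "cat_functor Y D H"
    and \<eta>: "\<eta> \<in> nat_trans Y D F G" and \<theta>: "\<theta> \<in> nat_trans Y D G H" by simp_all
  note [simp] = nat_trans_arr[OF \<eta>] nat_trans_arr[OF \<theta>]
    push_nat_closed[OF _ _ \<eta>] push_nat_closed[OF _ _ \<theta>] push_nat_inc[OF _ _ \<eta>] push_nat_inc[OF _ _ \<theta>]
  have \<theta>\<eta>: "Comp YF.Fun F G H \<theta> \<eta> \<in> nat_trans Y D F H"
    using YF.nat_trans_Comp[OF F \<eta> \<theta>] by simp
  show "push_nat F H (Comp YF.Fun F G H \<theta> \<eta>) =
      Comp XF.Fun (push_obj F) (push_obj G) (push_obj H) (push_nat G H \<theta>) (push_nat F G \<eta>)"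
  proof (rule push_nat_eqI[OF _ _ \<theta>\<eta>])
    fix x y a assume [simp]: "x \<in> Obj X" "y \<in> Obj Y" "a \<in> Hom X (fo y) x"
    show "Comp D (on_obj F y) (P F x) (P H x)
        (Comp XF.Fun (push_obj F) (push_obj G) (push_obj H) (push_nat G H \<theta>) (push_nat F G \<eta>) x) (inc F x y a) =
      Comp D (on_obj F y) (on_obj H y) (P H x) (inc H x y a) (Comp YF.Fun F G H \<theta> \<eta> y)"
      by (simp add: YF.D.Comp_assoc) (simp flip: YF.D.Comp_assoc)
  qed simp_all
next
  fix F assume "F \<in> Obj YF.Fun"
  then have F [simp]: "cat_functor Y D F" by simp
  show "push_nat F F (Ident YF.Fun F) = Ident XF.Fun (push_obj F)"
    by (rule push_nat_eqI) (simp_all add: YF.nat_trans_Ident)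
qed (simp_all add: YF.category_Fun XF.category_Fun push_nat_trans)

lemma push_linear: "linear_functor YF.Fun XF.Fun push"
proof -
  interpret cat_functor YF.Fun XF.Fun push by (rule push_functor)
  show ?thesis
  proof unfold_locales
    fix F G assume "F \<in> Obj YF.Fun" "G \<in> Obj YF.Fun"
    then have F [simp]: "cat_functor Y D F" "cat_functor Y D G" by simp_all
    show "on_arr push F G \<in> lin_hom (YF.Fun.hs F G) (XF.Fun.hs (on_obj push F) (on_obj push G))"
    proof (rule lin_homI)
      fix \<eta> \<theta> assume "\<eta> \<in> carrier (YF.Fun.hs F G)" "\<theta> \<in> carrier (YF.Fun.hs F G)"
      then have \<eta>: "\<eta> \<in> nat_trans Y D F G" and \<theta>: "\<theta> \<in> nat_trans Y D F G" by simp_all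
      note [simp] = nat_trans_arr[OF \<eta>] nat_trans_arr[OF \<theta>]
        push_nat_closed[OF _ _ \<eta>] push_nat_closed[OF _ _ \<theta>] push_nat_inc[OF _ _ \<eta>] push_nat_inc[OF _ _ \<theta>]
      have sum: "\<eta> \<oplus>\<^bsub>YF.Fun.hs F G\<^esub> \<theta> \<in> nat_trans Y D F G"
        using YF.nat_trans_add[OF F \<eta> \<theta>] by simp
      have "push_nat F G (\<eta> \<oplus>\<^bsub>YF.Fun.hs F G\<^esub> \<theta>) =
          push_nat F G \<eta> \<oplus>\<^bsub>XF.Fun.hs (push_obj F) (push_obj G)\<^esub> push_nat F G \<theta>"
        by (rule push_nat_eqI[OF _ _ sum]) simp_all
      then show "on_arr push F G (\<eta> \<oplus>\<^bsub>YF.Fun.hs F G\<^esub> \<theta>) =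
          on_arr push F G \<eta> \<oplus>\<^bsub>XF.Fun.hs (on_obj push F) (on_obj push G)\<^esub> on_arr push F G \<theta>"
        using sum \<eta> \<theta> by (simp del: functor_category_simps(7))
    next
      fix c \<eta> assume "\<eta> \<in> carrier (YF.Fun.hs F G)"
      then have \<eta>: "\<eta> \<in> nat_trans Y D F G" by simp
      note [simp] = nat_trans_arr[OF \<eta>] push_nat_closed[OF _ _ \<eta>] push_nat_inc[OF _ _ \<eta>]
      have sm: "c \<odot>\<^bsub>YF.Fun.hs F G\<^esub> \<eta> \<in> nat_trans Y D F G"
        using YF.nat_trans_smult[OF F \<eta>] by simp
      have "push_nat F G (c \<odot>\<^bsub>YF.Fun.hs F G\<^esub> \<eta>) = c \<odot>\<^bsub>XF.Fun.hs (push_obj F) (push_obj G)\<^esub> push_nat F G \<eta>"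
        by (rule push_nat_eqI[OF _ _ sm]) simp_all
      then show "on_arr push F G (c \<odot>\<^bsub>YF.Fun.hs F G\<^esub> \<eta>) =
          c \<odot>\<^bsub>XF.Fun.hs (on_obj push F) (on_obj push G)\<^esub> on_arr push F G \<eta>"
        using sm \<eta> by (simp del: functor_category_simps(8))
    qed (simp add: push_nat_trans)
  qed
qed

subsection \<open>The two adjunctions\<close>

abbreviation pull :: "(('x, 'a, 'p, 'c) func, 'x \<Rightarrow> 'c, ('y, 'b, 'p, 'c) func, 'y \<Rightarrow> 'c) func" where
  "pull \<equiv> pullback Y X D f"

lemma pull_obj_functor [simp]: "cat_functor X D G \<Longrightarrow> cat_functor Y D (comp_functor Y G f)"
  by (rule cat_functor_comp[OF f.cat_functor_axioms])

lemma pull_simps [simp]: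
  "cat_functor X D G \<Longrightarrow> on_obj pull G = comp_functor Y G f"
  "cat_functor X D G \<Longrightarrow> cat_functor X D G' \<Longrightarrow> \<theta> \<in> nat_trans X D G G' \<Longrightarrow>
    on_arr pull G G' \<theta> = (\<lambda>y\<in>Obj Y. \<theta> (fo y))"
  by (simp_all add: pullback_def)

lemma pull_nat:
  assumes "\<theta> \<in> nat_trans X D G G'"
  shows "(\<lambda>y\<in>Obj Y. \<theta> (fo y)) \<in> nat_trans Y D (comp_functor Y G f) (comp_functor Y G' f)"
  by (rule nat_transI) (simp_all add: nat_trans_natural[OF assms] nat_trans_arr[OF assms])

lemma pull_functor: "cat_functor XF.Fun YF.Fun pull"
  unfolding pullback_def
  by (rule cat_functorI) (auto simp: YF.category_Fun XF.category_Fun pull_nat intro!: restrict_ext)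

lemma pull_linear: "linear_functor XF.Fun YF.Fun pull"
proof -
  interpret cat_functor XF.Fun YF.Fun pull by (rule pull_functor)
  show ?thesis
  proof unfold_locales
    fix F G assume "F \<in> Obj XF.Fun" "G \<in> Obj XF.Fun"
    then have F [simp]: "cat_functor X D F" "cat_functor X D G" by simp_all
    show "on_arr pull F G \<in> lin_hom (XF.Fun.hs F G) (YF.Fun.hs (on_obj pull F) (on_obj pull G))"
    proof (rule lin_homI)
      fix \<eta> \<theta> assume *: "\<eta> \<in> carrier (XF.Fun.hs F G)" "\<theta> \<in> carrier (XF.Fun.hs F G)"
      then show "on_arr pull F G (\<eta> \<oplus>\<^bsub>XF.Fun.hs F G\<^esub> \<theta>) =
          on_arr pull F G \<eta> \<oplus>\<^bsub>YF.Fun.hs (on_obj pull F) (on_obj pull G)\<^esub> on_arr pull F G \<theta>"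
        by (auto simp: XF.nat_trans_add intro!: restrict_ext)
    next
      fix c \<eta> assume *: "\<eta> \<in> carrier (XF.Fun.hs F G)"
      then show "on_arr pull F G (c \<odot>\<^bsub>XF.Fun.hs F G\<^esub> \<eta>) =
          c \<odot>\<^bsub>YF.Fun.hs (on_obj pull F) (on_obj pull G)\<^esub> on_arr pull F G \<eta>"
        by (auto simp: XF.nat_trans_smult intro!: restrict_ext)
    qed (simp add: pull_nat)
  qed
qed

end

context pushforward
begin

abbreviation "pb G \<equiv> comp_functor Y G f"

context
  fixes G
  assumes G [simp]: "cat_functor X D G"
begin

lemma pb_closed [simp]:
  "x \<in> Obj X \<Longrightarrow> y \<in> Obj Y \<Longrightarrow> a \<in> Hom X (fo y) x \<Longrightarrow> inc (pb G) x y a \<in> Hom D (on_obj G (fo y)) (P (pb G) x)"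
  "x \<in> Obj X \<Longrightarrow> y \<in> Obj Y \<Longrightarrow> a \<in> Hom X (fo y) x \<Longrightarrow> prj (pb G) x y a \<in> Hom D (P (pb G) x) (on_obj G (fo y))"
  using inc_closed[of "pb G" x y a] prj_closed[of "pb G" x y a] by simp_all

lemmas G_Comp = XF.functor_Comp[OF G]

text \<open>The counit of a left Kan extension, induced by the cocone of the arrows
  \<open>G a\<close>.\<close>

definition push_counit :: "'x \<Rightarrow> 'c" where
  "push_counit = (\<lambda>x\<in>Obj X. desc (pb G) x (on_obj G x) (\<lambda>y a. on_arr G (fo y) x a))"

text \<open>A right Kan extension is a limit over arrows \<open>x \<rightarrow> f y\<close>, while
  the index arrows here are \<open>a : f y \<rightarrow> x\<close>. Inverting \<open>a\<close>
  passes between the two, and so the cone uses the inverse.\<close>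

definition pull_unit :: "'x \<Rightarrow> 'c" where
  "pull_unit = (\<lambda>x\<in>Obj X. lift (pb G) x (on_obj G x) (\<lambda>y a. on_arr G x (fo y) (XF.ginv (fo y) x a)))"

lemma push_counit_closed [simp]: "x \<in> Obj X \<Longrightarrow> push_counit x \<in> Hom D (P (pb G) x) (on_obj G x)"
  unfolding push_counit_def restrict_apply
  by (simp, rule desc_closed) (simp_all add: G_Comp)

lemma push_counit_inc: "x \<in> Obj X \<Longrightarrow> y \<in> Obj Y \<Longrightarrow> a \<in> Hom X (fo y) x \<Longrightarrow>
    Comp D (on_obj G (fo y)) (P (pb G) x) (on_obj G x) (push_counit x) (inc (pb G) x y a) = on_arr G (fo y) x a"
  using desc_inc[of "pb G" x "on_obj G x" "\<lambda>y a. on_arr G (fo y) x a" y a]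
  by (simp add: push_counit_def G_Comp)

lemma pull_unit_closed [simp]: "x \<in> Obj X \<Longrightarrow> pull_unit x \<in> Hom D (on_obj G x) (P (pb G) x)"
  unfolding pull_unit_def restrict_apply
  by (simp, rule lift_closed) (simp_all add: G_Comp XF.ginv XF.ginv_comp_left)

lemma prj_pull_unit: "x \<in> Obj X \<Longrightarrow> y \<in> Obj Y \<Longrightarrow> a \<in> Hom X (fo y) x \<Longrightarrow>
    Comp D (on_obj G x) (P (pb G) x) (on_obj G (fo y)) (prj (pb G) x y a) (pull_unit x) =
    on_arr G x (fo y) (XF.ginv (fo y) x a)"
  using prj_lift[of "pb G" x "on_obj G x" "\<lambda>y a. on_arr G x (fo y) (XF.ginv (fo y) x a)" y a]
  by (simp add: pull_unit_def G_Comp XF.ginv XF.ginv_comp_left)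

lemma pb_push_arr_inc: "x \<in> Obj X \<Longrightarrow> x' \<in> Obj X \<Longrightarrow> g \<in> Hom X x x' \<Longrightarrow> y \<in> Obj Y \<Longrightarrow> a \<in> Hom X (fo y) x \<Longrightarrow>
    Comp D (on_obj G (fo y)) (P (pb G) x) (P (pb G) x') (push_arr (pb G) x x' g) (inc (pb G) x y a) =
      inc (pb G) x' y (Comp X (fo y) x x' g a)"
  using push_arr_inc[of "pb G" x x' g y a] by simp

lemma pb_prj_push_arr: "x \<in> Obj X \<Longrightarrow> x' \<in> Obj X \<Longrightarrow> g \<in> Hom X x x' \<Longrightarrow> y \<in> Obj Y \<Longrightarrow> a \<in> Hom X (fo y) x \<Longrightarrow>
    Comp D (P (pb G) x) (P (pb G) x') (on_obj G (fo y)) (prj (pb G) x' y (Comp X (fo y) x x' g a)) (push_arr (pb G) x x' g) =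
      prj (pb G) x y a"
  using prj_push_arr[of "pb G" x x' g y a] by simp

lemma push_counit_nat: "push_counit \<in> nat_trans X D (push_obj (pb G)) G"
proof (rule nat_transI)
  fix x x' g assume [simp]: "x \<in> Obj X" "x' \<in> Obj X" "g \<in> Hom X x x'"
  have "Comp D (P (pb G) x) (P (pb G) x') (on_obj G x') (push_counit x') (push_arr (pb G) x x' g) =
      Comp D (P (pb G) x) (on_obj G x) (on_obj G x') (on_arr G x x' g) (push_counit x)"
    by (rule inc_epi[of "pb G" x "on_obj G x'"])
      (simp_all add: YF.D.Comp_assoc pb_push_arr_inc push_counit_inc G_Comp)
  then show "Comp D (on_obj (push_obj (pb G)) x) (on_obj (push_obj (pb G)) x') (on_obj G x') (push_counit x')
      (on_arr (push_obj (pb G)) x x' g) =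
    Comp D (on_obj (push_obj (pb G)) x) (on_obj G x) (on_obj G x') (on_arr G x x' g) (push_counit x)"
    by simp
next
  show "push_counit \<in> extensional (Obj X)" by (simp add: push_counit_def)
qed simp

lemma pull_unit_nat: "pull_unit \<in> nat_trans X D G (push_obj (pb G))"
proof (rule nat_transI)
  fix x x' g assume [simp]: "x \<in> Obj X" "x' \<in> Obj X" "g \<in> Hom X x x'"
  have "Comp D (on_obj G x) (on_obj G x') (P (pb G) x') (pull_unit x') (on_arr G x x' g) =
      Comp D (on_obj G x) (P (pb G) x) (P (pb G) x') (push_arr (pb G) x x' g) (pull_unit x)"
  proof (rule prj_mono[of "pb G" x' "on_obj G x"])
    fix y a' assume y [simp]: "y \<in> Obj Y" and "a' \<in> Hom X (fo y) x'"
    \<comment> \<open>Composition with the invertible \<open>g\<close> is a bijection, so the index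
      at \<open>x'\<close> comes from one at \<open>x\<close>, as \<open>prj_push_arr\<close>
      demands.\<close>
    then obtain a where a' : "a' = Comp X (fo y) x x' g a" and [simp]: "a \<in> Hom X (fo y) x"
      using XF.bij_comp_left[of "fo y" x x' g] unfolding bij_betw_def by auto
    have 1: "Comp D (P (pb G) x) (P (pb G) x') (on_obj G (fo y)) (prj (pb G) x' y a') (push_arr (pb G) x x' g) = prj (pb G) x y a"
      using pb_prj_push_arr[of x x' g y a] by (simp add: a')
    have "Comp D (on_obj G x) (P (pb G) x') (on_obj G (fo y)) (prj (pb G) x' y a')
        (Comp D (on_obj G x) (on_obj G x') (P (pb G) x') (pull_unit x') (on_arr G x x' g)) =
      on_arr G x (fo y) (XF.ginv (fo y) x a)"
      by (simp add: a' prj_pull_unit G_Comp XF.ginv XF.ginv_comp_left flip: YF.D.Comp_assoc)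
    also have "\<dots> = Comp D (on_obj G x) (P (pb G) x') (on_obj G (fo y)) (prj (pb G) x' y a')
        (Comp D (on_obj G x) (P (pb G) x) (P (pb G) x') (push_arr (pb G) x x' g) (pull_unit x))"
      using 1 by (simp add: a' prj_pull_unit flip: YF.D.Comp_assoc)
    finally show "Comp D (on_obj G x) (P (pb G) x') (on_obj (pb G) y) (prj (pb G) x' y a')
        (Comp D (on_obj G x) (on_obj G x') (P (pb G) x') (pull_unit x') (on_arr G x x' g)) =
      Comp D (on_obj G x) (P (pb G) x') (on_obj (pb G) y) (prj (pb G) x' y a')
        (Comp D (on_obj G x) (P (pb G) x) (P (pb G) x') (push_arr (pb G) x x' g) (pull_unit x))"
      by simp
  qed simp_all
  then show "Comp D (on_obj G x) (on_obj G x') (on_obj (push_obj (pb G)) x') (pull_unit x') (on_arr G x x' g) =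
    Comp D (on_obj G x) (on_obj (push_obj (pb G)) x) (on_obj (push_obj (pb G)) x')
      (on_arr (push_obj (pb G)) x x' g) (pull_unit x)"
    by simp
next
  show "pull_unit \<in> extensional (Obj X)" by (simp add: pull_unit_def)
qed simp

end

context
  fixes F
  assumes F [simp]: "cat_functor Y D F"
begin

definition push_unit :: "'y \<Rightarrow> 'c" where
  "push_unit = (\<lambda>y\<in>Obj Y. inc F (fo y) y (Ident X (fo y)))"

definition pull_counit :: "'y \<Rightarrow> 'c" where
  "pull_counit = (\<lambda>y\<in>Obj Y. prj F (fo y) y (Ident X (fo y)))"

lemma push_unit_nat: "push_unit \<in> nat_trans Y D F (pb (push_obj F))"
  by (rule nat_transI) (simp_all add: push_unit_def inc_natural push_arr_inc)

lemma pull_counit_nat: "pull_counit \<in> nat_trans Y D (pb (push_obj F)) F"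
proof (rule nat_transI)
  fix y y' b assume [simp]: "y \<in> Obj Y" "y' \<in> Obj Y" "b \<in> Hom Y y y'"
  \<comment> \<open>By \<open>prj_push_arr'\<close> one side of naturality is the projection at the
    inverse of \<open>f b\<close>. Applying \<open>prj_natural\<close> at that index gives the other
    side, since the inverse composed with \<open>f b\<close> is the identity.\<close>
  have "Comp X (fo y) (fo y') (fo y) (XF.ginv (fo y) (fo y') (fa y y' b)) (fa y y' b) = Ident X (fo y)"
    by (simp add: XF.ginv)
  then have "Comp D (P F (fo y)) (on_obj F y) (on_obj F y') (on_arr F y y' b) (prj F (fo y) y (Ident X (fo y))) =
      prj F (fo y) y' (XF.ginv (fo y) (fo y') (fa y y' b))"
    using prj_natural[OF F, of "fo y" y y' b "XF.ginv (fo y) (fo y') (fa y y' b)"] by (simp add: XF.ginv)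
  then show "Comp D (on_obj (pb (push_obj F)) y) (on_obj (pb (push_obj F)) y') (on_obj F y') (pull_counit y')
      (on_arr (pb (push_obj F)) y y' b) =
    Comp D (on_obj (pb (push_obj F)) y) (on_obj F y) (on_obj F y') (on_arr F y y' b) (pull_counit y)"
    by (simp add: pull_counit_def prj_push_arr' XF.ginv)
qed (simp_all add: pull_counit_def)

end

text \<open>Equations between arrows out of a pushforward are tested against \<open>inc\<close>. The
  triangle identity on the pushforward becomes \<open>push_arr\<close> of \<open>a\<close> applied
  to the inclusion at an identity arrow, which is the inclusion at \<open>a\<close>.\<close>

lemma push_left_adjoint: "left_adjoint YF.Fun XF.Fun push pull"
proof -
  define \<eta> where "\<eta> = (\<lambda>F\<in>Obj YF.Fun. push_unit F)"
  define \<epsilon> where "\<epsilon> = (\<lambda>G\<in>Obj XF.Fun. push_counit G)"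
  have \<eta> [simp]: "\<eta> F = push_unit F" if "cat_functor Y D F" for F using that by (simp add: \<eta>_def)
  have \<epsilon> [simp]: "\<epsilon> G = push_counit G" if "cat_functor X D G" for G using that by (simp add: \<epsilon>_def)
  have \<eta>_nat: "\<eta> \<in> nat_trans YF.Fun YF.Fun (id_functor YF.Fun) (comp_functor YF.Fun pull push)"
    by (rule nat_transI)
      (simp add: push_unit_nat, simp add: \<eta>_def,
        auto simp: push_nat_trans push_unit_def push_nat_inc intro!: restrict_ext)
  have \<epsilon>_step: "Comp D (P (pb G) x) (P (pb G') x) (on_obj G' x) (push_counit G' x)
      (push_nat (pb G) (pb G') (\<lambda>y\<in>Obj Y. \<phi> (fo y)) x) =
    Comp D (P (pb G) x) (on_obj G x) (on_obj G' x) (\<phi> x) (push_counit G x)"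
    if G [simp]: "cat_functor X D G" "cat_functor X D G'" and \<phi>: "\<phi> \<in> nat_trans X D G G'"
      and x [simp]: "x \<in> Obj X" for G G' \<phi> x
  proof (rule inc_epi[of "pb G" x "on_obj G' x"])
    have pG: "cat_functor Y D (pb G)" "cat_functor Y D (pb G')" by simp_all
    note [simp] = nat_trans_arr[OF \<phi>] push_nat_closed[OF pG pull_nat[OF \<phi>]]
    let ?N = "push_nat (pb G) (pb G') (\<lambda>y\<in>Obj Y. \<phi> (fo y)) x"
    show "Comp D (P (pb G) x) (P (pb G') x) (on_obj G' x) (push_counit G' x) ?N \<in> Hom D (P (pb G) x) (on_obj G' x)"
      "Comp D (P (pb G) x) (on_obj G x) (on_obj G' x) (\<phi> x) (push_counit G x) \<in> Hom D (P (pb G) x) (on_obj G' x)"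
      by simp_all
    fix y a assume [simp]: "y \<in> Obj Y" "a \<in> Hom X (fo y) x"
    have 1: "Comp D (on_obj G (fo y)) (P (pb G) x) (P (pb G') x) ?N (inc (pb G) x y a) =
        Comp D (on_obj G (fo y)) (on_obj G' (fo y)) (P (pb G') x) (inc (pb G') x y a) (\<phi> (fo y))"
      using push_nat_inc[OF pG pull_nat[OF \<phi>], of x y a] by simp
    have "Comp D (on_obj G (fo y)) (P (pb G) x) (on_obj G' x)
        (Comp D (P (pb G) x) (P (pb G') x) (on_obj G' x) (push_counit G' x) ?N) (inc (pb G) x y a) =
      Comp D (on_obj G (fo y)) (on_obj G' (fo y)) (on_obj G' x) (on_arr G' (fo y) x a) (\<phi> (fo y))"
      by (simp add: YF.D.Comp_assoc 1) (simp add: push_counit_inc flip: YF.D.Comp_assoc)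
    then show "Comp D (on_obj (pb G) y) (P (pb G) x) (on_obj G' x)
        (Comp D (P (pb G) x) (P (pb G') x) (on_obj G' x) (push_counit G' x) ?N) (inc (pb G) x y a) =
      Comp D (on_obj (pb G) y) (P (pb G) x) (on_obj G' x)
        (Comp D (P (pb G) x) (on_obj G x) (on_obj G' x) (\<phi> x) (push_counit G x)) (inc (pb G) x y a)"
      by (simp add: YF.D.Comp_assoc[of "on_obj G (fo y)" "P (pb G) x" "on_obj G x"] push_counit_inc
        nat_trans_natural[OF \<phi>])
  qed simp_all
  have \<epsilon>_nat: "\<epsilon> \<in> nat_trans XF.Fun XF.Fun (comp_functor XF.Fun push pull) (id_functor XF.Fun)"
    by (rule nat_transI) (auto simp: push_counit_nat \<epsilon>_def pull_nat \<epsilon>_step intro!: restrict_ext)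
  have t1: "Comp XF.Fun (push_obj F) (push_obj (pb (push_obj F))) (push_obj F) (push_counit (push_obj F))
      (push_nat F (pb (push_obj F)) (push_unit F)) = Ident XF.Fun (push_obj F)"
    if F [simp]: "cat_functor Y D F" for F
  proof -
    let ?Q = "pb (push_obj F)" and ?\<epsilon> = "push_counit (push_obj F)"
    let ?N = "push_nat F ?Q (push_unit F)"
    have F': "cat_functor Y D ?Q" by simp
    note [simp] = push_nat_closed[OF F F' push_unit_nat[OF F]]
    have c [simp]: "?\<epsilon> x \<in> Hom D (P ?Q x) (P F x)" if "x \<in> Obj X" for x
      using push_counit_closed[of "push_obj F" x] that by simp
    have "Comp D (P F x) (P ?Q x) (P F x) (?\<epsilon> x) (?N x) = Ident D (P F x)" if [simp]: "x \<in> Obj X" for x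
    proof (rule inc_epi[OF F, where x = x and d = "P F x"])
      fix y a assume [simp]: "y \<in> Obj Y" "a \<in> Hom X (fo y) x"
      have [simp]: "push_unit F y \<in> Hom D (on_obj F y) (P F (fo y))" "inc ?Q x y a \<in> Hom D (P F (fo y)) (P ?Q x)"
        and 1: "Comp D (P F (fo y)) (P ?Q x) (P F x) (?\<epsilon> x) (inc ?Q x y a) = push_arr F (fo y) x a"
        and 2: "Comp D (on_obj F y) (P F x) (P ?Q x) (?N x) (inc F x y a) =
          Comp D (on_obj F y) (P F (fo y)) (P ?Q x) (inc ?Q x y a) (push_unit F y)"
        using nat_trans_arr[OF push_unit_nat[OF F], of y] pb_closed(1)[of "push_obj F" x y a]
          push_counit_inc[of "push_obj F" x y a] push_nat_inc[OF F F' push_unit_nat[OF F], of x y a] by simp_all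
      have "Comp D (on_obj F y) (P F x) (P F x) (Comp D (P F x) (P ?Q x) (P F x) (?\<epsilon> x) (?N x)) (inc F x y a) =
          Comp D (on_obj F y) (P F (fo y)) (P F x) (push_arr F (fo y) x a) (push_unit F y)"
        by (simp add: YF.D.Comp_assoc 2) (simp add: 1 flip: YF.D.Comp_assoc)
      then show "Comp D (on_obj F y) (P F x) (P F x) (Comp D (P F x) (P ?Q x) (P F x) (?\<epsilon> x) (?N x)) (inc F x y a) =
          Comp D (on_obj F y) (P F x) (P F x) (Ident D (P F x)) (inc F x y a)"
        by (simp add: push_unit_def push_arr_inc)
    qed simp_all
    then show ?thesis by (auto intro!: restrict_ext)
  qed
  have t2: "Comp YF.Fun (pb G) (pb (push_obj (pb G))) (pb G) (\<lambda>y\<in>Obj Y. push_counit G (fo y)) (push_unit (pb G)) =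
      Ident YF.Fun (pb G)" if G [simp]: "cat_functor X D G" for G
    by (auto intro!: restrict_ext simp: push_unit_def push_counit_inc)
  show ?thesis
    unfolding left_adjoint_def Let_def
    by (intro conjI bexI[OF _ \<eta>_nat] bexI[OF _ \<epsilon>_nat] ballI push_functor pull_functor)
      (use t1 t2 push_unit_nat push_counit_nat in \<open>simp_all del: functor_category_simps(3,4)\<close>)
qed

text \<open>Equations between arrows into a pushforward are tested against \<open>prj\<close>. The
  triangle identity on the pushforward becomes the projection at an identity arrow after
  \<open>push_arr\<close> of the inverse of \<open>a\<close>, which is the projection at
  \<open>a\<close>.\<close>

lemma push_right_adjoint: "left_adjoint XF.Fun YF.Fun pull push"
proof -
  define \<eta> where "\<eta> = (\<lambda>G\<in>Obj XF.Fun. pull_unit G)"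
  define \<epsilon> where "\<epsilon> = (\<lambda>F\<in>Obj YF.Fun. pull_counit F)"
  have \<eta> [simp]: "\<eta> G = pull_unit G" if "cat_functor X D G" for G using that by (simp add: \<eta>_def)
  have \<epsilon> [simp]: "\<epsilon> F = pull_counit F" if "cat_functor Y D F" for F using that by (simp add: \<epsilon>_def)
  have \<epsilon>_nat: "\<epsilon> \<in> nat_trans YF.Fun YF.Fun (comp_functor YF.Fun pull push) (id_functor YF.Fun)"
    by (rule nat_transI)
      (simp add: pull_counit_nat, simp add: \<epsilon>_def,
        auto simp: push_nat_trans pull_counit_def prj_push_nat intro!: restrict_ext)
  have \<eta>_step: "Comp D (on_obj G x) (on_obj G' x) (P (pb G') x) (pull_unit G' x) (\<phi> x) =
    Comp D (on_obj G x) (P (pb G) x) (P (pb G') x) (push_nat (pb G) (pb G') (\<lambda>y\<in>Obj Y. \<phi> (fo y)) x) (pull_unit G x)"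
    if G [simp]: "cat_functor X D G" "cat_functor X D G'" and \<phi>: "\<phi> \<in> nat_trans X D G G'"
      and x [simp]: "x \<in> Obj X" for G G' \<phi> x
  proof (rule prj_mono[of "pb G'" x "on_obj G x"])
    have pG: "cat_functor Y D (pb G)" "cat_functor Y D (pb G')" by simp_all
    note [simp] = nat_trans_arr[OF \<phi>] push_nat_closed[OF pG pull_nat[OF \<phi>]]
    let ?N = "push_nat (pb G) (pb G') (\<lambda>y\<in>Obj Y. \<phi> (fo y)) x"
    show "Comp D (on_obj G x) (on_obj G' x) (P (pb G') x) (pull_unit G' x) (\<phi> x) \<in> Hom D (on_obj G x) (P (pb G') x)"
      "Comp D (on_obj G x) (P (pb G) x) (P (pb G') x) ?N (pull_unit G x) \<in> Hom D (on_obj G x) (P (pb G') x)"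
      by simp_all
    fix y a assume [simp]: "y \<in> Obj Y" "a \<in> Hom X (fo y) x"
    have 1: "Comp D (P (pb G) x) (P (pb G') x) (on_obj G' (fo y)) (prj (pb G') x y a) ?N =
        Comp D (P (pb G) x) (on_obj G (fo y)) (on_obj G' (fo y)) (\<phi> (fo y)) (prj (pb G) x y a)"
      using prj_push_nat[OF pG pull_nat[OF \<phi>], of x y a] by simp
    have "Comp D (on_obj G x) (P (pb G') x) (on_obj G' (fo y)) (prj (pb G') x y a)
        (Comp D (on_obj G x) (P (pb G) x) (P (pb G') x) ?N (pull_unit G x)) =
      Comp D (on_obj G x) (on_obj G (fo y)) (on_obj G' (fo y)) (\<phi> (fo y)) (on_arr G x (fo y) (XF.ginv (fo y) x a))"
      by (simp add: 1 flip: YF.D.Comp_assoc) (simp add: prj_pull_unit YF.D.Comp_assoc)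
    then show "Comp D (on_obj G x) (P (pb G') x) (on_obj (pb G') y) (prj (pb G') x y a)
        (Comp D (on_obj G x) (on_obj G' x) (P (pb G') x) (pull_unit G' x) (\<phi> x)) =
      Comp D (on_obj G x) (P (pb G') x) (on_obj (pb G') y) (prj (pb G') x y a)
        (Comp D (on_obj G x) (P (pb G) x) (P (pb G') x) ?N (pull_unit G x))"
      by (simp add: prj_pull_unit nat_trans_natural[OF \<phi>] XF.ginv
        flip: YF.D.Comp_assoc[of "on_obj G x" "on_obj G' x" "P (pb G') x"])
  qed simp_all
  have \<eta>_nat: "\<eta> \<in> nat_trans XF.Fun XF.Fun (id_functor XF.Fun) (comp_functor XF.Fun push pull)"
    by (rule nat_transI) (auto simp: pull_unit_nat \<eta>_def pull_nat \<eta>_step intro!: restrict_ext)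
  have t2: "Comp XF.Fun (push_obj F) (push_obj (pb (push_obj F))) (push_obj F)
      (push_nat (pb (push_obj F)) F (pull_counit F)) (pull_unit (push_obj F)) = Ident XF.Fun (push_obj F)"
    if F [simp]: "cat_functor Y D F" for F
  proof -
    let ?Q = "pb (push_obj F)" and ?\<eta> = "pull_unit (push_obj F)"
    let ?N = "push_nat ?Q F (pull_counit F)"
    have F': "cat_functor Y D ?Q" by simp
    note [simp] = push_nat_closed[OF F' F pull_counit_nat[OF F]]
    have c [simp]: "?\<eta> x \<in> Hom D (P F x) (P ?Q x)" if "x \<in> Obj X" for x
      using pull_unit_closed[of "push_obj F" x] that by simp
    have "Comp D (P F x) (P ?Q x) (P F x) (?N x) (?\<eta> x) = Ident D (P F x)" if [simp]: "x \<in> Obj X" for x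
    proof (rule prj_mono[OF F, where x = x and d = "P F x"])
      fix y a assume [simp]: "y \<in> Obj Y" "a \<in> Hom X (fo y) x"
      have [simp]: "XF.ginv (fo y) x a \<in> Hom X x (fo y)" by (simp add: XF.ginv)
      have [simp]: "pull_counit F y \<in> Hom D (P F (fo y)) (on_obj F y)" "prj ?Q x y a \<in> Hom D (P ?Q x) (P F (fo y))"
        and 1: "Comp D (P F x) (P ?Q x) (P F (fo y)) (prj ?Q x y a) (?\<eta> x) = push_arr F x (fo y) (XF.ginv (fo y) x a)"
        and 2: "Comp D (P ?Q x) (P F x) (on_obj F y) (prj F x y a) (?N x) =
          Comp D (P ?Q x) (P F (fo y)) (on_obj F y) (pull_counit F y) (prj ?Q x y a)"
        using nat_trans_arr[OF pull_counit_nat[OF F], of y] pb_closed(2)[of "push_obj F" x y a]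
          prj_pull_unit[of "push_obj F" x y a] prj_push_nat[OF F' F pull_counit_nat[OF F], of x y a] by simp_all
      have "Comp D (P F x) (P F x) (on_obj F y) (prj F x y a) (Comp D (P F x) (P ?Q x) (P F x) (?N x) (?\<eta> x)) =
          Comp D (P F x) (P F (fo y)) (on_obj F y) (pull_counit F y) (push_arr F x (fo y) (XF.ginv (fo y) x a))"
        by (simp add: 2 flip: YF.D.Comp_assoc) (simp add: 1 YF.D.Comp_assoc)
      then show "Comp D (P F x) (P F x) (on_obj F y) (prj F x y a) (Comp D (P F x) (P ?Q x) (P F x) (?N x) (?\<eta> x)) =
          Comp D (P F x) (P F x) (on_obj F y) (prj F x y a) (Ident D (P F x))"
        using prj_push_arr[OF F, of x "fo y" "XF.ginv (fo y) x a" y a] by (simp add: pull_counit_def XF.ginv)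
    qed simp_all
    then show ?thesis by (auto intro!: restrict_ext)
  qed
  have ginv_Ident: "XF.ginv x x (Ident X x) = Ident X x" if [simp]: "x \<in> Obj X" for x
    using XF.ginv[of x x "Ident X x"] by simp
  have t1: "Comp YF.Fun (pb G) (pb (push_obj (pb G))) (pb G) (pull_counit (pb G)) (\<lambda>y\<in>Obj Y. pull_unit G (fo y)) =
      Ident YF.Fun (pb G)" if G [simp]: "cat_functor X D G" for G
    by (auto intro!: restrict_ext simp: pull_counit_def prj_pull_unit ginv_Ident)
  show ?thesis
    unfolding left_adjoint_def Let_def
    by (intro conjI bexI[OF _ \<eta>_nat] bexI[OF _ \<epsilon>_nat] ballI push_functor pull_functor)
      (use t1 t2 pull_counit_nat pull_unit_nat in \<open>simp_all del: functor_category_simps(3,4)\<close>)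
qed

end

subsection \<open>The category of vector spaces\<close>

lemma Vect_simps [simp]:
  "Obj Vect = {V. fd_space V}"
  "Hom Vect = linear_maps"
  "Ident Vect V = (\<lambda>v\<in>carrier V. v)"
  "Comp Vect U V W g f = compose (carrier U) g f"
  "carrier (Hom_space Vect V W) = linear_maps V W"
  "\<zero>\<^bsub>Hom_space Vect V W\<^esub> = (\<lambda>v\<in>carrier V. \<zero>\<^bsub>W\<^esub>)"
  "f \<oplus>\<^bsub>Hom_space Vect V W\<^esub> g = (\<lambda>v\<in>carrier V. f v \<oplus>\<^bsub>W\<^esub> g v)"
  "c \<odot>\<^bsub>Hom_space Vect V W\<^esub> f = (\<lambda>v\<in>carrier V. c \<odot>\<^bsub>W\<^esub> f v)"
  by (simp_all add: Vect_def)

lemma linear_mapsI: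
  assumes "cspace V" "f \<in> lin_hom V W"
  shows "(\<lambda>v\<in>carrier V. f v) \<in> linear_maps V W"
  using lin_hom_cong[OF assms, of "\<lambda>v\<in>carrier V. f v"] by (auto simp: linear_maps_def)

lemma linear_maps_lin_hom: "f \<in> linear_maps V W \<Longrightarrow> f \<in> lin_hom V W"
  by (simp add: linear_maps_def)

lemma linear_maps_closed: "f \<in> linear_maps V W \<Longrightarrow> v \<in> carrier V \<Longrightarrow> f v \<in> carrier W"
  by (rule lin_hom_closed[OF linear_maps_lin_hom])

lemma linear_maps_eqI:
  "f \<in> linear_maps V W \<Longrightarrow> g \<in> linear_maps V W' \<Longrightarrow> (\<And>v. v \<in> carrier V \<Longrightarrow> f v = g v) \<Longrightarrow> f = g"
  by (auto simp: linear_maps_def intro: extensionalityI)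

lemma linear_maps_compose:
  assumes "cspace U" "f \<in> linear_maps U V" "g \<in> linear_maps V W"
  shows "compose (carrier U) g f \<in> linear_maps U W"
  unfolding compose_def
  by (rule linear_mapsI[OF assms(1)]) (rule lin_hom_comp[OF linear_maps_lin_hom[OF assms(2)] linear_maps_lin_hom[OF assms(3)]])

text \<open>A finite spanning set determines a linear map, because the vectors it kills form a
  subspace.\<close>

lemma fd_space_linear_maps:
  fixes V W :: "(complex, 'v) module"
  assumes V: "fd_space V" and W: "fd_space W"
  shows "fd_space (Hom_space Vect V W)"
proof -
  have cV: "cspace V" and cW: "cspace W" using V W by (simp_all add: fd_space_cspace)
  interpret V: vectorspace class_ring V by (rule cV)
  obtain A where A: "finite A" "A \<subseteq> carrier V" "V.span A = carrier V"
    using V by (auto simp: fd_space_def V.fin_dim_def)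
  show ?thesis
  proof (rule fd_space_pointwise[where K = "carrier V" and V = "\<lambda>_. W" and K\<^sub>0 = A])
    show "carrier (Hom_space Vect V W) \<subseteq> carrier V \<rightarrow>\<^sub>E carrier W"
    proof
      fix f assume "f \<in> carrier (Hom_space Vect V W)"
      then have f: "f \<in> linear_maps V W" by simp
      then have "f \<in> extensional (carrier V)" by (simp add: linear_maps_def)
      with linear_maps_closed[OF f] show "f \<in> carrier V \<rightarrow>\<^sub>E carrier W" by (simp add: PiE_iff)
    qed
    fix f assume "f \<in> carrier (Hom_space Vect V W)" and zero: "\<And>a. a \<in> A \<Longrightarrow> f a = \<zero>\<^bsub>W\<^esub>"
    then have f: "f \<in> linear_maps V W" by simp
    note fl = linear_maps_lin_hom[OF f]
    have "submodule class_ring {v \<in> carrier V. f v = \<zero>\<^bsub>W\<^esub>} V"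
      by standard (use cV cW in \<open>auto simp: lin_hom_add[OF fl] lin_hom_smult[OF fl] lin_hom_zero[OF cV cW fl]\<close>)
    then have "V.span A \<subseteq> {v \<in> carrier V. f v = \<zero>\<^bsub>W\<^esub>}"
      using A(2) zero by (intro V.span_is_subset) auto
    then show "f = \<zero>\<^bsub>Hom_space Vect V W\<^esub>"
      using f A(3) by (auto intro!: extensionalityI[of f "carrier V"] simp: linear_maps_def)
  qed (use W cW cV A in \<open>auto intro!: linear_mapsI lin_hom_zero_fun lin_hom_add_fun lin_hom_smult_fun
      dest: linear_maps_lin_hom\<close>)
qed

lemma linear_category_Vect: "linear_category (Vect :: 'v vect_cat)"
proof unfold_locales
  fix V :: "(complex, 'v) module" assume "V \<in> Obj Vect"
  then show "Ident Vect V \<in> Hom Vect V V"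
    by (auto intro!: linear_mapsI lin_hom_id fd_space_cspace)
next
  fix U V W :: "(complex, 'v) module" and f g
  assume "U \<in> Obj Vect" "V \<in> Obj Vect" "W \<in> Obj Vect" "f \<in> Hom Vect U V" "g \<in> Hom Vect V W"
  then show "Comp Vect U V W g f \<in> Hom Vect U W"
    by (auto intro!: linear_maps_compose fd_space_cspace)
next
  fix V W :: "(complex, 'v) module" and f
  assume "V \<in> Obj Vect" "W \<in> Obj Vect" and f: "f \<in> Hom Vect V W"
  then show "Comp Vect V W W (Ident Vect W) f = f" "Comp Vect V V W f (Ident Vect V) = f"
    by (auto simp: linear_maps_def lin_hom_closed compose_eq intro!: extensionalityI[of _ "carrier V"])
next
  fix T U V W :: "(complex, 'v) module" and f g h
  assume "T \<in> Obj Vect" "U \<in> Obj Vect" "V \<in> Obj Vect" "W \<in> Obj Vect"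
    and "f \<in> Hom Vect T U" "g \<in> Hom Vect U V" "h \<in> Hom Vect V W"
  then show "Comp Vect T U W (Comp Vect U V W h g) f = Comp Vect T V W h (Comp Vect T U V g f)"
    by (auto simp: compose_def linear_maps_closed intro!: restrict_ext)
next
  fix V W :: "(complex, 'v) module" assume "V \<in> Obj Vect" "W \<in> Obj Vect"
  then show "carrier (Hom_space Vect V W) = Hom Vect V W" "fd_space (Hom_space Vect V W)"
    by (simp_all add: fd_space_linear_maps)
next
  fix U V W :: "(complex, 'v) module" and f
  assume *: "U \<in> Obj Vect" "V \<in> Obj Vect" "W \<in> Obj Vect" "f \<in> Hom Vect U V"
  then have f: "f \<in> linear_maps U V" by simp
  show "(\<lambda>g. Comp Vect U V W g f) \<in> lin_hom (Hom_space Vect V W) (Hom_space Vect U W)"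
  proof (rule lin_homI)
    show "Comp Vect U V W g f \<in> carrier (Hom_space Vect U W)" if "g \<in> carrier (Hom_space Vect V W)" for g
      using that * linear_maps_compose[OF _ f] by (simp add: fd_space_cspace)
  qed (auto simp: compose_def linear_maps_closed[OF f] intro!: restrict_ext)
next
  fix U V W :: "(complex, 'v) module" and g
  assume *: "U \<in> Obj Vect" "V \<in> Obj Vect" "W \<in> Obj Vect" "g \<in> Hom Vect V W"
  then have g: "g \<in> linear_maps V W" by simp
  note gl = linear_maps_lin_hom[OF g]
  show "(\<lambda>f. Comp Vect U V W g f) \<in> lin_hom (Hom_space Vect U V) (Hom_space Vect U W)"
  proof (rule lin_homI)
    show "Comp Vect U V W g f \<in> carrier (Hom_space Vect U W)" if "f \<in> carrier (Hom_space Vect U V)" for f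
      using that * linear_maps_compose[OF _ _ g] by (simp add: fd_space_cspace)
  qed (auto simp: compose_def linear_maps_closed lin_hom_add[OF gl] lin_hom_smult[OF gl] intro!: restrict_ext)
qed

interpretation Vect: linear_category Vect
  by (rule linear_category_Vect)

lemma eval_linear: "v \<in> carrier V \<Longrightarrow> (\<lambda>f. f v) \<in> lin_hom (Hom_space Vect V W) W"
  by (rule lin_homI) (auto simp: linear_maps_closed)

lemma regular_Vect: "linear_category.regular (Vect :: 'v vect_cat)"
  unfolding Vect.regular_def
proof (intro ballI)
  fix V W :: "(complex, 'v) module" and f
  assume "V \<in> Obj Vect" "W \<in> Obj Vect" and "f \<in> Hom Vect V W"
  then have V: "fd_space V" and W: "fd_space W" and f: "f \<in> linear_maps V W" by simp_all
  obtain g where g: "g \<in> lin_hom W V" "\<And>v. v \<in> carrier V \<Longrightarrow> f (g (f v)) = f v"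
    using lin_hom_pseudo_inverse[OF fd_space_cspace[OF V] W linear_maps_lin_hom[OF f]] by blast
  show "\<exists>g\<in>Hom Vect W V. Comp Vect V W W (Comp Vect W V W f g) f = f"
  proof (rule bexI)
    show "Comp Vect V W W (Comp Vect W V W f (\<lambda>w\<in>carrier W. g w)) f = f"
      using f g(2) by (auto simp: compose_def linear_maps_closed linear_maps_def lin_hom_closed
        intro!: extensionalityI[of _ "carrier V"])
  qed (simp add: linear_mapsI[OF fd_space_cspace[OF W] g(1)])
qed

lemma split_idempotents_Vect: "linear_category.split_idempotents (Vect :: 'v vect_cat)"
  unfolding Vect.split_idempotents_def
proof (intro ballI impI)
  fix V :: "(complex, 'v) module" and p
  assume "V \<in> Obj Vect" "p \<in> Hom Vect V V" and pp: "Comp Vect V V V p p = p"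
  then have V: "fd_space V" and p: "p \<in> linear_maps V V" by simp_all
  have cV: "cspace V" using V by (rule fd_space_cspace)
  interpret V: vectorspace class_ring V by (rule cV)
  note pl = linear_maps_lin_hom[OF p]
  have ppv: "p (p v) = p v" if "v \<in> carrier V" for v
    using fun_cong[OF pp, of v] that by (simp add: compose_def)
  \<comment> \<open>The image of \<open>p\<close>, realised as its fixed vectors: a subset of the
    carrier of \<open>V\<close>, hence a space in \<open>'v\<close> without any transport.\<close>
  define N where "N = {v \<in> carrier V. p v = v}"
  define W where "W = V\<lparr>carrier := N\<rparr>"
  have subm: "submodule class_ring N V"
    by standard (use cV in \<open>auto simp: N_def lin_hom_add[OF pl] lin_hom_smult[OF pl] lin_hom_zero[OF cV cV pl]\<close>)
  have cW: "cspace W"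
    using V.submodule_is_module[OF subm] by (simp add: W_def vectorspace_def class_field)
  have i: "(\<lambda>v. v) \<in> lin_hom W V"
    by (rule lin_homI) (auto simp: W_def N_def)
  have r: "p \<in> lin_hom V W"
    by (rule lin_homI) (auto simp: W_def N_def ppv lin_hom_closed[OF pl] lin_hom_add[OF pl] lin_hom_smult[OF pl])
  have W: "fd_space W"
    by (rule fd_space_inj[OF cW V i]) (simp add: W_def)
  show "\<exists>W\<in>Obj Vect. \<exists>i\<in>Hom Vect W V. \<exists>r\<in>Hom Vect V W.
      Comp Vect W V W r i = Ident Vect W \<and> Comp Vect V W V i r = p"
  proof (intro bexI conjI)
    show "W \<in> Obj Vect" using W by simp
    show "(\<lambda>v\<in>carrier W. v) \<in> Hom Vect W V" using linear_mapsI[OF cW i] by simp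
    show "p \<in> Hom Vect V W" using r p by (simp add: linear_maps_def)
    show "Comp Vect W V W p (\<lambda>v\<in>carrier W. v) = Ident Vect W"
      by (auto simp: compose_def W_def N_def intro!: restrict_ext)
    show "Comp Vect V W V (\<lambda>v\<in>carrier W. v) p = p"
      using p by (auto simp: compose_def W_def N_def ppv lin_hom_closed[OF pl] linear_maps_def intro!: extensionalityI[of _ "carrier V"])
  qed
qed

text \<open>\<open>P\<close> with coordinates \<open>c\<close> is a copy, inside the type \<open>'v\<close>, of the space \<open>W\<close> of families.\<close>

definition represents :: "'k set \<Rightarrow> ('k \<Rightarrow> (complex, 'v) module) \<Rightarrow> ('k \<Rightarrow> 'v) set \<Rightarrow> (complex, 'v) module \<Rightarrow> ('k \<Rightarrow> 'v \<Rightarrow> 'v) \<Rightarrow> bool" where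
  "represents K V W P c \<longleftrightarrow> fd_space P \<and> (\<forall>k\<in>K. c k \<in> lin_hom P (V k)) \<and>
     bij_betw (\<lambda>u. \<lambda>k\<in>K. c k u) (carrier P) W"

lemma ex_represents:
  fixes V :: "'k \<Rightarrow> (complex, 'v) module"
  assumes V: "\<And>k. k \<in> K \<Longrightarrow> fd_space (V k)"
    and sub: "W \<subseteq> (\<Pi>\<^sub>E k\<in>K. carrier (V k))"
    and zero: "(\<lambda>k\<in>K. \<zero>\<^bsub>V k\<^esub>) \<in> W"
    and add: "\<And>f g. f \<in> W \<Longrightarrow> g \<in> W \<Longrightarrow> (\<lambda>k\<in>K. f k \<oplus>\<^bsub>V k\<^esub> g k) \<in> W"
    and smult: "\<And>c f. f \<in> W \<Longrightarrow> (\<lambda>k\<in>K. c \<odot>\<^bsub>V k\<^esub> f k) \<in> W"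
    and K\<^sub>0: "finite K\<^sub>0" "K\<^sub>0 \<subseteq> K"
      "\<And>f k. f \<in> W \<Longrightarrow> k \<in> K \<Longrightarrow> (\<And>k. k \<in> K\<^sub>0 \<Longrightarrow> f k = \<zero>\<^bsub>V k\<^esub>) \<Longrightarrow> f k = \<zero>\<^bsub>V k\<^esub>"
  obtains P c where "represents K V W P c"
proof -
  obtain P :: "(complex, 'v) module" and \<tau> where P: "fd_space P" "bij_betw \<tau> (carrier P) W"
    "\<And>k. k \<in> K \<Longrightarrow> (\<lambda>u. \<tau> u k) \<in> lin_hom P (V k)"
    by (rule family_space[of K V W K\<^sub>0, OF V sub zero add smult K\<^sub>0(1,2)]) (auto intro: K\<^sub>0(3))
  have "(\<lambda>k\<in>K. \<tau> u k) = \<tau> u" if "u \<in> carrier P" for u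
  proof -
    have "\<tau> u \<in> (\<Pi>\<^sub>E k\<in>K. carrier (V k))" using bij_betwE[OF P(2)] that sub by auto
    then have "\<tau> u \<in> extensional K" by (simp add: PiE_iff)
    then show ?thesis by (rule extensional_restrict)
  qed
  then have "bij_betw (\<lambda>u. \<lambda>k\<in>K. \<tau> u k) (carrier P) W"
    using P(2) by (subst bij_betw_cong[where g = \<tau>]) auto
  then have "represents K V W P (\<lambda>k u. \<tau> u k)"
    using P by (simp add: represents_def)
  then show ?thesis by (rule that)
qed

context
  fixes K :: "'k set" and V :: "'k \<Rightarrow> (complex, 'v) module" and W P c
  assumes rep: "represents K V W P c"
begin

lemma represents_fd: "fd_space P"
  and represents_coord: "k \<in> K \<Longrightarrow> c k \<in> lin_hom P (V k)"
  using rep by (simp_all add: represents_def)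

lemma represents_eqI:
  assumes "u \<in> carrier P" "v \<in> carrier P" "\<And>k. k \<in> K \<Longrightarrow> c k u = c k v"
  shows "u = v"
proof -
  have "inj_on (\<lambda>u. \<lambda>k\<in>K. c k u) (carrier P)"
    using rep by (simp add: represents_def bij_betw_def)
  from inj_onD[OF this, of u v] show ?thesis using assms by (auto intro: restrict_ext)
qed

lemma represents_mem: "u \<in> carrier P \<Longrightarrow> (\<lambda>k\<in>K. c k u) \<in> W"
  using rep by (auto simp: represents_def bij_betw_def)

lemma represents_map:
  fixes U :: "(complex, 'v) module"
  assumes V: "\<And>k. k \<in> K \<Longrightarrow> cspace (V k)" and U: "cspace U"
    and m: "\<And>k. k \<in> K \<Longrightarrow> m k \<in> lin_hom U (V k)" "\<And>u. u \<in> carrier U \<Longrightarrow> (\<lambda>k\<in>K. m k u) \<in> W"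
  obtains h where "h \<in> linear_maps U P" "\<And>u k. u \<in> carrier U \<Longrightarrow> k \<in> K \<Longrightarrow> c k (h u) = m k u"
proof -
  have cP: "cspace P" using represents_fd by (rule fd_space_cspace)
  have "\<exists>p\<in>carrier P. (\<lambda>k\<in>K. c k p) = (\<lambda>k\<in>K. m k u)" if "u \<in> carrier U" for u
    using m(2)[OF that] rep unfolding represents_def bij_betw_def by (metis (no_types, lifting) imageE)
  then obtain h where h: "\<And>u. u \<in> carrier U \<Longrightarrow> h u \<in> carrier P"
    "\<And>u. u \<in> carrier U \<Longrightarrow> (\<lambda>k\<in>K. c k (h u)) = (\<lambda>k\<in>K. m k u)"
    by metis
  have ch: "c k (h u) = m k u" if "u \<in> carrier U" "k \<in> K" for u k
    using fun_cong[OF h(2)[OF that(1)], of k] that(2) by simp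
  have "h \<in> lin_hom U P"
  proof (rule lin_homI)
    show "h (u \<oplus>\<^bsub>U\<^esub> v) = h u \<oplus>\<^bsub>P\<^esub> h v" if "u \<in> carrier U" "v \<in> carrier U" for u v
      by (rule represents_eqI) (use that U cP h(1) ch in \<open>auto simp: lin_hom_add[OF represents_coord] lin_hom_add[OF m(1)]\<close>)
    show "h (a \<odot>\<^bsub>U\<^esub> u) = a \<odot>\<^bsub>P\<^esub> h u" if "u \<in> carrier U" for a u
      by (rule represents_eqI) (use that U cP h(1) ch in \<open>auto simp: lin_hom_smult[OF represents_coord] lin_hom_smult[OF m(1)]\<close>)
  qed (rule h(1))
  then have "(\<lambda>u\<in>carrier U. h u) \<in> linear_maps U P" by (rule linear_mapsI[OF U])
  then show ?thesis by (rule that) (simp add: ch)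
qed

end

text \<open>The product of the carriers consists of functions into \<open>'v\<close>, so a copy
  \<open>P\<close> of it inside \<open>'v\<close> takes its place, and equations of arrows into
  \<open>P\<close> are checked in the coordinates \<open>c\<close>.\<close>

lemma biproduct_Vect:
  fixes xs :: "nat \<Rightarrow> (complex, 'v) module"
  assumes xs: "\<And>k. k < n \<Longrightarrow> fd_space (xs k)"
  obtains B where "biproduct Vect n xs B"
proof -
  have cx: "cspace (xs k)" if "k < n" for k using xs[OF that] by (rule fd_space_cspace)
  let ?W = "\<Pi>\<^sub>E k\<in>{..<n}. carrier (xs k)"
  obtain P c where rep: "represents {..<n} xs ?W P c"
    by (rule ex_represents[of "{..<n}" xs ?W "{..<n}"]) (use xs cx in \<open>auto simp: PiE_iff\<close>)
  note cl = represents_coord[OF rep]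
  have P: "fd_space P" and cP: "cspace P"
    using represents_fd[OF rep] by (simp_all add: fd_space_cspace)
  define p where "p k = (\<lambda>u\<in>carrier P. c k u)" for k
  have p: "p k \<in> linear_maps P (xs k)" if "k < n" for k
    unfolding p_def by (rule linear_mapsI[OF cP cl]) (use that in simp)
  have "\<exists>h. h \<in> linear_maps (xs k) P \<and> (\<forall>v\<in>carrier (xs k). \<forall>j\<in>{..<n}. c j (h v) = (if j = k then v else \<zero>\<^bsub>xs j\<^esub>))"
    if k: "k < n" for k
  proof (rule represents_map[OF rep, of "xs k" "\<lambda>j v. if j = k then v else \<zero>\<^bsub>xs j\<^esub>"])
    show "(\<lambda>v. if j = k then v else \<zero>\<^bsub>xs j\<^esub>) \<in> lin_hom (xs k) (xs j)" if "j \<in> {..<n}" for j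
      using that cx by (cases "j = k") (auto intro: lin_hom_id lin_hom_zero_fun)
  qed (use k cx in \<open>auto simp: PiE_iff\<close>)
  then obtain i where i: "\<And>k. k < n \<Longrightarrow> i k \<in> linear_maps (xs k) P"
    and ci: "\<And>k v j. k < n \<Longrightarrow> v \<in> carrier (xs k) \<Longrightarrow> j < n \<Longrightarrow> c j (i k v) = (if j = k then v else \<zero>\<^bsub>xs j\<^esub>)"
    by (metis lessThan_iff)
  have "(\<Oplus>\<^bsub>Hom_space Vect P P\<^esub>k\<in>{..<n}. Comp Vect P (xs k) P (i k) (p k)) = Ident Vect P" (is "?l = ?r")
  proof (rule linear_maps_eqI)
    have t: "(\<lambda>k. Comp Vect P (xs k) P (i k) (p k)) \<in> {..<n} \<rightarrow> linear_maps P P"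
      using i p cP by (auto intro!: linear_maps_compose)
    then show "?l \<in> linear_maps P P" "?r \<in> linear_maps P P"
      using Vect.hom_finsum_closed[of P P] Vect.Ident_closed[of P] P by simp_all
    fix u assume u: "u \<in> carrier P"
    show "?l u = ?r u"
    proof (rule represents_eqI[OF rep])
      show "?l u \<in> carrier P" "?r u \<in> carrier P"
        using \<open>?l \<in> linear_maps P P\<close> u by (auto intro: linear_maps_closed)
      fix j assume j: "j \<in> {..<n}"
      have "c j (?l u) = (\<Oplus>\<^bsub>xs j\<^esub>k\<in>{..<n}. c j (Comp Vect P (xs k) P (i k) (p k) u))"
        by (rule lin_hom_finsum[OF _ _ lin_hom_comp[OF eval_linear[OF u] cl[OF j]]])
          (use P j cx t in \<open>auto intro: Vect.cspace_hs\<close>)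
      also have "\<dots> = c j (Comp Vect P (xs j) P (i j) (p j) u)"
        by (rule vs_finsum_single) (use u j cx ci in \<open>auto simp: compose_def p_def lin_hom_closed[OF cl]\<close>)
      also have "\<dots> = c j (?r u)"
        using u j ci by (simp add: compose_def p_def lin_hom_closed[OF cl])
      finally show "c j (?l u) = c j (?r u)" .
    qed
  qed
  moreover have "Comp Vect (xs k) P (xs j) (p j) (i k) = (if j = k then Ident Vect (xs k) else \<zero>\<^bsub>Hom_space Vect (xs k) (xs j)\<^esub>)"
    if "j < n" "k < n" for j k
    using that by (auto simp: compose_def p_def ci linear_maps_closed[OF i] intro!: restrict_ext)
  moreover have "\<forall>k<n. i k \<in> Hom Vect (xs k) P \<and> p k \<in> Hom Vect P (xs k)" "P \<in> Obj Vect"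
    using P i p by simp_all
  ultimately have "biproduct Vect n xs P"
    unfolding biproduct_def by blast
  then show ?thesis by (rule that)
qed

lemma additive_Vect: "additive_linear_category (Vect :: 'v vect_cat)"
proof unfold_locales
  show "\<exists>s. biproduct Vect n xs s" if "\<forall>k<n. xs k \<in> Obj Vect" for n and xs :: "nat \<Rightarrow> (complex, 'v) module"
    using biproduct_Vect[of n xs] that by auto
  \<comment> \<open>The empty biproduct is a zero space, available in every type
    \<open>'v\<close>.\<close>
  obtain Z where Z: "biproduct (Vect :: 'v vect_cat) 0 (\<lambda>_. undefined) Z"
    by (rule biproduct_Vect) auto
  then have ZO: "Z \<in> Obj Vect" by (simp add: biproduct_def)
  have "Ident Vect Z = \<zero>\<^bsub>Hom_space Vect Z Z\<^esub>"
    using Z vs_finsum_empty[OF Vect.cspace_hs[OF ZO ZO]] unfolding biproduct_def by auto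
  then have "zero_object Vect Z" by (rule zero_objectI[OF linear_category_Vect ZO])
  then show "\<exists>z. zero_object (Vect :: 'v vect_cat) z" by blast
qed

text \<open>If all spaces in \<open>'v\<close> are zero, any of them is a generator.\<close>

lemma ex_generator_Vect: "\<exists>V. linear_category.generator (Vect :: 'v vect_cat) V"
proof (cases "\<exists>V :: (complex, 'v) module. fd_space V \<and> (\<exists>v\<in>carrier V. v \<noteq> \<zero>\<^bsub>V\<^esub>)")
  case True
  then obtain V :: "(complex, 'v) module" and v where V: "fd_space V" and v: "v \<in> carrier V" "v \<noteq> \<zero>\<^bsub>V\<^esub>" by auto
  have cV: "cspace V" using V by (rule fd_space_cspace)
  obtain L where L: "separates V L"
    using fd_space_separates[OF V] .
  then obtain l where l: "l \<in> lin_hom V complex_line" "l v \<noteq> 0"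
    using v unfolding separates_def by blast
  have "Vect.generator V"
    unfolding Vect.generator_def
  proof (intro conjI ballI impI)
    show "V \<in> Obj Vect" using V by simp
    fix W :: "(complex, 'v) module" assume "W \<in> Obj Vect" and zero: "\<forall>h\<in>Hom Vect V W. h = \<zero>\<^bsub>Hom_space Vect V W\<^esub>"
    then have cW: "cspace W" by (simp add: fd_space_cspace)
    have "w = \<zero>\<^bsub>W\<^esub>" if w: "w \<in> carrier W" for w
    proof -
      \<comment> \<open>A map of rank at most one whose value at \<open>v\<close> is a nonzero
        multiple of \<open>w\<close>.\<close>
      have "(\<lambda>u\<in>carrier V. l u \<odot>\<^bsub>W\<^esub> w) = \<zero>\<^bsub>Hom_space Vect V W\<^esub>"
        using zero linear_mapsI[OF cV lin_hom_smult_vector[OF cV cW l(1) w]] by auto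
      from fun_cong[OF this, of v] have "l v \<odot>\<^bsub>W\<^esub> w = \<zero>\<^bsub>W\<^esub>"
        using v by simp
      then have "(1 / l v) \<odot>\<^bsub>W\<^esub> (l v \<odot>\<^bsub>W\<^esub> w) = \<zero>\<^bsub>W\<^esub>"
        using cW by simp
      then show ?thesis using cW w l(2) by (simp add: vs_smult_smult)
    qed
    then show "Ident Vect W = \<zero>\<^bsub>Hom_space Vect W W\<^esub>" by (auto intro!: restrict_ext)
  qed
  then show ?thesis by blast
next
  case False
  obtain Z :: "(complex, 'v) module" where "Z \<in> Obj Vect"
    using additive_linear_category.ex_zero_object[OF additive_Vect] unfolding zero_object_def by blast
  then have "Vect.generator Z"
    using False unfolding Vect.generator_def by (auto intro!: restrict_ext)
  then show ?thesis by blast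
qed

subsection \<open>Existence of the pushforward for vector spaces\<close>

context kan_context
begin

context
  fixes F x
  assumes F [simp]: "cat_functor Y D F" and x [simp]: "x \<in> Obj X"
begin

text \<open>The composite that \<open>kan_data\<close> prescribes for the cone at
  \<open>(y', a')\<close> after the cocone at \<open>(y, a)\<close>. It becomes the coordinate at
  \<open>(y', a')\<close> of the cocone.\<close>

definition fiber_sum :: "'y \<Rightarrow> 'a \<Rightarrow> 'y \<Rightarrow> 'a \<Rightarrow> 'c" where
  "fiber_sum y a y' a' = (\<Oplus>\<^bsub>YF.D.hs (on_obj F y) (on_obj F y')\<^esub>
     b \<in> {b \<in> Hom Y y y'. Comp X (fo y) (fo y') x a' (fa y y' b) = a}. on_arr F y y' b)"

lemma fiber_sum_closed [simp]: "y \<in> Obj Y \<Longrightarrow> y' \<in> Obj Y \<Longrightarrow> fiber_sum y a y' a' \<in> Hom D (on_obj F y) (on_obj F y')"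
  unfolding fiber_sum_def by (rule YF.D.hom_finsum_closed) auto

text \<open>Composition with \<open>c\<close> carries one index set of the sum bijectively to the
  other. For fixed \<open>(y, a)\<close> the fiber sums are thus a compatible family, which is why
  they define a map into the limit.\<close>

lemma fiber_sum_left:
  assumes [simp]: "y \<in> Obj Y" "y' \<in> Obj Y" "y'' \<in> Obj Y" "c \<in> Hom Y y' y''" "a'' \<in> Hom X (fo y'') x"
  shows "Comp D (on_obj F y) (on_obj F y') (on_obj F y'') (on_arr F y' y'' c)
    (fiber_sum y a y' (Comp X (fo y') (fo y'') x a'' (fa y' y'' c))) = fiber_sum y a y'' a''"
proof -
  let ?B = "{b \<in> Hom Y y y'. Comp X (fo y) (fo y') x (Comp X (fo y') (fo y'') x a'' (fa y' y'' c)) (fa y y' b) = a}"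
  let ?B' = "{d \<in> Hom Y y y''. Comp X (fo y) (fo y'') x a'' (fa y y'' d) = a}"
  have bij: "bij_betw (Comp Y y y' y'' c) (Hom Y y y') (Hom Y y y'')"
    by (rule YF.bij_comp_left) simp_all
  have eq: "Comp X (fo y) (fo y'') x a'' (fa y y'' (Comp Y y y' y'' c b)) =
      Comp X (fo y) (fo y') x (Comp X (fo y') (fo y'') x a'' (fa y' y'' c)) (fa y y' b)" if "b \<in> Hom Y y y'" for b
    using that by (simp add: f.on_arr_Comp XF.Comp_assoc)
  have img: "Comp Y y y' y'' c ` ?B = ?B'"
  proof
    show "Comp Y y y' y'' c ` ?B \<subseteq> ?B'" using eq by auto
    show "?B' \<subseteq> Comp Y y y' y'' c ` ?B"
    proof
      fix d assume d: "d \<in> ?B'"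
      then obtain b where "b \<in> Hom Y y y'" "d = Comp Y y y' y'' c b"
        using bij unfolding bij_betw_def by blast
      with d eq show "d \<in> Comp Y y y' y'' c ` ?B" by auto
    qed
  qed
  have "Comp D (on_obj F y) (on_obj F y') (on_obj F y'') (on_arr F y' y'' c)
      (fiber_sum y a y' (Comp X (fo y') (fo y'') x a'' (fa y' y'' c))) =
    (\<Oplus>\<^bsub>YF.D.hs (on_obj F y) (on_obj F y'')\<^esub>b\<in>?B.
      Comp D (on_obj F y) (on_obj F y') (on_obj F y'') (on_arr F y' y'' c) (on_arr F y y' b))"
    unfolding fiber_sum_def by (rule YF.D.Comp_finsum_right) auto
  also have "\<dots> = (\<Oplus>\<^bsub>YF.D.hs (on_obj F y) (on_obj F y'')\<^esub>b\<in>?B. on_arr F y y'' (Comp Y y y' y'' c b))"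
    by (rule vs_finsum_cong) (auto simp: YF.functor_Comp)
  also have "\<dots> = (\<Oplus>\<^bsub>YF.D.hs (on_obj F y) (on_obj F y'')\<^esub>d\<in>Comp Y y y' y'' c ` ?B. on_arr F y y'' d)"
    by (rule vs_finsum_reindex[symmetric])
      (use bij_betw_imp_inj_on[OF bij] in \<open>auto simp: inj_on_def\<close>)
  finally show ?thesis by (simp add: img fiber_sum_def)
qed

text \<open>The same reindexing on the other side, where cancelling \<open>f b\<close> in
  \<open>X\<close> matches the index sets. It yields the cocone condition for the map defined by the
  fiber sums.\<close>

lemma fiber_sum_right:
  assumes [simp]: "y \<in> Obj Y" "y' \<in> Obj Y" "y'' \<in> Obj Y" "b \<in> Hom Y y y'" "a' \<in> Hom X (fo y') x" "a'' \<in> Hom X (fo y'') x"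
  shows "Comp D (on_obj F y) (on_obj F y') (on_obj F y'') (fiber_sum y' a' y'' a'') (on_arr F y y' b) =
    fiber_sum y (Comp X (fo y) (fo y') x a' (fa y y' b)) y'' a''"
proof -
  let ?B = "{c \<in> Hom Y y' y''. Comp X (fo y') (fo y'') x a'' (fa y' y'' c) = a'}"
  let ?B' = "{d \<in> Hom Y y y''. Comp X (fo y) (fo y'') x a'' (fa y y'' d) = Comp X (fo y) (fo y') x a' (fa y y' b)}"
  let ?m = "\<lambda>c. Comp Y y y' y'' c b"
  have bij: "bij_betw ?m (Hom Y y' y'') (Hom Y y y'')"
    by (rule YF.bij_comp_right) simp_all
  have eq: "Comp X (fo y) (fo y'') x a'' (fa y y'' (?m c)) = Comp X (fo y) (fo y') x a' (fa y y' b) \<longleftrightarrow>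
      Comp X (fo y') (fo y'') x a'' (fa y' y'' c) = a'" if c [simp]: "c \<in> Hom Y y' y''" for c
  proof -
    have "Comp X (fo y) (fo y'') x a'' (fa y y'' (?m c)) =
        Comp X (fo y) (fo y') x (Comp X (fo y') (fo y'') x a'' (fa y' y'' c)) (fa y y' b)"
      by (simp add: f.on_arr_Comp XF.Comp_assoc)
    then show ?thesis
      using XF.comp_inj_right[of "fo y" "fo y'" x "fa y y' b" "Comp X (fo y') (fo y'') x a'' (fa y' y'' c)" a'] by auto
  qed
  have img: "?m ` ?B = ?B'"
  proof
    show "?m ` ?B \<subseteq> ?B'" using eq by auto
    show "?B' \<subseteq> ?m ` ?B"
    proof
      fix d assume d: "d \<in> ?B'"
      then obtain c where "c \<in> Hom Y y' y''" "d = ?m c"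
        using bij unfolding bij_betw_def by blast
      with d eq show "d \<in> ?m ` ?B" by auto
    qed
  qed
  have "Comp D (on_obj F y) (on_obj F y') (on_obj F y'') (fiber_sum y' a' y'' a'') (on_arr F y y' b) =
    (\<Oplus>\<^bsub>YF.D.hs (on_obj F y) (on_obj F y'')\<^esub>c\<in>?B.
      Comp D (on_obj F y) (on_obj F y') (on_obj F y'') (on_arr F y' y'' c) (on_arr F y y' b))"
    unfolding fiber_sum_def by (rule YF.D.Comp_finsum_left) auto
  also have "\<dots> = (\<Oplus>\<^bsub>YF.D.hs (on_obj F y) (on_obj F y'')\<^esub>c\<in>?B. on_arr F y y'' (?m c))"
    by (rule vs_finsum_cong) (auto simp: YF.functor_Comp)
  also have "\<dots> = (\<Oplus>\<^bsub>YF.D.hs (on_obj F y) (on_obj F y'')\<^esub>d\<in>?m ` ?B. on_arr F y y'' d)"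
    by (rule vs_finsum_reindex[symmetric])
      (use bij_betw_imp_inj_on[OF bij] in \<open>auto simp: inj_on_def\<close>)
  finally show ?thesis by (simp add: img fiber_sum_def)
qed

end

end

lemma ex_kan_data_Vect:
  fixes F :: "('y, 'b, (complex, 'v) module, 'v \<Rightarrow> 'v) func"
  assumes ctxt: "kan_context Y S w (Vect :: 'v vect_cat) X S' w' f"
    and F: "cat_functor Y Vect F" and x: "x \<in> Obj X"
  shows "\<exists>P \<iota> \<pi>. kan_data Y S w X f Vect F x P \<iota> \<pi>"
proof -
  interpret kan_context Y S w "Vect :: 'v vect_cat" X S' w' f by (rule ctxt)
  note [simp] = x
  have Fo: "fd_space (on_obj F y)" if "y \<in> Obj Y" for y
    using YF.obj[OF F that] by simp
  have cF [simp]: "cspace (on_obj F y)" if "y \<in> Obj Y" for y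
    using Fo[OF that] by (rule fd_space_cspace)
  have Fa: "on_arr F y y' b \<in> linear_maps (on_obj F y) (on_obj F y')"
    if "y \<in> Obj Y" "y' \<in> Obj Y" "b \<in> Hom Y y y'" for y y' b
    using YF.arr[OF F that] by simp
  note Fl = linear_maps_lin_hom[OF Fa]
  let ?K = "Sigma (Obj Y) (\<lambda>y. Hom X (fo y) x)" and ?V = "\<lambda>k. on_obj F (fst k)"
  define W where "W = {\<phi> \<in> \<Pi>\<^sub>E k\<in>?K. carrier (?V k). \<forall>y\<in>Obj Y. \<forall>y'\<in>Obj Y. \<forall>b\<in>Hom Y y y'. \<forall>a\<in>Hom X (fo y') x.
    on_arr F y y' b (\<phi> (y, Comp X (fo y) (fo y') x a (fa y y' b))) = \<phi> (y', a)}"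
  have WI: "(\<lambda>k\<in>?K. g k) \<in> W" if "\<And>y a. y \<in> Obj Y \<Longrightarrow> a \<in> Hom X (fo y) x \<Longrightarrow> g (y, a) \<in> carrier (on_obj F y)"
    "\<And>y y' b a. y \<in> Obj Y \<Longrightarrow> y' \<in> Obj Y \<Longrightarrow> b \<in> Hom Y y y' \<Longrightarrow> a \<in> Hom X (fo y') x \<Longrightarrow>
      on_arr F y y' b (g (y, Comp X (fo y) (fo y') x a (fa y y' b))) = g (y', a)" for g
    using that by (auto simp: W_def)
  have WD: "\<phi> (y, a) \<in> carrier (on_obj F y)" if "\<phi> \<in> W" "y \<in> Obj Y" "a \<in> Hom X (fo y) x" for \<phi> y a
    using that by (force simp: W_def PiE_iff)
  have Wn: "on_arr F y y' b (\<phi> (y, Comp X (fo y) (fo y') x a (fa y y' b))) = \<phi> (y', a)"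
    if "\<phi> \<in> W" "y \<in> Obj Y" "y' \<in> Obj Y" "b \<in> Hom Y y y'" "a \<in> Hom X (fo y') x" for \<phi> y y' b a
    using that by (simp add: W_def)
  obtain P c where rep: "represents ?K ?V W P c"
  proof (rule ex_represents[of ?K ?V W "I x"])
    show "W \<subseteq> (\<Pi>\<^sub>E k\<in>?K. carrier (?V k))" by (auto simp: W_def)
    show "(\<lambda>k\<in>?K. \<zero>\<^bsub>?V k\<^esub>) \<in> W"
      by (rule WI) (auto simp: lin_hom_zero[OF _ _ Fl])
    show "(\<lambda>k\<in>?K. \<phi> k \<oplus>\<^bsub>?V k\<^esub> \<psi> k) \<in> W" if "\<phi> \<in> W" "\<psi> \<in> W" for \<phi> \<psi>
      by (rule WI) (use that WD in \<open>auto simp: lin_hom_add[OF Fl] Wn\<close>)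
    show "(\<lambda>k\<in>?K. d \<odot>\<^bsub>?V k\<^esub> \<phi> k) \<in> W" if "\<phi> \<in> W" for d \<phi>
      by (rule WI) (use that WD in \<open>auto simp: lin_hom_smult[OF Fl] Wn\<close>)
    \<comment> \<open>The finite set \<open>I x\<close> determines a compatible family: an arrow
      \<open>b : s \<rightarrow> y\<close> with \<open>s \<in> S\<close> carries the value at
      \<open>(s, a \<circ> f b)\<close> to the value at \<open>(y, a)\<close>.\<close>
    show "\<phi> k = \<zero>\<^bsub>?V k\<^esub>" if \<phi>: "\<phi> \<in> W" and k: "k \<in> ?K" and zero: "\<And>k. k \<in> I x \<Longrightarrow> \<phi> k = \<zero>\<^bsub>?V k\<^esub>" for \<phi> k
    proof -
      obtain y a where ya: "k = (y, a)" "y \<in> Obj Y" "a \<in> Hom X (fo y) x" using k by auto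
      obtain s b where sb: "s \<in> S" "b \<in> Hom Y s y" using YF.ex_arrow[OF ya(2)] .
      have s: "s \<in> Obj Y" using sb(1) by (rule YF.S_Obj)
      have "on_arr F s y b (\<phi> (s, Comp X (fo s) (fo y) x a (fa s y b))) = \<zero>\<^bsub>on_obj F y\<^esub>"
        using zero[of "(s, Comp X (fo s) (fo y) x a (fa s y b))"] sb s ya lin_hom_zero[OF _ _ Fl[OF s ya(2) sb(2)]] by simp
      then show ?thesis using Wn[OF \<phi> s ya(2) sb(2) ya(3)] ya by simp
    qed
  qed (use Fo YF.finite_S XF.finite_Hom YF.S_Obj in auto)
  have cl: "c (y, a) \<in> lin_hom P (on_obj F y)" if "y \<in> Obj Y" "a \<in> Hom X (fo y) x" for y a
    using represents_coord[OF rep, of "(y, a)"] that by simp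
  have P: "fd_space P" and cP [simp]: "cspace P"
    using represents_fd[OF rep] by (simp_all add: fd_space_cspace)
  define \<pi> where "\<pi> y a = (\<lambda>u\<in>carrier P. c (y, a) u)" for y a
  have \<pi>: "\<pi> y a \<in> linear_maps P (on_obj F y)" if "y \<in> Obj Y" "a \<in> Hom X (fo y) x" for y a
    unfolding \<pi>_def by (rule linear_mapsI[OF cP cl[OF that]])
  let ?T = "fiber_sum F x"
  have T: "?T y a y' a' \<in> linear_maps (on_obj F y) (on_obj F y')" if "y \<in> Obj Y" "y' \<in> Obj Y" for y a y' a'
    using fiber_sum_closed[OF F x that] by simp
  \<comment> \<open>Construction of the cocone: the map into \<open>P\<close> whose coordinates are
    the fiber sums.\<close>
  have "\<exists>h. h \<in> linear_maps (on_obj F y) P \<and> (\<forall>v\<in>carrier (on_obj F y). \<forall>y'\<in>Obj Y. \<forall>a'\<in>Hom X (fo y') x.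
      c (y', a') (h v) = ?T y a y' a' v)" if ya: "y \<in> Obj Y" "a \<in> Hom X (fo y) x" for y a
  proof (rule represents_map[OF rep, of "on_obj F y" "\<lambda>k. ?T y a (fst k) (snd k)"])
    show "(\<lambda>k\<in>?K. ?T y a (fst k) (snd k) v) \<in> W" if v: "v \<in> carrier (on_obj F y)" for v
    proof (rule WI)
      fix y' y'' b a'' assume *: "y' \<in> Obj Y" "y'' \<in> Obj Y" "b \<in> Hom Y y' y''" "a'' \<in> Hom X (fo y'') x"
      have "compose (carrier (on_obj F y)) (on_arr F y' y'' b) (?T y a y' (Comp X (fo y') (fo y'') x a'' (fa y' y'' b))) =
          ?T y a y'' a''"
        using fiber_sum_left[OF F x ya(1) *] by simp
      from fun_cong[OF this, of v] v show "on_arr F y' y'' b (?T y a (fst (y', Comp X (fo y') (fo y'') x a'' (fa y' y'' b)))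
          (snd (y', Comp X (fo y') (fo y'') x a'' (fa y' y'' b))) v) = ?T y a (fst (y'', a'')) (snd (y'', a'')) v"
        by (simp add: compose_def)
    next
      fix y' a' assume "y' \<in> Obj Y" "a' \<in> Hom X (fo y') x"
      then show "?T y a (fst (y', a')) (snd (y', a')) v \<in> carrier (on_obj F y')"
        using linear_maps_closed[OF T[OF ya(1)] v] by simp
    qed
    show "?T y a (fst k) (snd k) \<in> lin_hom (on_obj F y) (?V k)" if "k \<in> ?K" for k
      using that by (intro linear_maps_lin_hom[OF T[OF ya(1)]]) auto
    show "\<exists>h. h \<in> linear_maps (on_obj F y) P \<and> (\<forall>v\<in>carrier (on_obj F y). \<forall>y'\<in>Obj Y. \<forall>a'\<in>Hom X (fo y') x.
        c (y', a') (h v) = ?T y a y' a' v)"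
      if h: "h \<in> linear_maps (on_obj F y) P"
        "\<And>u k. u \<in> carrier (on_obj F y) \<Longrightarrow> k \<in> ?K \<Longrightarrow> c k (h u) = ?T y a (fst k) (snd k) u" for h
      by (rule exI[of _ h]) (use h in simp)
  qed (use ya in auto)
  then obtain \<iota> where \<iota>: "\<And>y a. y \<in> Obj Y \<Longrightarrow> a \<in> Hom X (fo y) x \<Longrightarrow> \<iota> y a \<in> linear_maps (on_obj F y) P"
    and c\<iota>: "\<And>y a v y' a'. y \<in> Obj Y \<Longrightarrow> a \<in> Hom X (fo y) x \<Longrightarrow> v \<in> carrier (on_obj F y) \<Longrightarrow> y' \<in> Obj Y \<Longrightarrow>
      a' \<in> Hom X (fo y') x \<Longrightarrow> c (y', a') (\<iota> y a v) = ?T y a y' a' v"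
    by metis
  have P_eqI: "u = u'" if "u \<in> carrier P" "u' \<in> carrier P"
    "\<And>y a. y \<in> Obj Y \<Longrightarrow> a \<in> Hom X (fo y) x \<Longrightarrow> c (y, a) u = c (y, a) u'" for u u'
    by (rule represents_eqI[OF rep that(1,2)]) (use that(3) in auto)
  have i: "Comp Vect (on_obj F y) (on_obj F y') P (\<iota> y' a) (on_arr F y y' b) = \<iota> y (Comp X (fo y) (fo y') x a (fa y y' b))"
    if *: "y \<in> Obj Y" "y' \<in> Obj Y" "b \<in> Hom Y y y'" "a \<in> Hom X (fo y') x" for y y' b a
  proof (rule linear_maps_eqI)
    have a': "Comp X (fo y) (fo y') x a (fa y y' b) \<in> Hom X (fo y) x" using * by simp
    show l: "Comp Vect (on_obj F y) (on_obj F y') P (\<iota> y' a) (on_arr F y y' b) \<in> linear_maps (on_obj F y) P"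
      using linear_maps_compose[OF cF Fa \<iota>] * by simp
    show r: "\<iota> y (Comp X (fo y) (fo y') x a (fa y y' b)) \<in> linear_maps (on_obj F y) P"
      by (rule \<iota>[OF *(1) a'])
    fix v assume v: "v \<in> carrier (on_obj F y)"
    show "Comp Vect (on_obj F y) (on_obj F y') P (\<iota> y' a) (on_arr F y y' b) v = \<iota> y (Comp X (fo y) (fo y') x a (fa y y' b)) v"
    proof (rule P_eqI[OF linear_maps_closed[OF l v] linear_maps_closed[OF r v]])
      fix y'' a'' assume y'': "y'' \<in> Obj Y" "a'' \<in> Hom X (fo y'') x"
      have "compose (carrier (on_obj F y)) (?T y' a y'' a'') (on_arr F y y' b) = ?T y (Comp X (fo y) (fo y') x a (fa y y' b)) y'' a''"
        using fiber_sum_right[OF F x *(1,2) y''(1) *(3,4) y''(2)] by simp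
      from fun_cong[OF this, of v]
      show "c (y'', a'') (Comp Vect (on_obj F y) (on_obj F y') P (\<iota> y' a) (on_arr F y y' b) v) =
          c (y'', a'') (\<iota> y (Comp X (fo y) (fo y') x a (fa y y' b)) v)"
        using v * y'' a' linear_maps_closed[OF Fa v, of y' b] by (simp add: compose_def c\<iota>)
    qed
  qed
  have ii: "Comp Vect P (on_obj F y) (on_obj F y') (on_arr F y y' b) (\<pi> y (Comp X (fo y) (fo y') x a (fa y y' b))) = \<pi> y' a"
    if *: "y \<in> Obj Y" "y' \<in> Obj Y" "b \<in> Hom Y y y'" "a \<in> Hom X (fo y') x" for y y' b a
  proof -
    have "on_arr F y y' b (c (y, Comp X (fo y) (fo y') x a (fa y y' b)) u) = c (y', a) u" if u: "u \<in> carrier P" for u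
      using Wn[OF represents_mem[OF rep u] *] * by simp
    then show ?thesis by (auto simp: compose_def \<pi>_def intro!: restrict_ext)
  qed
  have iii: "Comp Vect (on_obj F y) P (on_obj F y') (\<pi> y' a') (\<iota> y a) = ?T y a y' a'"
    if *: "y \<in> Obj Y" "y' \<in> Obj Y" "a \<in> Hom X (fo y) x" "a' \<in> Hom X (fo y') x" for y y' a a'
    by (rule linear_maps_eqI[OF _ T])
      (use * linear_maps_compose[OF cF \<iota> \<pi>] linear_maps_closed[OF \<iota>] in \<open>simp_all add: compose_def \<pi>_def c\<iota>\<close>)
  \<comment> \<open>Checked in the coordinate \<open>(y, a)\<close>: since the family of
    \<open>u\<close> is compatible, the term at \<open>k\<close> contributes that coordinate of
    \<open>u\<close> once for each arrow in \<open>?B k\<close>, and \<open>count_into\<close> adds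
    up the weights.\<close>
  have iv: "(\<Oplus>\<^bsub>Hom_space Vect P P\<^esub> k \<in> I x. w (fst k) \<odot>\<^bsub>Hom_space Vect P P\<^esub>
      Comp Vect P (?V k) P (\<iota> (fst k) (snd k)) (\<pi> (fst k) (snd k))) = Ident Vect P" (is "?l = ?r")
  proof (rule linear_maps_eqI)
    let ?t = "\<lambda>k. w (fst k) \<odot>\<^bsub>Hom_space Vect P P\<^esub> Comp Vect P (?V k) P (\<iota> (fst k) (snd k)) (\<pi> (fst k) (snd k))"
    have PO: "P \<in> Obj Vect" using P by simp
    have "?t k \<in> Hom Vect P P" if "k \<in> I x" for k
    proof (rule Vect.hom_smult_closed[OF PO PO])
      have k: "fst k \<in> Obj Y" "snd k \<in> Hom X (fo (fst k)) x" using that by (auto simp: YF.S_Obj)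
      show "Comp Vect P (?V k) P (\<iota> (fst k) (snd k)) (\<pi> (fst k) (snd k)) \<in> Hom Vect P P"
        using linear_maps_compose[OF cP \<pi>[OF k] \<iota>[OF k]] by simp
    qed
    then have t: "?t \<in> I x \<rightarrow> Hom Vect P P" by auto
    show l: "?l \<in> linear_maps P P"
      using Vect.hom_finsum_closed[OF PO PO t] by simp
    show r: "?r \<in> linear_maps P P"
      using Vect.Ident_closed[OF PO] by simp
    fix u assume u: "u \<in> carrier P"
    show "?l u = ?r u"
    proof (rule P_eqI[OF linear_maps_closed[OF l u] linear_maps_closed[OF r u]])
      fix y a assume ya: "y \<in> Obj Y" "a \<in> Hom X (fo y) x"
      let ?B = "\<lambda>k. {b \<in> Hom Y (fst k) y. Comp X (fo (fst k)) (fo y) x a (fa (fst k) y b) = snd k}"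
      have cu: "c (y, a) u \<in> carrier (on_obj F y)" by (rule lin_hom_closed[OF cl[OF ya] u])
      have "c (y, a) (?l u) = (\<Oplus>\<^bsub>on_obj F y\<^esub>k\<in>I x. c (y, a) (?t k u))"
        by (rule lin_hom_finsum[OF _ _ lin_hom_comp[OF eval_linear[OF u] cl[OF ya]]])
          (use PO t ya in \<open>auto intro: Vect.cspace_hs\<close>)
      also have "\<dots> = (\<Oplus>\<^bsub>on_obj F y\<^esub>k\<in>I x. (w (fst k) * of_nat (card (?B k))) \<odot>\<^bsub>on_obj F y\<^esub> c (y, a) u)"
      proof (rule vs_finsum_cong)
        fix k assume k: "k \<in> I x"
        then have k': "fst k \<in> Obj Y" "snd k \<in> Hom X (fo (fst k)) x" by (auto simp: YF.S_Obj)
        have cku: "c (fst k, snd k) u \<in> carrier (?V k)" by (rule lin_hom_closed[OF cl[OF k'] u])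
        have e: "on_arr F (fst k) y b (c (fst k, snd k) u) = c (y, a) u" if "b \<in> ?B k" for b
          using Wn[OF represents_mem[OF rep u] k'(1) ya(1), of b a] that k' ya by auto
        have Bf: "(\<lambda>b. on_arr F (fst k) y b) \<in> ?B k \<rightarrow> carrier (Hom_space Vect (?V k) (on_obj F y))"
          using Fa k' ya by auto
        have "?T (fst k) (snd k) y a (c (fst k, snd k) u) =
            (\<Oplus>\<^bsub>on_obj F y\<^esub>b\<in>?B k. on_arr F (fst k) y b (c (fst k, snd k) u))"
          unfolding fiber_sum_def[OF F x]
          by (rule lin_hom_finsum[OF _ _ eval_linear[OF cku] Bf]) (use Fo k' ya in \<open>auto intro: Vect.cspace_hs\<close>)
        also have "\<dots> = (\<Oplus>\<^bsub>on_obj F y\<^esub>b\<in>?B k. 1 \<odot>\<^bsub>on_obj F y\<^esub> c (y, a) u)"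
          by (rule vs_finsum_cong) (use ya cu e in auto)
        also have "\<dots> = (\<Sum>b\<in>?B k. 1) \<odot>\<^bsub>on_obj F y\<^esub> c (y, a) u"
          by (rule vs_finsum_const_smult) (use ya cu in auto)
        finally have T': "?T (fst k) (snd k) y a (c (fst k, snd k) u) = of_nat (card (?B k)) \<odot>\<^bsub>on_obj F y\<^esub> c (y, a) u"
          by simp
        have "?t k u = w (fst k) \<odot>\<^bsub>P\<^esub> \<iota> (fst k) (snd k) (c (fst k, snd k) u)"
          using u by (simp add: compose_def \<pi>_def)
        then have "c (y, a) (?t k u) = w (fst k) \<odot>\<^bsub>on_obj F y\<^esub> ?T (fst k) (snd k) y a (c (fst k, snd k) u)"
          using cku k' ya linear_maps_closed[OF \<iota>[OF k'] cku] by (simp add: lin_hom_smult[OF cl] c\<iota>)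
        then show "c (y, a) (?t k u) = (w (fst k) * of_nat (card (?B k))) \<odot>\<^bsub>on_obj F y\<^esub> c (y, a) u"
          using ya cu T' by (simp add: vs_smult_smult)
      qed (use ya cu in auto)
      also have "\<dots> = (\<Sum>k\<in>I x. w (fst k) * of_nat (card (?B k))) \<odot>\<^bsub>on_obj F y\<^esub> c (y, a) u"
        by (rule vs_finsum_const_smult) (use ya cu in auto)
      also have "\<dots> = c (y, a) (?r u)"
        using count_into[OF x ya] ya cu u by simp
      finally show "c (y, a) (?l u) = c (y, a) (?r u)" .
    qed
  qed
  have "kan_data Y S w X f Vect F x P \<iota> \<pi>"
    unfolding kan_data_def
    using P \<iota> \<pi> i ii iii[unfolded fiber_sum_def[OF F x]] iv by (intro conjI ballI) simp_all
  then show ?thesis by blast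
qed

lemma pushforward_Vect:
  assumes "averaging Y S w" "averaging X S' w'" "cat_functor Y X f"
  shows "pushforward Y S w (Vect :: 'v vect_cat) X S' w' f"
proof -
  have 1: "kan_context Y S w (Vect :: 'v vect_cat) X S' w' f"
    using assms linear_category_Vect by (simp add: kan_context_def groupoid_functors_def)
  then show ?thesis
    using ex_kan_data_Vect[OF 1] by (intro pushforward.intro pushforward_axioms.intro)
qed

subsection \<open>Functor categories are 2-vector spaces\<close>

text \<open>If all arrows from \<open>push_obj \<Gamma>\<close> to \<open>G\<close> vanish, so do
  those from \<open>\<Gamma>\<close> to the pullback of \<open>G\<close>, by transposition. Then the
  identity of \<open>G\<close> is zero at the objects \<open>f y\<close>, among them all of
  \<open>S'\<close>, and hence everywhere by \<open>nat_trans_zeroI\<close>.\<close>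

lemma (in pushforward) push_generator:
  assumes gen: "YF.Fun.generator \<Gamma>" and S': "S' \<subseteq> fo ` Obj Y"
  shows "XF.Fun.generator (push_obj \<Gamma>)"
  unfolding XF.Fun.generator_def
proof (intro conjI ballI impI)
  have \<Gamma> [simp]: "cat_functor Y D \<Gamma>" using gen by (simp add: YF.Fun.generator_def)
  show "push_obj \<Gamma> \<in> Obj XF.Fun" by simp
  fix G assume "G \<in> Obj XF.Fun" and zero: "\<forall>h\<in>Hom XF.Fun (push_obj \<Gamma>) G. h = \<zero>\<^bsub>XF.Fun.hs (push_obj \<Gamma>) G\<^esub>"
  then have G [simp]: "cat_functor X D G" by simp
  have pG: "cat_functor Y D (pb G)" by simp
  have "\<alpha> = \<zero>\<^bsub>YF.Fun.hs \<Gamma> (pb G)\<^esub>" if \<alpha>: "\<alpha> \<in> nat_trans Y D \<Gamma> (pb G)" for \<alpha>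
  proof -
    \<comment> \<open>The transpose of \<open>\<alpha>\<close> under the adjunction; below,
      \<open>\<alpha>\<close> is recovered from it by composing with the inclusions at identity
      arrows.\<close>
    define h where "h = (\<lambda>x\<in>Obj X. Comp D (P \<Gamma> x) (P (pb G) x) (on_obj G x) (push_counit G x) (push_nat \<Gamma> (pb G) \<alpha> x))"
    have "h \<in> nat_trans X D (push_obj \<Gamma>) G"
      using XF.nat_trans_Comp[OF push_obj_functor[OF \<Gamma>] push_obj_functor[OF pG] G push_nat_trans[OF \<Gamma> pG \<alpha>] push_counit_nat[OF G]]
      by (simp add: h_def cong: restrict_cong)
    then have h0: "h x = \<zero>\<^bsub>YF.D.hs (P \<Gamma> x) (on_obj G x)\<^esub>" if "x \<in> Obj X" for x
      using zero that by auto
    have "\<alpha> y = \<zero>\<^bsub>YF.D.hs (on_obj \<Gamma> y) (on_obj G (fo y))\<^esub>" if [simp]: "y \<in> Obj Y" for y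
    proof -
      let ?i = "Ident X (fo y)"
      have [simp]: "\<alpha> y \<in> Hom D (on_obj \<Gamma> y) (on_obj G (fo y))"
        using nat_trans_arr[OF \<alpha>, of y] by simp
      note [simp] = push_nat_closed[OF \<Gamma> pG \<alpha>]
      have "\<alpha> y = Comp D (on_obj \<Gamma> y) (on_obj G (fo y)) (on_obj G (fo y))
          (Comp D (on_obj G (fo y)) (P (pb G) (fo y)) (on_obj G (fo y)) (push_counit G (fo y)) (inc (pb G) (fo y) y ?i)) (\<alpha> y)"
        by (simp add: push_counit_inc)
      also have "\<dots> = Comp D (on_obj \<Gamma> y) (P (pb G) (fo y)) (on_obj G (fo y)) (push_counit G (fo y))
          (Comp D (on_obj \<Gamma> y) (on_obj G (fo y)) (P (pb G) (fo y)) (inc (pb G) (fo y) y ?i) (\<alpha> y))"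
        by (simp add: YF.D.Comp_assoc)
      also have "Comp D (on_obj \<Gamma> y) (on_obj G (fo y)) (P (pb G) (fo y)) (inc (pb G) (fo y) y ?i) (\<alpha> y) =
          Comp D (on_obj \<Gamma> y) (P \<Gamma> (fo y)) (P (pb G) (fo y)) (push_nat \<Gamma> (pb G) \<alpha> (fo y)) (inc \<Gamma> (fo y) y ?i)"
        using push_nat_inc[OF \<Gamma> pG \<alpha>, of "fo y" y ?i] by simp
      also have "Comp D (on_obj \<Gamma> y) (P (pb G) (fo y)) (on_obj G (fo y)) (push_counit G (fo y)) \<dots> =
          Comp D (on_obj \<Gamma> y) (P \<Gamma> (fo y)) (on_obj G (fo y)) (h (fo y)) (inc \<Gamma> (fo y) y ?i)"
        by (simp add: h_def YF.D.Comp_assoc)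
      finally show ?thesis by (simp add: h0)
    qed
    then have "restrict (\<lambda>y. \<zero>\<^bsub>YF.D.hs (on_obj \<Gamma> y) (on_obj (pb G) y)\<^esub>) (Obj Y) = \<alpha>"
      by (intro nat_trans_restrictI[OF \<alpha>]) simp
    then show ?thesis by simp
  qed
  then have Ident0: "Ident YF.Fun (pb G) = \<zero>\<^bsub>YF.Fun.hs (pb G) (pb G)\<^esub>"
    using gen pG unfolding YF.Fun.generator_def by simp
  have id0: "Ident D (on_obj G (fo y)) = \<zero>\<^bsub>YF.D.hs (on_obj G (fo y)) (on_obj G (fo y))\<^esub>" if "y \<in> Obj Y" for y
    using fun_cong[OF Ident0, of y] that by simp
  have "(\<lambda>x\<in>Obj X. Ident D (on_obj G x)) x = \<zero>\<^bsub>YF.D.hs (on_obj G x) (on_obj G x)\<^esub>" if "x \<in> Obj X" for x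
    by (rule XF.nat_trans_zeroI[OF G G XF.nat_trans_Ident[OF G] _ that]) (use S' id0 XF.S_Obj in auto)
  then show "Ident XF.Fun G = \<zero>\<^bsub>XF.Fun.hs G G\<^esub>"
    by (auto intro!: restrict_ext)
qed

lemma averaging_discrete:
  assumes "category X" "finite S" "S \<subseteq> Obj X"
  shows "averaging (\<lparr>Obj = S, Hom = (\<lambda>s t. if s = t then {Ident X s} else {}), Ident = Ident X,
    Comp = Comp X\<rparr> :: ('x, 'a) cat) S (\<lambda>_. 1)" (is "averaging ?Z S _")
proof -
  interpret category X by fact
  have S: "s \<in> Obj X" if "s \<in> S" for s using assms(3) that by auto
  show ?thesis
    by unfold_locales
      (use assms(2) in \<open>auto simp: S Ident_closed Comp_Ident_left iso_arrow_def if_distrib cong: if_cong split: if_splits\<close>)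
qed

lemma two_vector_space_Fun_Vect:
  fixes X :: "('x, 'a) cat"
  assumes X: "groupoid X" "essentially_finite X"
  shows "two_vector_space (functor_category X (Vect :: 'v vect_cat))"
proof -
  obtain S w where av: "averaging X S w"
    using essentially_finite_averaging[OF X] .
  interpret averaging X S w by (rule av)
  \<comment> \<open>A constant functor on \<open>X\<close> itself would detect only what is
    invariant under automorphisms. On the discrete groupoid there are no nontrivial automorphisms,
    and its pushforward to \<open>X\<close> detects everything.\<close>
  define Z :: "('x, 'a) cat" where
    "Z = \<lparr>Obj = S, Hom = (\<lambda>s t. if s = t then {Ident X s} else {}), Ident = Ident X, Comp = Comp X\<rparr>"
  have Z [simp]: "Obj Z = S" "Hom Z s t = (if s = t then {Ident X s} else {})" "Ident Z = Ident X" "Comp Z = Comp X" for s t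
    by (simp_all add: Z_def)
  have avZ: "averaging Z S (\<lambda>_. 1)"
    unfolding Z_def by (rule averaging_discrete[OF category_axioms finite_S]) (use S_Obj in auto)
  define i :: "('x, 'a, 'x, 'a) func" where
    "i = \<lparr>on_obj = (\<lambda>s\<in>Obj Z. s), on_arr = (\<lambda>s\<in>Obj Z. \<lambda>t\<in>Obj Z. \<lambda>a\<in>Hom Z s t. a)\<rparr>"
  have i: "cat_functor Z X i"
    unfolding i_def
    by (rule cat_functorI)
      (use avZ in \<open>auto simp: averaging_def groupoid_def category_axioms S_Obj Ident_closed split: if_splits\<close>)
  interpret pushforward Z S "\<lambda>_. 1" "Vect :: 'v vect_cat" X S w i
    by (rule pushforward_Vect[OF avZ av i])
  obtain V where V: "Vect.generator (V :: (complex, 'v) module)"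
    using ex_generator_Vect by blast
  then have VO: "V \<in> Obj Vect" by (simp add: Vect.generator_def)
  have "YF.Fun.generator (YF.const_functor V)"
    unfolding YF.Fun.generator_def
  proof (intro conjI ballI impI)
    show \<Gamma>: "YF.const_functor V \<in> Obj YF.Fun" using YF.cat_functor_const[OF VO] by simp
    fix G assume "G \<in> Obj YF.Fun"
      and zero: "\<forall>h\<in>Hom YF.Fun (YF.const_functor V) G. h = \<zero>\<^bsub>YF.Fun.hs (YF.const_functor V) G\<^esub>"
    then have G: "cat_functor Z Vect G" by simp
    have "Ident Vect (on_obj G s) = \<zero>\<^bsub>Vect.hs (on_obj G s) (on_obj G s)\<^esub>" if s: "s \<in> S" for s
    proof -
      have "h = \<zero>\<^bsub>Vect.hs V (on_obj G s)\<^esub>" if h: "h \<in> Hom Vect V (on_obj G s)" for h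
      proof -
        \<comment> \<open>The extension of \<open>h\<close> by zero, natural because
          \<open>Z\<close> has only identity arrows.\<close>
        define \<alpha> where "\<alpha> = (\<lambda>t\<in>Obj Z. if t = s then h else \<zero>\<^bsub>Vect.hs V (on_obj G t)\<^esub>)"
        have \<alpha>c: "\<alpha> t \<in> Hom Vect V (on_obj G t)" if "t \<in> S" for t
          using that h Vect.hom_zero_closed[OF VO YF.obj[OF G, of t]] by (simp add: \<alpha>_def)
        have "\<alpha> \<in> nat_trans Z Vect (YF.const_functor V) G"
        proof (rule nat_transI)
          fix t u a assume "t \<in> Obj Z" "u \<in> Obj Z" "a \<in> Hom Z t u"
          then have tu: "t \<in> S" "u = t" "a = Ident X t" by (auto split: if_splits)
          then show "Comp Vect (on_obj (YF.const_functor V) t) (on_obj (YF.const_functor V) u) (on_obj G u) (\<alpha> u)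
              (on_arr (YF.const_functor V) t u a) =
            Comp Vect (on_obj (YF.const_functor V) t) (on_obj G t) (on_obj G u) (on_arr G t u a) (\<alpha> t)"
            using \<alpha>c[OF tu(1)] VO YF.obj[OF G, of t] YF.Ident'[OF G, of t]
            by (simp del: Vect_simps)
        qed (use \<alpha>c in \<open>auto simp: \<alpha>_def\<close>)
        then have "\<alpha> = \<zero>\<^bsub>YF.Fun.hs (YF.const_functor V) G\<^esub>" using zero by simp
        from fun_cong[OF this, of s] s show ?thesis by (simp add: \<alpha>_def)
      qed
      then show ?thesis
        using V YF.obj[OF G, of s] s unfolding Vect.generator_def by simp
    qed
    then show "Ident YF.Fun G = \<zero>\<^bsub>YF.Fun.hs G G\<^esub>"
      by (auto intro!: restrict_ext simp del: Vect_simps)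
  qed
  then have gen: "XF.Fun.generator (push_obj (YF.const_functor V))"
    by (rule push_generator) (simp add: i_def)
  interpret A: additive_linear_category XF.Fun
    by (rule XF.additive_Fun[OF additive_Vect])
  show ?thesis
    by (rule A.two_vector_spaceI[OF XF.regular_Fun[OF regular_Vect] XF.split_idempotents_Fun[OF split_idempotents_Vect] gen])
qed

theorem proposition4p2p1:
  fixes X :: "('x, 'a) cat" and Y :: "('y, 'b) cat"
    and f :: "('y, 'b, 'x, 'a) func"
  assumes X: "groupoid X" "essentially_finite X"
    and Y: "groupoid Y" "essentially_finite Y"
    and f: "cat_functor Y X f"
  shows "two_linear_map (functor_category X (Vect :: 'v vect_cat))
           (functor_category Y (Vect :: 'v vect_cat)) (pullback Y X Vect f) \<and>
         (\<exists>f_push.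
           two_linear_map (functor_category Y (Vect :: 'v vect_cat))
             (functor_category X (Vect :: 'v vect_cat)) f_push \<and>
           left_adjoint (functor_category Y (Vect :: 'v vect_cat))
             (functor_category X (Vect :: 'v vect_cat)) f_push (pullback Y X Vect f) \<and>
           left_adjoint (functor_category X (Vect :: 'v vect_cat))
             (functor_category Y (Vect :: 'v vect_cat)) (pullback Y X Vect f) f_push)"
proof -
  obtain S w S' w' where av: "averaging Y S w" "averaging X S' w'"
    using essentially_finite_averaging[OF X] essentially_finite_averaging[OF Y] by metis
  interpret pushforward Y S w "Vect :: 'v vect_cat" X S' w' f
    by (rule pushforward_Vect[OF av f])
  note tv = two_vector_space_Fun_Vect[OF X, where 'v = 'v] two_vector_space_Fun_Vect[OF Y, where 'v = 'v]
  have "two_linear_map XF.Fun YF.Fun pull" "two_linear_map YF.Fun XF.Fun push"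
    using tv pull_linear push_linear by (auto intro: two_linear_map.intro)
  with push_left_adjoint push_right_adjoint show ?thesis by blast
qed

end
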